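(* Assume SETH. Then for every integer $k\geq 2$, every algorithm that, given an undirected unweighted graph $G=(V,E)$ with $m$ edges and $S\subseteq V$, $T=V\setminus S$, whose Bichromatic Diameter $D_{ST}$ is promised to be either at most $2k-1$ or at least $4k-3$, distinguishes between these two cases, requires $m^{1+1/(k-1)-o(1)}$ time.
   Context: $d(u,v)$ denotes the shortest path distance; the Bichromatic Diameter is $D_{ST}=\max_{s\in S}\max_{t\in T}d(s,t)$ with $T=V\setminus S$. SETH: on a word-RAM with $O(\log n)$-bit words there is no constant $\varepsilon>0$ and (possibly randomized) algorithm running in $(2-\varepsilon)^n$ time deciding satisfiability of CNF formulas with $n$ variables and $O(n)$ clauses. *)

theory Defs
  imports
    "HOL-Probability.Probability"
    "HOL-Library.Landau_Symbols"
    "HOL-Library.Log_Nat"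
begin

unbundle bit_operations_syntax

text \<open>
  A randomized word-RAM. Words are natural numbers below \<open>2 ^ w\<close>, arithmetic is modulo \<open>2 ^ w\<close>,
  and memory is an array of words that is indexed by words. A program mentions finitely many registers. Control flow is
  structured; a program with jumps becomes a single loop that dispatches on a register holding the
  program counter, at the cost of a constant factor in time.
\<close>

datatype binop = ADD | SUB | MUL | DIV | MOD | BAND | BOR | BXOR | SHL | SHR | LESS | EQ

datatype instr =
    Const nat nat
  | Op binop nat nat nat
  | Load nat nat
  | Store nat nat
  | Rand nat
  | Cond nat "instr list" "instr list"
  | Loop nat "instr list"

type_synonym program = "instr list"

fun eval_op :: "nat \<Rightarrow> binop \<Rightarrow> nat \<Rightarrow> nat \<Rightarrow> nat" where
  "eval_op w ADD x y = (x + y) mod 2 ^ w"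
| "eval_op w SUB x y = nat ((int x - int y) mod 2 ^ w)"
| "eval_op w MUL x y = (x * y) mod 2 ^ w"
| "eval_op w DIV x y = x div y"
| "eval_op w MOD x y = x mod y"
| "eval_op w BAND x y = x AND y"
| "eval_op w BOR x y = x OR y"
| "eval_op w BXOR x y = x XOR y"
| "eval_op w SHL x y = push_bit y x mod 2 ^ w"
| "eval_op w SHR x y = drop_bit y x"
| "eval_op w LESS x y = of_bool (x < y)"
| "eval_op w EQ x y = of_bool (x = y)"

text \<open>
  A configuration consists of the instructions still to be executed, the registers and the memory.
  The empty instruction list is the halting state.
\<close>

type_synonym config = "program \<times> (nat \<Rightarrow> nat) \<times> (nat \<Rightarrow> nat)"

fun step :: "nat \<Rightarrow> config \<Rightarrow> config pmf" where
  "step w ([], R, M) = return_pmf ([], R, M)"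
| "step w (Const r x # P, R, M) = return_pmf (P, R(r := x mod 2 ^ w), M)"
| "step w (Op f r a b # P, R, M) = return_pmf (P, R(r := eval_op w f (R a) (R b)), M)"
| "step w (Load r a # P, R, M) = return_pmf (P, R(r := M (R a)), M)"
| "step w (Store a r # P, R, M) = return_pmf (P, R, M(R a := R r))"
| "step w (Rand r # P, R, M) =
     map_pmf (\<lambda>x. (P, R(r := x), M)) (pmf_of_set {..<2 ^ w})"
| "step w (Cond r A B # P, R, M) = return_pmf ((if R r \<noteq> 0 then A else B) @ P, R, M)"
| "step w (Loop r A # P, R, M) =
     return_pmf (if R r \<noteq> 0 then A @ Loop r A # P else P, R, M)"

primrec run :: "nat \<Rightarrow> nat \<Rightarrow> config \<Rightarrow> config pmf" where
  "run w 0 c = return_pmf c"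
| "run w (Suc t) c = bind_pmf (step w c) (run w t)"

definition initial :: "program \<Rightarrow> nat list \<Rightarrow> config" where
  "initial P xs = (P, (\<lambda>_. 0), (\<lambda>i. if i < length xs then xs ! i else 0))"

text \<open>The answer is read off register 0: nonzero means yes.\<close>

definition halted_with :: "bool \<Rightarrow> config set" where
  "halted_with ans = {(P, R, M). P = [] \<and> (R 0 \<noteq> 0 \<longleftrightarrow> ans)}"

text \<open>Two-sided bounded error; a deterministic algorithm is a program without \<open>Rand\<close>.\<close>

definition answers_within :: "nat \<Rightarrow> program \<Rightarrow> nat list \<Rightarrow> nat \<Rightarrow> bool \<Rightarrow> bool" where
  "answers_within w P xs t ans \<longleftrightarrow>
     measure_pmf.prob (run w t (initial P xs)) (halted_with ans) \<ge> 2 / 3"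

text \<open>
  Words of \<open>O(log N)\<close> bits, where \<open>floorlog 2 N\<close> is the length of the binary representation of \<open>N\<close>;
  the constant \<open>c\<close> belongs to the algorithm.
\<close>

definition word_length :: "nat \<Rightarrow> nat \<Rightarrow> nat" where
  "word_length c N = c * floorlog 2 N"

text \<open>A literal \<open>(v, b)\<close> is true under \<open>\<alpha>\<close> iff \<open>\<alpha> v = b\<close>.\<close>

type_synonym cnf = "(nat \<times> bool) list list"

text \<open>
  Literals do not repeat within a clause, so that a formula with \<open>O(n)\<close> clauses has size polynomial
  in \<open>n\<close>.
\<close>

definition cnf_over :: "nat \<Rightarrow> cnf \<Rightarrow> bool" where
  "cnf_over n \<phi> \<longleftrightarrow> (\<forall>C \<in> set \<phi>. distinct C \<and> (\<forall>(v, b) \<in> set C. v < n))"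

definition satisfiable :: "cnf \<Rightarrow> bool" where
  "satisfiable \<phi> \<longleftrightarrow> (\<exists>\<alpha> :: nat \<Rightarrow> bool. \<forall>C \<in> set \<phi>. \<exists>(v, b) \<in> set C. \<alpha> v = b)"

definition encode_cnf :: "nat \<Rightarrow> cnf \<Rightarrow> nat list" where
  "encode_cnf n \<phi> =
     n # length \<phi> # concat (map (\<lambda>C. length C # map (\<lambda>(v, b). 2 * v + of_bool b) C) \<phi>)"

text \<open>
  An algorithm that takes exponential time may use exponentially many memory cells, and a word has
  to be able to address them. The quantity of which words have logarithmic length is therefore
  \<open>2 ^ n\<close> times the size of the formula, which is the time of exhaustive search, and not the size of
  the formula.
\<close>

definition decides_sparse_sat :: "nat \<Rightarrow> program \<Rightarrow> nat \<Rightarrow> (nat \<Rightarrow> nat) \<Rightarrow> bool" where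
  "decides_sparse_sat K P c T \<longleftrightarrow>
     (\<forall>n \<phi>. cnf_over n \<phi> \<and> length \<phi> \<le> K * n \<longrightarrow>
        answers_within (word_length c (2 ^ n * length (encode_cnf n \<phi>)))
          P (encode_cnf n \<phi>) (T n) (satisfiable \<phi>))"

text \<open>
  The number of clauses is \<open>O(n)\<close> with an arbitrary constant \<open>K\<close>, on which the constant in the
  running time may depend. The bound \<open>\<epsilon> < 2\<close> only keeps the base \<open>2 - \<epsilon>\<close> positive.
\<close>

definition SETH :: bool where
  "SETH \<longleftrightarrow>
     \<not> (\<exists>(\<epsilon>::real) P c. 0 < \<epsilon> \<and> \<epsilon> < 2 \<and> 0 < c \<and>
          (\<forall>K. \<exists>T. (\<lambda>n. real (T n)) \<in> O(\<lambda>n. (2 - \<epsilon>) ^ n) \<and> decides_sparse_sat K P c T))"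

text \<open>Simple graphs with vertex set \<open>{..<n}\<close>; an edge is a set of two vertices.\<close>

definition simple_graph :: "nat \<Rightarrow> nat set set \<Rightarrow> bool" where
  "simple_graph n E \<longleftrightarrow> (\<forall>e \<in> E. e \<subseteq> {..<n} \<and> card e = 2)"

definition adj :: "nat set set \<Rightarrow> (nat \<times> nat) set" where
  "adj E = {(u, v). {u, v} \<in> E}"

definition connected_graph :: "nat \<Rightarrow> nat set set \<Rightarrow> bool" where
  "connected_graph n E \<longleftrightarrow> (\<forall>u < n. \<forall>v < n. (u, v) \<in> (adj E)\<^sup>*)"

definition graph_dist :: "nat set set \<Rightarrow> nat \<Rightarrow> nat \<Rightarrow> nat" where
  "graph_dist E u v = (LEAST l. (u, v) \<in> adj E ^^ l)"

definition bichromatic_diameter :: "nat \<Rightarrow> nat set set \<Rightarrow> nat set \<Rightarrow> nat" where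
  "bichromatic_diameter n E S = Max {graph_dist E s t | s t. s \<in> S \<and> t \<in> {..<n} - S}"

text \<open>
  Both colour classes are nonempty and the graph is connected, which makes the bichromatic diameter
  a natural number and the number of vertices at most one more than the number of edges. An
  algorithm for arbitrary graphs is in particular one for connected graphs, so a lower bound for
  connected graphs is the stronger statement.
\<close>

definition bichromatic_instance :: "nat \<Rightarrow> nat set set \<Rightarrow> nat set \<Rightarrow> bool" where
  "bichromatic_instance n E S \<longleftrightarrow>
     simple_graph n E \<and> connected_graph n E \<and> S \<subseteq> {..<n} \<and> S \<noteq> {} \<and> {..<n} - S \<noteq> {}"

definition lists_edges :: "(nat \<times> nat) list \<Rightarrow> nat set set \<Rightarrow> bool" where
  "lists_edges es E \<longleftrightarrow>
     distinct (map (\<lambda>(u, v). {u, v}) es) \<and> (\<lambda>(u, v). {u, v}) ` set es = E"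

definition encode_graph :: "nat \<Rightarrow> (nat \<times> nat) list \<Rightarrow> nat list \<Rightarrow> nat list" where
  "encode_graph n es ss =
     n # length es # length ss # concat (map (\<lambda>(u, v). [u, v]) es) @ ss"

definition distinguishes_diameter ::
  "nat \<Rightarrow> nat \<Rightarrow> program \<Rightarrow> nat \<Rightarrow> (nat \<Rightarrow> nat) \<Rightarrow> bool" where
  "distinguishes_diameter a b P c T \<longleftrightarrow>
     (\<forall>n E S es ss.
        bichromatic_instance n E S \<and>
        lists_edges es E \<and> distinct ss \<and> set ss = S \<and>
        (bichromatic_diameter n E S \<le> a \<or> bichromatic_diameter n E S \<ge> b) \<longrightarrow>
        answers_within (word_length c (length (encode_graph n es ss)))
          P (encode_graph n es ss) (T (card E)) (bichromatic_diameter n E S \<le> a))"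

end

theory Submission
  imports Defs
begin

text \<open>
  Put \<open>K = k - 1\<close>. Splitting the variables of a formula into \<open>k\<close> blocks turns satisfiability into
  \<open>k\<close>-OV: are there vectors, one for each of \<open>k\<close> families of about \<open>2 ^ (n / k)\<close> vectors, without a
  common 1-coordinate? The graph has layers \<open>0, \<dots>, K + 1\<close>. The outer layers consist of \<open>K\<close>-tuples
  of vectors, from the first \<open>K\<close> families in layer 0 and from the last \<open>K\<close> families in layer \<open>K + 1\<close>.
  An inner vertex consists of \<open>K - 1\<close> vectors and \<open>K\<close> coordinates at which these vectors are 1, and
  from each layer to the next one vector of the left tuple is exchanged for one of the right tuple.
  Without a solution, all pairs of tuples are at distance \<open>K + 1\<close>. If \<open>w\<^sub>0, \<dots>, w\<^sub>K\<close> is a solution, the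
  tuples \<open>(w\<^sub>0, \<dots>, w\<^sub>K\<^sub>-\<^sub>1)\<close> and \<open>(w\<^sub>1, \<dots>, w\<^sub>K)\<close> are at distance at least \<open>3 * K + 1\<close>: a shorter walk
  crosses two of the \<open>K + 1\<close> levels exactly once, and one of the coordinates, which cannot change
  between these two crossings, would be common to all \<open>w\<^sub>i\<close>. A path with \<open>K\<close> edges at every vertex of
  layer \<open>K + 1\<close> stretches the distances to \<open>2 * K + 1\<close> and \<open>4 * K + 1\<close>; layer 0 is \<open>S\<close>. The graph has
  \<open>2 ^ (n * K / k)\<close> edges up to polynomial factors, and a distinguishing algorithm is run on it inside a
  machine with longer words.
\<close>

subsection \<open>Digits and crossings of levels\<close>

text \<open>Each of the \<open>K\<close> coordinates belongs to one level \<open>r < K\<close>. If a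
  walk crosses the levels \<open>r < r'\<close> exactly once each, the slots untouched up to the
  first crossing hold the families below \<open>K - r\<close> of the left tuple, and the slots
  settled after the second one hold all families from \<open>K - r\<close> on of the right tuple.
  Coordinate \<open>r\<close> is required to be 1 in all of these. A level crossed more than once
  costs three steps, which explains the factor 3. Two obstacles shape the rest. The machine model
  offers no data structures, so the graph is padded until every word of its encoding is a closed
  arithmetic formula in the index of the cell; such formulas are compiled with uniform bounds on
  value and time. And a distinguisher is correct only for the word length that belongs to its own
  input, hence the masking of every result and the coupling of two random runs. The time bound of
  the distinguisher need not be computable, since its simulation runs without a clock.\<close>

definition dig :: "nat \<Rightarrow> nat \<Rightarrow> nat \<Rightarrow> nat" where
  "dig B p y = y div B ^ p mod B"

definition zero_dig :: "nat \<Rightarrow> nat \<Rightarrow> nat \<Rightarrow> nat" where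
  "zero_dig B p y = y div B ^ Suc p * B ^ Suc p + y mod B ^ p"

lemma dig_less: "B > 0 \<Longrightarrow> dig B p y < B"
  by (simp add: dig_def)

lemma dig_0 [simp]: "dig B p 0 = 0"
  by (simp add: dig_def)

lemma dig_Suc: "dig B (Suc p) y = dig B p (y div B)"
  by (simp add: dig_def div_mult2_eq)

lemma dig_mod: "p < q \<Longrightarrow> dig B p (y mod B ^ q) = dig B p y"
proof -
  assume "p < q"
  then obtain r where q: "q = p + Suc r" using less_imp_Suc_add by auto
  have eq: "y mod B ^ q = B ^ p * (y div B ^ p mod B ^ Suc r) + y mod B ^ p"
    unfolding q power_add by (rule mod_mult2_eq)
  have "y mod B ^ q div B ^ p = (y div B ^ p) mod B ^ Suc r" if "B > 0"
    unfolding eq using that by simp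
  then show ?thesis
    by (cases "B = 0") (simp_all add: dig_def mod_mod_cancel q)
qed

lemma zero_dig_le: "zero_dig B p y \<le> y"
proof -
  have "y mod B ^ p = y mod B ^ Suc p mod B ^ p"
    by (simp add: mod_mod_cancel)
  also have "\<dots> \<le> y mod B ^ Suc p" by simp
  finally have "zero_dig B p y \<le> y div B ^ Suc p * B ^ Suc p + y mod B ^ Suc p"
    by (simp add: zero_dig_def)
  then show ?thesis by (simp only: div_mult_mod_eq)
qed

lemma dig_zero_dig:
  assumes "B > 0"
  shows "dig B p (zero_dig B q y) = (if p = q then 0 else dig B p y)"
proof -
  consider "p < q" | "p = q" | "p > q" by linarith
  then show ?thesis
  proof cases
    case 1
    have "zero_dig B q y mod B ^ q = y mod B ^ q"
      unfolding zero_dig_def power_Suc by (metis mod_mod_trivial mod_mult_self3 mult.assoc)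
    then show ?thesis using dig_mod[OF 1] 1 by (metis nat_neq_iff)
  next
    case 2
    have "zero_dig B q y = y mod B ^ q + (y div B ^ Suc q * B) * B ^ q"
      by (simp add: zero_dig_def)
    then have "zero_dig B q y div B ^ q = y div B ^ Suc q * B"
      using assms by (simp only: div_mult_self1 power_not_zero) simp
    then show ?thesis using 2 by (simp add: dig_def)
  next
    case 3
    then obtain r where p: "p = Suc q + r" by (metis add_Suc less_imp_Suc_add)
    have "y mod B ^ q < B ^ q" "B ^ q \<le> B ^ Suc q" using assms by simp_all
    then have "y mod B ^ q < B ^ Suc q" by (rule less_le_trans)
    then have "zero_dig B q y div B ^ Suc q = y div B ^ Suc q"
      unfolding zero_dig_def using assms by (subst div_mult_self3) auto
    then show ?thesis using 3 unfolding dig_def p power_add by (simp only: div_mult2_eq) simp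
  qed
qed

lemma dig_eqI:
  assumes "y < B ^ n" "y' < B ^ n" "\<And>p. p < n \<Longrightarrow> dig B p y = dig B p y'"
  shows "y = y'"
  using assms
proof (induction n arbitrary: y y')
  case (Suc n)
  have "y div B < B ^ n" "y' div B < B ^ n"
    using Suc.prems(1,2) by (simp_all add: less_mult_imp_div_less mult.commute)
  moreover have "dig B p (y div B) = dig B p (y' div B)" if "p < n" for p
    using Suc.prems(3)[of "Suc p"] that by (simp add: dig_Suc)
  ultimately have "y div B = y' div B" using Suc.IH by blast
  moreover have "y mod B = y' mod B" using Suc.prems(3)[of 0] by (simp add: dig_def)
  ultimately show ?case by (metis div_mult_mod_eq)
qed auto

lemma zero_dig_id:
  assumes "B > 0" "dig B p y = 0"
  shows "zero_dig B p y = y"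
proof -
  \<comment> \<open>Powers of 1 do not grow, so base 1 is a case of its own.\<close>
  obtain n where "y < B ^ n \<or> B = 1"
    using assms(1) by (metis One_nat_def less_one linorder_neqE_nat not_less_eq power_gt_expt)
  then show ?thesis
  proof
    assume "y < B ^ n"
    then show ?thesis
      
      by (intro dig_eqI[OF le_less_trans[OF zero_dig_le]]) (use assms in \<open>auto simp: dig_zero_dig\<close>)
  next
    assume "B = 1"
    then show ?thesis by (simp add: zero_dig_def)
  qed
qed

lemma ex_digits:
  assumes "\<And>p. p < n \<Longrightarrow> g p < B"
  shows "\<exists>y < B ^ n. \<forall>p < n. dig B p y = g p"
  using assms
proof (induction n arbitrary: g)
  case (Suc n)
  obtain y where y: "y < B ^ n" "\<forall>p < n. dig B p y = g (Suc p)"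
    using Suc.IH[of "g \<circ> Suc"] Suc.prems by auto
  have g0: "g 0 < B" using Suc.prems by simp
  have "g 0 + B * y < B ^ Suc n"
  proof -
    have "Suc y * B \<le> B ^ n * B" using y(1) by (intro mult_le_mono1) simp
    then show ?thesis using g0 by (simp add: mult.commute)
  qed
  moreover have "dig B p (g 0 + B * y) = g p" if "p < Suc n" for p
    using that y(2) g0 by (cases p) (auto simp: dig_Suc, simp add: dig_def)
  ultimately show ?case by blast
qed simp

lemma discrete_down_crossing:
  fixes g :: "nat \<Rightarrow> nat"
  assumes "a \<le> b" "r < g a" "g b \<le> r"
  shows "\<exists>m. a \<le> m \<and> m < b \<and> r < g m \<and> g (Suc m) \<le> r"
  using assms
proof (induction "b - a" arbitrary: b)
  case (Suc n)
  then obtain b' where b: "b = Suc b'" by (metis diff_Suc_Suc diff_0_eq_0 nat.exhaust zero_diff Suc_neq_Zero)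
  have ab: "a \<le> b'" using Suc b by (metis le_SucE not_le)
  show ?case
  proof (cases "g b' \<le> r")
    case True
    then show ?thesis using Suc.hyps(1)[of b'] Suc.hyps(2) Suc.prems b ab by fastforce
  next
    case False
    then show ?thesis using Suc.prems b ab by (intro exI[of _ b']) auto
  qed
qed (metis diff_is_0_eq le_antisym not_le)

text \<open>The least time above \<open>r\<close> is taken, so that all earlier times are known to
  be at most \<open>r\<close>; this is one half of \<open>cut\<close>.\<close>

lemma discrete_up_crossing:
  fixes g :: "nat \<Rightarrow> nat"
  assumes "g 0 \<le> r" "r < g l"
  shows "\<exists>m < l. (\<forall>j \<le> m. g j \<le> r) \<and> r < g (Suc m)"
proof -
  define t where "t = (LEAST t. r < g t)"
  have t: "r < g t" "t \<le> l"
    unfolding t_def using assms(2) by (rule LeastI, rule Least_le)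
  have t': "g j \<le> r" if "j < t" for j
    using not_less_Least[OF that[unfolded t_def]] by simp
  have "t \<noteq> 0" using t(1) assms(1) by (metis not_less)
  then show ?thesis using t t' by (intro exI[of _ "t - 1"]) auto
qed

text \<open>Level \<open>r\<close> is the gap between the values \<open>r\<close> and
  \<open>r + 1\<close>. This form of "crossed exactly once" tells on which side of the gap the walk
  is at any time.\<close>

definition cut :: "(nat \<Rightarrow> nat) \<Rightarrow> nat \<Rightarrow> nat \<Rightarrow> nat \<Rightarrow> bool" where
  "cut g l r m \<longleftrightarrow> m < l \<and> (\<forall>j \<le> m. g j \<le> r) \<and> (\<forall>j. m < j \<and> j \<le> l \<longrightarrow> r < g j)"

text \<open>A level that is not crossed exactly once is crossed at least three times.\<close>

lemma two_cuts:
  fixes g :: "nat \<Rightarrow> nat"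
  assumes g0: "g 0 = 0" and gl: "g l = 2 * K + 1" and l: "l < 4 * K + 1"
    and step: "\<And>m. m < l \<Longrightarrow> g (Suc m) \<le> Suc (g m) \<and> g m \<le> Suc (g (Suc m))"
  shows "\<exists>r r' m m'. r < r' \<and> r' \<le> K \<and> cut g l r m \<and> cut g l r' m'"
proof (rule ccontr)
  assume nex: "\<not> ?thesis"
  define X where "X r = {m. m < l \<and> ((g m \<le> r \<and> r < g (Suc m)) \<or> (g (Suc m) \<le> r \<and> r < g m))}" for r
  define U where "U = {r. r \<le> K \<and> (\<exists>m. cut g l r m)}"
  have fin: "finite (X r)" for r unfolding X_def by simp
  have card1: "1 \<le> card (X r)" if "r \<le> 2 * K" for r
  proof -
    have "g 0 \<le> r" "r < g l" using g0 gl that by simp_all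
    from discrete_up_crossing[OF this] obtain m
      where "m < l" "\<forall>j \<le> m. g j \<le> r" "r < g (Suc m)" by blast
    then have "X r \<noteq> {}" unfolding X_def by blast
    then show ?thesis using fin by (simp add: Suc_leI card_gt_0_iff)
  qed
  \<comment> \<open>The first crossing goes up. As the level is not cut, the walk comes back, and as
    it ends above \<open>r\<close>, it goes up again.\<close>
  have card3: "3 \<le> card (X r)" if r: "r \<le> K" "r \<notin> U" for r
  proof -
    have "g 0 \<le> r" "r < g l" using g0 gl r by simp_all
    from discrete_up_crossing[OF this] obtain m1
      where m1: "m1 < l" "\<forall>j \<le> m1. g j \<le> r" "r < g (Suc m1)" by blast
    have "\<not> cut g l r m1" using r unfolding U_def by auto
    then obtain j where j: "m1 < j" "j \<le> l" "g j \<le> r"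
      using m1 unfolding cut_def by (auto simp: not_less)
    obtain m2 where m2: "Suc m1 \<le> m2" "m2 < j" "r < g m2" "g (Suc m2) \<le> r"
      using discrete_down_crossing[of "Suc m1" j r g] j m1 by (metis Suc_leI)
    have "g (Suc m2 + 0) \<le> r" "r < g (Suc m2 + (l - Suc m2))" using m2 j gl r by simp_all
    from discrete_up_crossing[of "\<lambda>i. g (Suc m2 + i)", OF this] obtain m3
      where m3: "m3 < l - Suc m2" "g (Suc m2 + m3) \<le> r" "r < g (Suc (Suc m2 + m3))"
      by (metis add_Suc_right order_refl)
    have "{m1, m2, Suc m2 + m3} \<subseteq> X r"
      using m1 m2 m3 j unfolding X_def by auto
    moreover have "card {m1, m2, Suc m2 + m3} = 3" using m2 by auto
    ultimately show ?thesis using card_mono[OF fin] by metis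
  qed
  have "card U \<le> 1"
  proof (rule ccontr)
    assume "\<not> card U \<le> 1"
    then obtain a b where "a \<in> U" "b \<in> U" "a \<noteq> b"
      by (metis card_le_Suc0_iff_eq One_nat_def card.infinite le_0_eq le_SucI)
    then show False using nex unfolding U_def nat_neq_iff by blast
  qed
  \<comment> \<open>A step changes \<open>g\<close> by at most one and so crosses at most one
    level.\<close>
  have disj: "X r \<inter> X r' = {}" if "r \<noteq> r'" for r r'
    using that step unfolding X_def by (auto; fastforce)
  have "(\<Sum>r\<le>2*K. card (X r)) = card (\<Union>r\<le>2*K. X r)"
    using disj fin by (subst card_UN_disjoint) auto
  also have "\<dots> \<le> card {..<l}"
    by (rule card_mono) (auto simp: X_def)
  finally have up: "(\<Sum>r\<le>2*K. card (X r)) \<le> l" by simp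
  have finU: "finite U" "U \<subseteq> {..K}" unfolding U_def by auto
  have eq: "{..2*K} = {..K} \<union> {K<..2*K}" by auto
  have "(\<Sum>r\<le>2*K. card (X r)) = (\<Sum>r\<le>K. card (X r)) + (\<Sum>r\<in>{K<..2*K}. card (X r))"
    unfolding eq by (rule sum.union_disjoint) auto
  moreover have "(\<Sum>r\<in>{K<..2*K}. 1) \<le> (\<Sum>r\<in>{K<..2*K}. card (X r))"
    by (rule sum_mono) (use card1 in auto)
  moreover have "(\<Sum>r\<le>K. card (X r)) = (\<Sum>r\<in>{..K} - U. card (X r)) + (\<Sum>r\<in>U. card (X r))"
    using finU by (intro sum.subset_diff) auto
  moreover have "(\<Sum>r\<in>{..K} - U. 3) \<le> (\<Sum>r\<in>{..K} - U. card (X r))"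
    by (rule sum_mono) (use card3 in auto)
  moreover have "(\<Sum>r\<in>U. 1) \<le> (\<Sum>r\<in>U. card (X r))"
    by (rule sum_mono) (use card1 finU in auto)
  moreover have "card ({..K} - U) = Suc K - card U"
    using finU by (simp add: card_Diff_subset)
  \<comment> \<open>At least \<open>K\<close> of the levels \<open>0, ..., K\<close> cost three
    steps each; the remaining one and the \<open>K\<close> levels above \<open>K\<close> cost at
    least one each. The total \<open>3 * K + 1 + K\<close> exceeds \<open>l\<close>.\<close>
  ultimately show False using up l \<open>card U \<le> 1\<close> by auto
qed

subsection \<open>The graph of a k-OV instance\<close>

text \<open>
  \<open>f l w c\<close> says that vector \<open>w\<close> of family \<open>l\<close> is 1 at coordinate \<open>c\<close>. Vector 0 of each family is an
  all-ones vector, which also stands for an empty slot of a tuple. The last two assumptions connect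
  all tuples to the tuple of all-ones vectors.
\<close>

locale kov_graph =
  fixes K N D :: nat and f :: "nat \<Rightarrow> nat \<Rightarrow> nat \<Rightarrow> bool"
  assumes K: "K \<ge> 1" and N: "N > 0"
    and dummy: "\<And>l c. f l 0 c"
    and coord_first: "\<exists>c < D. \<forall>l w. l \<noteq> 0 \<longrightarrow> f l w c"
    and coord_last: "\<exists>c < D. \<forall>l w. l \<noteq> K \<longrightarrow> f l w c"
begin

definition "Ny = N ^ K"
definition "Dx = D ^ K"

text \<open>
  A label consists of a layer \<open>i\<close>, a \<open>K\<close>-tuple \<open>y\<close> of vectors and a \<open>K\<close>-tuple \<open>x\<close> of coordinates, both
  coded by their digits. Slot \<open>p\<close> of \<open>y\<close> holds a vector of family \<open>p\<close> if \<open>p + i < K\<close> (from the left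
  tuple), is empty if \<open>p + i = K\<close>, and otherwise holds a vector of family \<open>p + 1\<close> (from the right
  tuple); \<open>vx\<close> clears the empty slot and, in the outer layers, the coordinates. Coordinate \<open>j\<close> is meant
  to be common to the families below \<open>K - j\<close> of the left tuple and the other families of the right
  tuple. Layers above \<open>K + 1\<close> form the paths at the vertices of layer \<open>K + 1\<close>.
\<close>

definition vid :: "nat \<Rightarrow> nat \<Rightarrow> nat \<Rightarrow> nat" where
  "vid i y x = (i * Ny + y) * Dx + x"

definition "layer a = a div Dx div Ny"
definition "yc a = a div Dx mod Ny"
definition "xc a = a mod Dx"
definition "V = 2 * (K + 1) * (Ny * Dx)"
definition "hub = vid (K + 1) 0 0"

definition vx :: "nat \<Rightarrow> nat \<Rightarrow> nat \<Rightarrow> nat" where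
  "vx i y x = (if 1 \<le> i \<and> i \<le> K then vid i (zero_dig N (K - i) y) x else vid i y 0)"

definition valid :: "nat \<Rightarrow> nat \<Rightarrow> nat \<Rightarrow> bool" where
  "valid i y x \<longleftrightarrow> (\<forall>p < K. \<forall>j < K.
     if p + i < K then p + j < K \<longrightarrow> f p (dig N p y) (dig D j x)
     else K \<le> p + j + 1 \<longrightarrow> f (p + 1) (dig N p y) (dig D j x))"

text \<open>This marks the labels of edges from \<open>vx i y x\<close> to
  \<open>vx (Suc i) y x\<close>. The tuple \<open>y\<close> is full: each end hides at most one
  slot, \<open>K - i\<close> or \<open>K - Suc i\<close>. In the tail, \<open>x = 0\<close> leaves
  one label per edge.\<close>

definition core :: "nat \<Rightarrow> nat \<Rightarrow> nat \<Rightarrow> bool" where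
  "core i y x \<longleftrightarrow> i \<le> 2 * K \<and> (if i \<le> K then valid i y x else x = 0)"

text \<open>\<open>vx\<close> is idempotent, so its fixed points, if valid in the inner layers,
  serve as canonical names of the vertices.\<close>

definition good :: "nat \<Rightarrow> bool" where
  "good a \<longleftrightarrow> vx (layer a) (yc a) (xc a) = a \<and>
     (1 \<le> layer a \<and> layer a \<le> K \<longrightarrow> valid (layer a) (yc a) (xc a))"

text \<open>
  The numbers of vertices and edges do not depend on \<open>f\<close>: every label \<open>a\<close> has three leaves
  \<open>V + 3 * a + t\<close> at \<open>hub\<close>, and an edge between two of them replaces an edge that is absent. Labels
  that are not vertices are attached to \<open>hub\<close>.
\<close>

definition gedge :: "nat \<Rightarrow> nat \<times> nat" where
  "gedge j = (let a = j div 5; s = j mod 5; l = V + 3 * a in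
     if s < 3 then (l + s, hub)
     else if s = 3 then
       if core (layer a) (yc a) (xc a)
       then (vx (layer a) (yc a) (xc a), vx (layer a + 1) (yc a) (xc a)) else (l, l + 1)
     else if good a then (l, l + 2) else (a, hub))"

definition "Eg = (\<lambda>(u, v). {u, v}) ` gedge ` {..<5 * V}"
definition "Sg = (\<lambda>y. vid 0 y 0) ` {..<Ny}"

lemma D: "D > 0" using coord_first by auto
lemma Ny: "Ny > 0" using N by (simp add: Ny_def)
lemma Dx: "Dx > 0" using D by (simp add: Dx_def)

lemma vid_inv [simp]:
  assumes "y < Ny" "x < Dx"
  shows "layer (vid i y x) = i" "yc (vid i y x) = y" "xc (vid i y x) = x"
proof -
  have "vid i y x div Dx = i * Ny + y" using assms by (simp add: vid_def)
  then show "layer (vid i y x) = i" "yc (vid i y x) = y" using assms by (simp_all add: layer_def yc_def)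
  show "xc (vid i y x) = x" using assms by (simp add: xc_def vid_def)
qed

lemma vid_dest: "vid (layer a) (yc a) (xc a) = a"
  unfolding vid_def layer_def yc_def xc_def by (simp only: div_mult_mod_eq)

lemma yc_less [simp]: "yc a < Ny" and xc_less [simp]: "xc a < Dx"
  using Ny Dx by (simp_all add: yc_def xc_def)

lemma V_eq: "V = (2 * K + 2) * Ny * Dx"
  by (simp add: V_def algebra_simps)

lemma less_V_iff: "a < V \<longleftrightarrow> layer a \<le> 2 * K + 1"
proof -
  have "layer a < 2 * K + 2 \<longleftrightarrow> a < (2 * K + 2) * Ny * Dx"
    unfolding layer_def using Ny Dx by (simp add: less_mult_imp_div_less div_less_iff_less_mult)
  then show ?thesis unfolding V_eq by auto
qed

lemma vid_less: "y < Ny \<Longrightarrow> x < Dx \<Longrightarrow> i \<le> 2 * K + 1 \<Longrightarrow> vid i y x < V"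
  by (simp add: less_V_iff)

lemma zero_dig_Ny: "y < Ny \<Longrightarrow> zero_dig N p y < Ny"
  using zero_dig_le le_less_trans by blast

lemma vx_inv [simp]:
  assumes "y < Ny" "x < Dx"
  shows "layer (vx i y x) = i"
    and "yc (vx i y x) = (if 1 \<le> i \<and> i \<le> K then zero_dig N (K - i) y else y)"
    and "xc (vx i y x) = (if 1 \<le> i \<and> i \<le> K then x else 0)"
  using assms Dx by (simp_all add: vx_def zero_dig_Ny)

lemma vx_less: "y < Ny \<Longrightarrow> x < Dx \<Longrightarrow> i \<le> 2 * K + 1 \<Longrightarrow> vx i y x < V"
  by (simp add: less_V_iff)

lemma vx_idem:
  assumes "y < Ny" "x < Dx"
  shows "vx i (yc (vx i y x)) (xc (vx i y x)) = vx i y x"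
proof (cases "1 \<le> i \<and> i \<le> K")
  case True
  have "zero_dig N (K - i) (zero_dig N (K - i) y) = zero_dig N (K - i) y"
    using N by (intro zero_dig_id) (simp_all add: dig_zero_dig)
  then show ?thesis using True assms by (simp add: vx_def zero_dig_Ny)
qed (use assms Dx in \<open>auto simp: vx_def\<close>)

text \<open>Slot value 0 is the all-ones vector, so clearing a slot violates no condition.\<close>

lemma valid_zero_dig:
  assumes "valid i y x"
  shows "valid i (zero_dig N p y) x"
  unfolding valid_def
proof (intro allI impI)
  fix q j assume "q < K" "j < K"
  then show "if q + i < K then q + j < K \<longrightarrow> f q (dig N q (zero_dig N p y)) (dig D j x)
     else K \<le> q + j + 1 \<longrightarrow> f (q + 1) (dig N q (zero_dig N p y)) (dig D j x)"
    using assms[unfolded valid_def, rule_format, of q j] dummy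
    by (cases "q = p") (auto simp: dig_zero_dig N split: if_splits)
qed

text \<open>From layer \<open>i\<close> to layer \<open>Suc i\<close> only slot
  \<open>K - Suc i\<close> passes from the left to the right tuple, and this slot is
  cleared.\<close>

lemma valid_zero_dig_Suc:
  assumes "valid i y x" "i < K"
  shows "valid (Suc i) (zero_dig N (K - Suc i) y) x"
  unfolding valid_def
proof (intro allI impI)
  fix p j assume "p < K" "j < K"
  then show "if p + Suc i < K then p + j < K \<longrightarrow> f p (dig N p (zero_dig N (K - Suc i) y)) (dig D j x)
     else K \<le> p + j + 1 \<longrightarrow> f (p + 1) (dig N p (zero_dig N (K - Suc i) y)) (dig D j x)"
    using assms(1)[unfolded valid_def, rule_format, of p j] assms(2) dummy
    by (cases "p = K - Suc i") (auto simp: dig_zero_dig N split: if_splits)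
qed

lemma good_vid_outer: "y < Ny \<Longrightarrow> i = 0 \<or> K < i \<Longrightarrow> good (vid i y 0)"
  using Dx by (auto simp: good_def vx_def)

lemma good_hub: "good hub"
  unfolding hub_def using Ny by (intro good_vid_outer) auto

lemma hub_less: "hub < V"
  unfolding hub_def using Ny Dx K by (intro vid_less) auto

lemma core_good:
  assumes "core i y x" "y < Ny" "x < Dx"
  shows "good (vx i y x)" "good (vx (Suc i) y x)"
proof -
  show "good (vx i y x)"
    using assms vx_idem[OF assms(2,3), of i] unfolding good_def
    by (auto simp: core_def valid_zero_dig)
  show "good (vx (Suc i) y x)"
    using assms vx_idem[OF assms(2,3), of "Suc i"] unfolding good_def
    by (auto simp: core_def valid_zero_dig_Suc)
qed

text \<open>The case \<open>leaves\<close> merges two kinds of replacement: \<open>t = 1\<close>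
  stands in for a missing core edge, \<open>t = 2\<close> for the attachment to \<open>hub\<close>
  of a label that is a vertex.\<close>

lemma gedge_cases:
  assumes "j < 5 * V"
  obtains (leaf) a t where "a < V" "t < 3" "j = 5 * a + t" "gedge j = (V + 3 * a + t, hub)"
  | (core) a where "a < V" "j = 5 * a + 3" "core (layer a) (yc a) (xc a)"
      "gedge j = (vx (layer a) (yc a) (xc a), vx (Suc (layer a)) (yc a) (xc a))"
  | (leaves) a t where "a < V" "t < 3" "0 < t" "j = 5 * a + 2 + t"
      "gedge j = (V + 3 * a, V + 3 * a + t)"
  | (bad) a where "a < V" "j = 5 * a + 4" "\<not> good a" "gedge j = (a, hub)"
proof -
  define a where "a = j div 5"
  have a: "a < V" using assms unfolding a_def by (simp add: less_mult_imp_div_less mult.commute)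
  have j: "5 * a + j mod 5 = j" unfolding a_def by simp
  have g: "gedge j = (if j mod 5 < 3 then (V + 3 * a + j mod 5, hub)
     else if j mod 5 = 3 then
       if core (layer a) (yc a) (xc a)
       then (vx (layer a) (yc a) (xc a), vx (layer a + 1) (yc a) (xc a)) else (V + 3 * a, V + 3 * a + 1)
     else if good a then (V + 3 * a, V + 3 * a + 2) else (a, hub))"
    by (simp add: gedge_def Let_def a_def)
  consider "j mod 5 < 3" | "j mod 5 = 3" | "j mod 5 = 4" by linarith
  then show ?thesis
  proof cases
    case 1
    then show ?thesis using a g by (intro leaf[of a "j mod 5"] j[symmetric]) simp_all
  next
    case 2
    then have "j = 5 * a + 3" using j by metis
    then show ?thesis using a g 2 core[of a] leaves[of a 1]
      by (cases "core (layer a) (yc a) (xc a)") simp_all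
  next
    case 3
    then have j4: "j = 5 * a + 4" using j by metis
    have g4: "gedge j = (if good a then (V + 3 * a, V + 3 * a + 2) else (a, hub))"
      unfolding g 3 by simp
    show ?thesis
    proof (cases "good a")
      case True
      then show ?thesis using a g4 j4 by (intro leaves[of a 2]) simp_all
    next
      case False
      then show ?thesis using a g4 j4 by (intro bad[of a]) simp_all
    qed
  qed
qed

lemma core_edge_less:
  assumes "core i y x" "y < Ny" "x < Dx"
  shows "vx i y x < V" "vx (Suc i) y x < V" "vx i y x \<noteq> vx (Suc i) y x"
proof -
  have "i \<le> 2 * K" using assms(1) by (simp add: core_def)
  then show "vx i y x < V" "vx (Suc i) y x < V" using assms by (auto intro!: vx_less)
  show "vx i y x \<noteq> vx (Suc i) y x" using vx_inv(1)[OF assms(2,3)] by (metis n_not_Suc_n)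
qed

lemma simple_graph_Eg: "simple_graph (4 * V) Eg"
  unfolding simple_graph_def Eg_def
proof (intro ballI)
  fix e assume "e \<in> (\<lambda>(u, v). {u, v}) ` gedge ` {..<5 * V}"
  then obtain j where j: "j < 5 * V" and e': "e = (\<lambda>(u, v). {u, v}) (gedge j)"
    by blast
  obtain u v where uv: "gedge j = (u, v)" by (cases "gedge j") blast
  have e: "e = {u, v}" using e' uv by simp
  have "{u, v} \<subseteq> {..<4 * V} \<and> card {u, v} = 2"
    using j
  proof (cases rule: gedge_cases)
    case (core a)
    then show ?thesis using uv core_edge_less[OF core(3)] by (auto intro: less_le_trans)
  next
    case (bad a)
    then show ?thesis using uv hub_less good_hub by (auto simp: card_insert_if)
  qed (use uv hub_less in \<open>auto simp: card_insert_if\<close>)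
  then show "e \<subseteq> {..<4 * V} \<and> card e = 2" unfolding e .
qed

text \<open>The layers of the ends give \<open>layer a\<close>. The ends do not hide the same slot,
  so together they show all of \<open>y\<close>; the coordinates are read off an end in an inner
  layer, or are 0 in the tail.\<close>

lemma core_inj:
  assumes a: "core (layer a) (yc a) (xc a)" and b: "core (layer b) (yc b) (xc b)"
    and eq: "{vx (layer a) (yc a) (xc a), vx (Suc (layer a)) (yc a) (xc a)} =
      {vx (layer b) (yc b) (xc b), vx (Suc (layer b)) (yc b) (xc b)}"
  shows "a = b"
proof -
  have "layer ` {vx (layer a) (yc a) (xc a), vx (Suc (layer a)) (yc a) (xc a)} =
      layer ` {vx (layer b) (yc b) (xc b), vx (Suc (layer b)) (yc b) (xc b)}"
    using eq by simp
  then have layer: "layer a = layer b" by (auto simp: doubleton_eq_iff)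
  then have "vx (layer a) (yc a) (xc a) \<noteq> vx (Suc (layer b)) (yc b) (xc b)"
    by (metis n_not_Suc_n vx_inv(1) xc_less yc_less)
  then have e: "vx (layer a) (yc a) (xc a) = vx (layer a) (yc b) (xc b)"
    "vx (Suc (layer a)) (yc a) (xc a) = vx (Suc (layer a)) (yc b) (xc b)"
    using eq layer by (auto simp: doubleton_eq_iff)
  have y: "yc a = yc b"
  proof (rule dig_eqI[of _ N K])
    show "yc a < N ^ K" "yc b < N ^ K" using yc_less unfolding Ny_def by auto
    fix p assume "p < K"
    have 1: "yc (vx i (yc a) (xc a)) = (if 1 \<le> i \<and> i \<le> K then zero_dig N (K - i) (yc a) else yc a)"
      "yc (vx i (yc b) (xc b)) = (if 1 \<le> i \<and> i \<le> K then zero_dig N (K - i) (yc b) else yc b)" for i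
      by simp_all
    show "dig N p (yc a) = dig N p (yc b)"
      using e(1)[THEN arg_cong[of _ _ "\<lambda>v. dig N p (yc v)"]]
        e(2)[THEN arg_cong[of _ _ "\<lambda>v. dig N p (yc v)"]] \<open>p < K\<close>
      by (auto simp: 1 dig_zero_dig N split: if_splits)
  qed
  have "xc a = xc b"
  proof (cases "layer a \<le> K")
    case True
    then have "xc (vx i (yc a) (xc a)) = xc a \<and> xc (vx i (yc b) (xc b)) = xc b"
      if "1 \<le> i" "i \<le> K" for i using that by simp
    then show ?thesis using e True K
      by (cases "layer a = 0") (metis One_nat_def Suc_leI not_gr_zero order_refl)+
  next
    case False
    then show ?thesis using a b layer by (simp add: core_def)
  qed
  then show ?thesis using layer y vid_dest by metis
qed

end

lemma adj_sym: "(u, v) \<in> adj E \<Longrightarrow> (v, u) \<in> adj E"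
  by (simp add: adj_def insert_commute)

context kov_graph begin

lemma core_edge:
  assumes "core (layer a) (yc a) (xc a)" "v \<in> {vx (layer a) (yc a) (xc a), vx (Suc (layer a)) (yc a) (xc a)}"
  shows "v < V" "good v"
  using assms core_edge_less[OF assms(1)] core_good[OF assms(1)] by auto

text \<open>This makes the edge list free of repetitions and \<open>5 * V\<close> the number of
  edges, whatever the vectors are.\<close>

lemma gedge_inj:
  assumes j: "j < 5 * V" and j': "j' < 5 * V"
    and eq: "(\<lambda>(u, v). {u, v}) (gedge j) = (\<lambda>(u, v). {u, v}) (gedge j')"
  shows "j = j'"
proof -
  have hub: "hub < V + n" for n using hub_less by simp
  \<comment> \<open>Both ends of a core edge are good labels below \<open>V\<close>, while any other
    edge has a leaf or a bad label as its first component.\<close>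
  have no_core: False if "core (layer a) (yc a) (xc a)"
    "gedge j1 = (vx (layer a) (yc a) (xc a), vx (Suc (layer a)) (yc a) (xc a))"
    "(\<lambda>(u, v). {u, v}) (gedge j1) = (\<lambda>(u, v). {u, v}) (gedge j2)" "V \<le> u \<or> \<not> good u" "gedge j2 = (u, v)" for a j1 j2 u v
  proof -
    have "u \<in> {vx (layer a) (yc a) (xc a), vx (Suc (layer a)) (yc a) (xc a)}" using that(2,3,5) by simp
    then show False using core_edge[OF that(1)] that(4) by (meson not_less)
  qed
  from j show ?thesis
  proof (cases rule: gedge_cases)
    case (leaf a t)
    note 1 = this
    from j' show ?thesis
    proof (cases rule: gedge_cases)
      case (leaf a' t')
      have "3 * a + t = 3 * a' + t'"
        using eq hub[of "3 * a' + t'"] unfolding 1(4) leaf(4) by (auto simp: doubleton_eq_iff)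
      then have "(3 * a + t) div 3 = (3 * a' + t') div 3" by simp
      then have "a = a'" using 1(2) leaf(2) by simp
      then show ?thesis using \<open>3 * a + t = 3 * a' + t'\<close> 1(3) leaf(3) by simp
    next
      case (core a')
      then show ?thesis using no_core[OF core(3,4) eq[symmetric] _ 1(4)] by simp
    next
      case (leaves a' t')
      then show ?thesis using eq hub[of "3 * a'"] hub[of "3 * a' + t'"]
        unfolding 1(4) leaves(5) by (auto simp: doubleton_eq_iff)
    next
      case (bad a')
      then show ?thesis using eq hub[of 0] unfolding 1(4) bad(4) by (auto simp: doubleton_eq_iff)
    qed
  next
    case (core a)
    note 1 = this
    from j' show ?thesis
    proof (cases rule: gedge_cases)
      case (leaf a' t')
      then show ?thesis using no_core[OF 1(3,4) eq _ leaf(4)] by simp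
    next
      case (core a')
      then show ?thesis using 1 eq core_inj[of a a'] by simp
    next
      case (leaves a' t')
      then show ?thesis using no_core[OF 1(3,4) eq _ leaves(5)] by simp
    next
      case (bad a')
      then show ?thesis using no_core[OF 1(3,4) eq _ bad(4)] by simp
    qed
  next
    case (leaves a t)
    note 1 = this
    from j' show ?thesis
    proof (cases rule: gedge_cases)
      case (leaf a' t')
      then show ?thesis using eq hub[of "3 * a"] hub[of "3 * a + t"]
        unfolding 1(5) leaf(4) by (auto simp: doubleton_eq_iff)
    next
      case (core a')
      then show ?thesis using no_core[OF core(3,4) eq[symmetric] _ 1(5)] by simp
    next
      case (leaves a' t')
      have "3 * a = 3 * a' \<and> 3 * a + t = 3 * a' + t' \<or> 3 * a = 3 * a' + t' \<and> 3 * a + t = 3 * a'"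
        using eq unfolding 1(5) leaves(5) by (auto simp: doubleton_eq_iff)
      then show ?thesis using 1(3,4) leaves(3,4) by auto
    next
      case (bad a')
      then show ?thesis using eq hub_less unfolding 1(5) bad(4) by (auto simp: doubleton_eq_iff)
    qed
  next
    case (bad a)
    note 1 = this
    from j' show ?thesis
    proof (cases rule: gedge_cases)
      case (leaf a' t')
      then show ?thesis using eq 1(1) hub[of "3 * a' + t'"]
        unfolding 1(4) leaf(4) by (auto simp: doubleton_eq_iff)
    next
      case (core a')
      then show ?thesis using no_core[OF core(3,4) eq[symmetric] _ 1(4)] 1(3) by simp
    next
      case (leaves a' t')
      then show ?thesis using eq 1(1) unfolding 1(4) leaves(5) by (auto simp: doubleton_eq_iff)
    next
      case (bad a')
      then show ?thesis using 1 eq good_hub by (auto simp: doubleton_eq_iff)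
    qed
  qed
qed

lemma lists_edges_gedge: "lists_edges (map gedge [0..<5 * V]) Eg"
  unfolding lists_edges_def Eg_def
  by (auto simp: distinct_map inj_on_def atLeast0LessThan intro: gedge_inj)

lemma card_Eg: "card Eg = 5 * V"
  unfolding Eg_def image_image
  by (subst card_image) (auto simp: inj_on_def intro: gedge_inj)

lemma adj_gedge: "j < 5 * V \<Longrightarrow> gedge j \<in> adj Eg"
  unfolding adj_def Eg_def by (cases "gedge j") force

lemma adj_leaf:
  assumes "a < V" "t < 3"
  shows "(V + 3 * a + t, hub) \<in> adj Eg"
proof -
  have "gedge (5 * a + t) = (V + 3 * a + t, hub)"
    using assms by (simp add: gedge_def Let_def)
  then show ?thesis using adj_gedge[of "5 * a + t"] assms by simp
qed

lemma adj_bad: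
  assumes "a < V" "\<not> good a"
  shows "(a, hub) \<in> adj Eg"
proof -
  have "gedge (5 * a + 4) = (a, hub)"
    using assms by (simp add: gedge_def Let_def)
  then show ?thesis using adj_gedge[of "5 * a + 4"] assms by simp
qed

lemma adj_core:
  assumes "core i y x" "y < Ny" "x < Dx"
  shows "(vx i y x, vx (Suc i) y x) \<in> adj Eg"
proof -
  have "vid i y x < V" using assms by (intro vid_less) (auto simp: core_def)
  moreover have "gedge (5 * vid i y x + 3) = (vx i y x, vx (Suc i) y x)"
    using assms by (simp add: gedge_def Let_def)
  ultimately show ?thesis using adj_gedge[of "5 * vid i y x + 3"] by simp
qed

text \<open>A retraction onto the layered graph: padding is moved to \<open>hub\<close>, its only
  neighbour among the good labels below \<open>V\<close>. Walks become lazy walks, so the padding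
  offers no shortcut.\<close>

definition "proj u = (if u < V \<and> good u then u else hub)"

lemma adj_proj:
  assumes "(u, v) \<in> adj Eg"
  shows "proj u = proj v \<or> (\<exists>i y x. core i y x \<and> y < Ny \<and> x < Dx \<and>
    (proj u = vx i y x \<and> proj v = vx (Suc i) y x \<or> proj v = vx i y x \<and> proj u = vx (Suc i) y x))"
proof -
  obtain j where j: "j < 5 * V" and uv: "{u, v} = (\<lambda>(u, v). {u, v}) (gedge j)"
    using assms unfolding adj_def Eg_def by blast
  have hub: "proj hub = hub" using good_hub hub_less by (simp add: proj_def)
  from j show ?thesis
  proof (cases rule: gedge_cases)
    case (core a)
    then have "proj (vx (layer a) (yc a) (xc a)) = vx (layer a) (yc a) (xc a)"
      "proj (vx (Suc (layer a)) (yc a) (xc a)) = vx (Suc (layer a)) (yc a) (xc a)"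
      using core_good[OF core(3)] core_edge_less[OF core(3)] by (simp_all add: proj_def)
    moreover have "u = vx (layer a) (yc a) (xc a) \<and> v = vx (Suc (layer a)) (yc a) (xc a) \<or>
        v = vx (layer a) (yc a) (xc a) \<and> u = vx (Suc (layer a)) (yc a) (xc a)"
      using uv core(4) by (auto simp: doubleton_eq_iff)
    ultimately show ?thesis using core(3) yc_less xc_less by metis
  next
    case (leaf a t)
    then show ?thesis using uv hub by (auto simp: doubleton_eq_iff proj_def)
  next
    case (leaves a t)
    then show ?thesis using uv by (auto simp: doubleton_eq_iff proj_def)
  next
    case (bad a)
    then show ?thesis using uv hub by (auto simp: doubleton_eq_iff proj_def)
  qed
qed

section \<open>Upper bounds on distances: explicit walks\<close>

lemma straight_walk:
  assumes y: "y < Ny" and z: "z < Ny"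
    and ex: "\<And>j. j < K \<Longrightarrow> \<exists>c < D. (\<forall>l < K. l + j < K \<longrightarrow> f l (dig N l y) c) \<and>
      (\<forall>l < K. K \<le> l + j + 1 \<longrightarrow> f (l + 1) (dig N l z) c)"
  shows "(vid 0 y 0, vid (K + 1) z 0) \<in> adj Eg ^^ (K + 1)"
proof -
  from ex obtain X where X: "\<And>j. j < K \<Longrightarrow> X j < D \<and> (\<forall>l < K. l + j < K \<longrightarrow> f l (dig N l y) (X j)) \<and>
      (\<forall>l < K. K \<le> l + j + 1 \<longrightarrow> f (l + 1) (dig N l z) (X j))" by metis
  \<comment> \<open>The coordinates are chosen before the walk and stay fixed in all inner
    layers.\<close>
  obtain x where x: "x < Dx" "\<forall>j < K. dig D j x = X j"
    using ex_digits[of K X D] X unfolding Dx_def by auto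
  \<comment> \<open>\<open>Y i\<close> interpolates: slots that layer \<open>i\<close> still
    reserves for the left tuple come from \<open>y\<close>, the others from
    \<open>z\<close>.\<close>
  have "\<forall>i. \<exists>y' < Ny. \<forall>p < K. dig N p y' = (if p + i < K then dig N p y else dig N p z)"
    unfolding Ny_def using N by (intro allI ex_digits) (simp add: dig_less)
  then have "\<exists>Y. \<forall>i. Y i < Ny \<and> (\<forall>p < K. dig N p (Y i) = (if p + i < K then dig N p y else dig N p z))"
    by (intro choice) blast
  then obtain Y where Y: "\<And>i. Y i < Ny"
    "\<And>i p. p < K \<Longrightarrow> dig N p (Y i) = (if p + i < K then dig N p y else dig N p z)" by blast
  note digY = dig_eqI[of _ N K, folded Ny_def]
  have Y0: "Y 0 = y" by (rule digY[OF Y(1) y]) (simp add: Y(2))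
  have YK: "Y i = z" if "K \<le> i" for i by (rule digY[OF Y(1) z]) (use that in \<open>simp add: Y(2)\<close>)
  have "(vid 0 y 0, vx i (Y i) x) \<in> adj Eg ^^ i" if "i \<le> K + 1" for i
    using that
  proof (induction i)
    case 0
    then show ?case by (simp add: Y0 vx_def)
  next
    case (Suc i)
    have "valid i (Y i) x"
      unfolding valid_def using X x(2) Y(2) by auto
    then have "(vx i (Y i) x, vx (Suc i) (Y i) x) \<in> adj Eg"
      using Suc.prems Y(1) x(1) by (intro adj_core) (auto simp: core_def)
    \<comment> \<open>The two tuples differ at most in slot \<open>K - Suc i\<close>, which is empty
      in layer \<open>Suc i\<close>.\<close>
    moreover have "vx (Suc i) (Y i) x = vx (Suc i) (Y (Suc i)) x"
    proof (cases "Suc i \<le> K")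
      case True
      have "zero_dig N (K - Suc i) (Y i) = zero_dig N (K - Suc i) (Y (Suc i))"
      proof (rule digY)
        fix p assume "p < K"
        then show "dig N p (zero_dig N (K - Suc i) (Y i)) = dig N p (zero_dig N (K - Suc i) (Y (Suc i)))"
          using Y(2)[of p] N True by (auto simp: dig_zero_dig)
      qed (use zero_dig_Ny Y(1) in auto)
      then show ?thesis using True by (simp add: vx_def)
    next
      case False
      then have "K \<le> i" by simp
      then show ?thesis using YK[of i] YK[of "Suc i"] by simp
    qed
    ultimately show ?case using Suc by (auto intro: relcompI)
  qed
  from this[of "K + 1"] show ?thesis using YK[of "K + 1"] by (simp add: vx_def)
qed

text \<open>Slots emptied on the way are refilled with the all-ones vector, so climbing never needs
  a new coordinate. The tuple \<open>z\<close> that is reached is immaterial.\<close>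

lemma walk_up:
  assumes "1 \<le> i" "i + d = K + 1" "i \<le> K \<longrightarrow> valid i y x" "y < Ny" "x < Dx"
  shows "\<exists>z < Ny. (vx i y x, vid (K + 1) z 0) \<in> adj Eg ^^ d"
  using assms
proof (induction d arbitrary: i y)
  case 0
  then show ?case by (auto simp: vx_def)
next
  case (Suc d)
  have edge: "(vx i y x, vx (Suc i) y x) \<in> adj Eg"
    using Suc.prems by (intro adj_core) (auto simp: core_def)
  define y' where "y' = (if Suc i \<le> K then zero_dig N (K - Suc i) y else y)"
  have y': "y' < Ny" "vx (Suc i) y x = vx (Suc i) y' x"
    using Suc.prems(4,5) vx_idem[OF Suc.prems(4,5), of "Suc i"] by (auto simp: y'_def zero_dig_Ny vx_def)
  have "Suc i \<le> K \<longrightarrow> valid (Suc i) y' x"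
    using Suc.prems(3) valid_zero_dig_Suc[of i y x] by (simp add: y'_def)
  then obtain z where "z < Ny" "(vx (Suc i) y' x, vid (K + 1) z 0) \<in> adj Eg ^^ d"
    using Suc.IH[of "Suc i" y'] Suc.prems y' by auto
  then show ?case using edge y'(2) relpow_Suc_I2 by metis
qed

lemma walk_tail:
  assumes "z < Ny" "j \<le> K"
  shows "(vid (K + 1) z 0, vid (K + 1 + j) z 0) \<in> adj Eg ^^ j"
  using assms(2)
proof (induction j)
  case (Suc j)
  have "(vx (K + 1 + j) z 0, vx (Suc (K + 1 + j)) z 0) \<in> adj Eg"
    using Suc.prems assms(1) Dx by (intro adj_core) (auto simp: core_def)
  then show ?case using Suc by (auto simp: vx_def intro: relcompI)
qed simp

lemma vertex_cases:
  assumes "v < 4 * V"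
  obtains (start) y where "y < Ny" "v = vid 0 y 0"
  | (middle) i y x where "1 \<le> i" "i \<le> K" "y < Ny" "x < Dx" "valid i y x" "v = vx i y x"
  | (tail) j z where "z < Ny" "j \<le> K" "v = vid (K + 1 + j) z 0"
  | (near_hub) "(v, hub) \<in> adj Eg"
proof (cases "v < V")
  case True
  show ?thesis
  proof (cases "good v")
    case good: True
    show ?thesis
    proof (cases "1 \<le> layer v \<and> layer v \<le> K")
      case True
      then show ?thesis using good middle[of "layer v" "yc v" "xc v"] by (simp add: good_def)
    next
      case False
      then have "v = vid (layer v) (yc v) 0" using good unfolding good_def vx_def by auto
      moreover have "layer v \<le> 2 * K + 1" using True by (simp add: less_V_iff)
      ultimately show ?thesis using False start[of "yc v"] tail[of "yc v" "layer v - (K + 1)"]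
        by (cases "layer v = 0") simp_all
    qed
  qed (use True adj_bad near_hub in auto)
next
  case False
  then have "(V + 3 * ((v - V) div 3) + (v - V) mod 3, hub) \<in> adj Eg"
    using assms by (intro adj_leaf) auto
  moreover have "V + 3 * ((v - V) div 3) + (v - V) mod 3 = v" using False by simp
  ultimately show ?thesis using near_hub by simp
qed

text \<open>Family \<open>K\<close> occurs only in the right tuple, here made of all-ones vectors,
  so the coordinate of \<open>coord_last\<close> serves every \<open>j\<close>.
  \<open>start_end\<close> is the mirror image, with family 0.\<close>

lemma start_hub: "y < Ny \<Longrightarrow> (vid 0 y 0, hub) \<in> adj Eg ^^ (K + 1)"
  unfolding hub_def
proof (rule straight_walk)
  show "\<exists>c<D. (\<forall>l<K. l + j < K \<longrightarrow> f l (dig N l y) c) \<and>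
      (\<forall>l<K. K \<le> l + j + 1 \<longrightarrow> f (l + 1) (dig N l 0) c)" for j
    using coord_last dummy by (metis dig_0 nat_neq_iff)
qed (use Ny in auto)

lemma start_end: "z < Ny \<Longrightarrow> (vid 0 0 0, vid (K + 1) z 0) \<in> adj Eg ^^ (K + 1)"
proof (rule straight_walk)
  show "\<exists>c<D. (\<forall>l<K. l + j < K \<longrightarrow> f l (dig N l 0) c) \<and>
      (\<forall>l<K. K \<le> l + j + 1 \<longrightarrow> f (l + 1) (dig N l z) c)" for j
    using coord_first dummy by (metis dig_0 Suc_eq_plus1 nat.distinct(1))
qed (use Ny in auto)

lemma connected_hub:
  assumes "v < 4 * V"
  shows "(v, hub) \<in> (adj Eg)\<^sup>*"
proof -
  have sym: "(b, a) \<in> (adj Eg)\<^sup>*" if "(a, b) \<in> (adj Eg)\<^sup>*" for a b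
    using that sym_rtrancl[of "adj Eg"] adj_sym by (meson symD symI)
  have start: "(vid 0 y 0, hub) \<in> (adj Eg)\<^sup>*" if "y < Ny" for y
    using start_hub[OF that] by (rule relpow_imp_rtrancl)
  have fin: "(vid (K + 1) z 0, hub) \<in> (adj Eg)\<^sup>*" if "z < Ny" for z
    using sym[OF relpow_imp_rtrancl[OF start_end[OF that]]] start[OF Ny] by (rule rtrancl_trans)
  from assms show ?thesis
  proof (cases rule: vertex_cases)
    case (start y)
    then show ?thesis using \<open>\<And>y. y < Ny \<Longrightarrow> (vid 0 y 0, hub) \<in> (adj Eg)\<^sup>*\<close> by simp
  next
    case (middle i y x)
    then obtain z where "z < Ny" "(v, vid (K + 1) z 0) \<in> adj Eg ^^ (K + 1 - i)"
      using walk_up[of i "K + 1 - i" y x] by auto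
    then show ?thesis using fin relpow_imp_rtrancl rtrancl_trans by metis
  next
    case (tail j z)
    then show ?thesis using sym[OF relpow_imp_rtrancl[OF walk_tail]] fin rtrancl_trans by metis
  next
    case near_hub
    then show ?thesis by (rule r_into_rtrancl)
  qed
qed

lemma connected_Eg: "connected_graph (4 * V) Eg"
  unfolding connected_graph_def
proof (intro allI impI)
  fix u v assume "u < 4 * V" "v < 4 * V"
  then have "(u, hub) \<in> (adj Eg)\<^sup>*" "(v, hub) \<in> (adj Eg)\<^sup>*" by (simp_all add: connected_hub)
  moreover from this(2) have "(hub, v) \<in> (adj Eg)\<^sup>*" using sym_rtrancl[of "adj Eg"] adj_sym
    by (meson symD symI)
  ultimately have "(u, hub) \<in> (adj Eg)\<^sup>*" "(hub, v) \<in> (adj Eg)\<^sup>*" by simp_all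
  then show "(u, v) \<in> (adj Eg)\<^sup>*" by (rule rtrancl_trans)
qed

lemma Sg_subset: "Sg \<subseteq> {..<V}"
  unfolding Sg_def using Dx by (auto intro: vid_less)

lemma instance_Eg: "bichromatic_instance (4 * V) Eg Sg"
proof -
  have "V \<in> {..<4 * V} - Sg" using Sg_subset hub_less by auto
  then have "{..<4 * V} - Sg \<noteq> {}" by blast
  then show ?thesis
    unfolding bichromatic_instance_def
    using simple_graph_Eg connected_Eg Sg_subset Ny by (auto simp: Sg_def)
qed

text \<open>Layer \<open>K + 1\<close> is reached in \<open>K + 1\<close> steps, and at most
  \<open>K\<close> more suffice for the rest: an inner layer \<open>i \<ge> 1\<close> lies
  \<open>K + 1 - i\<close> below, tails have length \<open>K\<close>, and padding is next to
  \<open>hub\<close>.\<close>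

lemma short_walks:
  assumes nosol: "\<And>w. (\<And>l. l \<le> K \<Longrightarrow> w l < N) \<Longrightarrow> \<exists>c < D. \<forall>l \<le> K. f l (w l) c"
    and s: "s \<in> Sg" and v: "v < 4 * V" "v \<notin> Sg"
  shows "\<exists>d \<le> 2 * K + 1. (s, v) \<in> adj Eg ^^ d"
proof -
  obtain y where y: "y < Ny" "s = vid 0 y 0" using s by (auto simp: Sg_def)
  have st: "(s, vid (K + 1) z 0) \<in> adj Eg ^^ (K + 1)" if z: "z < Ny" for z
    unfolding y(2)
  proof (rule straight_walk[OF y(1) z])
    fix j assume "j < K"
    \<comment> \<open>For coordinate \<open>j\<close>, vectors of both tuples form one choice from
      each family. Family \<open>l\<close> sits in slot \<open>l - 1\<close> of the right tuple;
      \<open>j < K\<close> makes \<open>l\<close> positive in that branch.\<close>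
    define w where "w l = (if l + j < K then dig N l y else dig N (l - 1) z)" for l
    have "w l < N" for l using N by (simp add: w_def dig_less)
    then obtain c where c: "c < D" "\<And>l. l \<le> K \<Longrightarrow> f l (w l) c" using nosol[of w] by blast
    have "f l (dig N l y) c" if "l < K" "l + j < K" for l
      using c(2)[of l] that by (simp add: w_def)
    moreover have "f (l + 1) (dig N l z) c" if "l < K" "K \<le> l + j + 1" for l
      using c(2)[of "l + 1"] that by (simp add: w_def)
    ultimately show "\<exists>c<D. (\<forall>l<K. l + j < K \<longrightarrow> f l (dig N l y) c) \<and>
        (\<forall>l<K. K \<le> l + j + 1 \<longrightarrow> f (l + 1) (dig N l z) c)" using c(1) by blast
  qed
  have rev: "(b, a) \<in> adj Eg ^^ d" if "(a, b) \<in> adj Eg ^^ d" for a b d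
    using that
  proof (induction d arbitrary: b)
    case (Suc d)
    then obtain c where "(a, c) \<in> adj Eg ^^ d" "(c, b) \<in> adj Eg" by auto
    then show ?case using Suc.IH adj_sym relpow_Suc_I2 by metis
  qed simp
  from v(1) show ?thesis
  proof (cases rule: vertex_cases)
    case (start y)
    then show ?thesis using v(2) by (auto simp: Sg_def)
  next
    case (middle i y x)
    then obtain z where "z < Ny" "(v, vid (K + 1) z 0) \<in> adj Eg ^^ (K + 1 - i)"
      using walk_up[of i "K + 1 - i" y x] by auto
    then have "(s, v) \<in> adj Eg ^^ (K + 1 + (K + 1 - i))"
      using st rev unfolding relpow_add[of "K + 1"] by blast
    then show ?thesis using middle(1) by (intro exI[of _ "K + 1 + (K + 1 - i)"]) auto
  next
    case (tail j z)
    then have "(s, v) \<in> adj Eg ^^ (K + 1 + j)"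
      using st walk_tail unfolding relpow_add[of "K + 1"] by blast
    then show ?thesis using tail by (intro exI[of _ "K + 1 + j"]) auto
  next
    case near_hub
    then have "(s, v) \<in> adj Eg ^^ (K + 1 + 1)"
      using st[OF Ny] adj_sym unfolding hub_def[symmetric] by (auto intro: relcompI)
    then show ?thesis using K by (intro exI[of _ "K + 1 + 1"]) auto
  qed
qed

section \<open>Lower bounds on distances: what a walk cannot change\<close>

lemma slots_start:
  assumes cut: "\<And>j. j \<le> m \<Longrightarrow> layer (u j) \<le> r"
    and step: "\<And>j. j < m \<Longrightarrow> u j = u (Suc j) \<or> (\<exists>i y x. core i y x \<and> y < Ny \<and> x < Dx \<and>
      (u j = vx i y x \<and> u (Suc j) = vx (Suc i) y x \<or> u (Suc j) = vx i y x \<and> u j = vx (Suc i) y x))"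
    and p: "p < K" "p + r < K"
  shows "dig N p (yc (u m)) = dig N p (yc (u 0))"
  using cut step
proof (induction m)
  case (Suc m)
  have "dig N p (yc (u (Suc m))) = dig N p (yc (u m))"
  proof -
    from Suc.prems(2)[of m] consider "u m = u (Suc m)" | i y x where "y < Ny" "x < Dx"
      "u m = vx i y x \<and> u (Suc m) = vx (Suc i) y x \<or> u (Suc m) = vx i y x \<and> u m = vx (Suc i) y x"
      by blast
    then show ?thesis
    proof cases
      case 2
      then have "Suc i \<le> r" using Suc.prems(1)[of m] Suc.prems(1)[of "Suc m"] by auto
      then have "dig N p (yc (vx i y x)) = dig N p y" "dig N p (yc (vx (Suc i) y x)) = dig N p y"
        using 2(1,2) p N by (auto simp: dig_zero_dig)
      then show ?thesis using 2(3) by auto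
    qed simp
  qed
  then show ?case using Suc by simp
qed simp

text \<open>An edge between layers \<open>i\<close> and \<open>Suc i\<close> affects no slots but
  \<open>K - i\<close> and \<open>K - Suc i\<close>. Above level \<open>r\<close> both are less than
  \<open>p\<close>; in \<open>slots_start\<close>, below level \<open>r\<close>, both are
  greater.\<close>

lemma slots_end:
  assumes cut: "\<And>j. m < j \<Longrightarrow> j \<le> n \<Longrightarrow> r < layer (u j)"
    and step: "\<And>j. m < j \<Longrightarrow> j < n \<Longrightarrow> u j = u (Suc j) \<or> (\<exists>i y x. core i y x \<and> y < Ny \<and> x < Dx \<and>
      (u j = vx i y x \<and> u (Suc j) = vx (Suc i) y x \<or> u (Suc j) = vx i y x \<and> u j = vx (Suc i) y x))"
    and p: "p < K" "K \<le> p + r" and n: "m < n"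
  shows "dig N p (yc (u n)) = dig N p (yc (u (Suc m)))"
  using n cut step
proof (induction n)
  case (Suc n)
  show ?case
  proof (cases "m = n")
    case False
    have "dig N p (yc (u (Suc n))) = dig N p (yc (u n))"
    proof -
      from Suc.prems(3)[of n] False Suc.prems(1) consider "u n = u (Suc n)" | i y x where "y < Ny" "x < Dx"
        "u n = vx i y x \<and> u (Suc n) = vx (Suc i) y x \<or> u (Suc n) = vx i y x \<and> u n = vx (Suc i) y x"
        by auto
      then show ?thesis
      proof cases
        case 2
        then have "r < i" using Suc.prems(1) Suc.prems(2)[of n] Suc.prems(2)[of "Suc n"] False by auto
        then have "dig N p (yc (vx i y x)) = dig N p y" "dig N p (yc (vx (Suc i) y x)) = dig N p y"
          using 2(1,2) p N by (auto simp: dig_zero_dig)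
        then show ?thesis using 2(3) by auto
      qed simp
    qed
    then show ?thesis using Suc False by simp
  qed simp
qed simp

text \<open>Coordinates are forgotten only in the outer layers.\<close>

lemma coords_between:
  assumes cut: "\<And>j. m < j \<Longrightarrow> j \<le> n \<Longrightarrow> 1 \<le> layer (u j) \<and> layer (u j) \<le> K"
    and step: "\<And>j. m < j \<Longrightarrow> j < n \<Longrightarrow> u j = u (Suc j) \<or> (\<exists>i y x. core i y x \<and> y < Ny \<and> x < Dx \<and>
      (u j = vx i y x \<and> u (Suc j) = vx (Suc i) y x \<or> u (Suc j) = vx i y x \<and> u j = vx (Suc i) y x))"
    and n: "m < n"
  shows "xc (u n) = xc (u (Suc m))"
  using n cut step
proof (induction n)
  case (Suc n)
  show ?case
  proof (cases "m = n")
    case False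
    have "xc (u (Suc n)) = xc (u n)"
    proof -
      from Suc.prems(3)[of n] False Suc.prems(1) consider "u n = u (Suc n)" | i y x where "y < Ny" "x < Dx"
        "u n = vx i y x \<and> u (Suc n) = vx (Suc i) y x \<or> u (Suc n) = vx i y x \<and> u n = vx (Suc i) y x"
        by auto
      then show ?thesis
      proof cases
        case 2
        then have "1 \<le> i" "Suc i \<le> K"
          using Suc.prems(1) Suc.prems(2)[of n] Suc.prems(2)[of "Suc n"] False by auto
        then show ?thesis using 2 by auto
      qed simp
    qed
    then show ?thesis using Suc False by simp
  qed simp
qed simp

lemma long_walks:
  assumes sol: "\<And>l. l \<le> K \<Longrightarrow> w l < N" "\<And>c. c < D \<Longrightarrow> \<exists>l \<le> K. \<not> f l (w l) c"
    and y: "y < Ny" "\<And>p. p < K \<Longrightarrow> dig N p y = w p"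
    and z: "z < Ny" "\<And>p. p < K \<Longrightarrow> dig N p z = w (Suc p)"
    and walk: "(vid 0 y 0, vid (2 * K + 1) z 0) \<in> adj Eg ^^ n"
  shows "4 * K + 1 \<le> n"
proof (rule ccontr)
  assume n: "\<not> 4 * K + 1 \<le> n"
  obtain v where v: "v 0 = vid 0 y 0" "v n = vid (2 * K + 1) z 0"
    "\<And>j. j < n \<Longrightarrow> (v j, v (Suc j)) \<in> adj Eg"
    using walk unfolding relpow_fun_conv by auto
  define u where "u j = proj (v j)" for j
  have step: "u j = u (Suc j) \<or> (\<exists>i y x. core i y x \<and> y < Ny \<and> x < Dx \<and>
      (u j = vx i y x \<and> u (Suc j) = vx (Suc i) y x \<or> u (Suc j) = vx i y x \<and> u j = vx (Suc i) y x))"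
    if "j < n" for j
    using adj_proj[OF v(3)[OF that]] unfolding u_def .
  have u0: "u 0 = vid 0 y 0" and un: "u n = vid (2 * K + 1) z 0"
    unfolding u_def v proj_def using y(1) z(1) Dx by (simp_all add: vid_less good_vid_outer)
  have "\<exists>r r' m m'. r < r' \<and> r' \<le> K \<and> cut (\<lambda>j. layer (u j)) n r m \<and> cut (\<lambda>j. layer (u j)) n r' m'"
  proof (rule two_cuts)
    show "layer (u 0) = 0" "layer (u n) = 2 * K + 1" using u0 un y(1) z(1) Dx by simp_all
    show "layer (u (Suc m)) \<le> Suc (layer (u m)) \<and> layer (u m) \<le> Suc (layer (u (Suc m)))" if "m < n" for m
      using step[OF that] by auto
  qed (use n in simp)
  then obtain r r' m m' where r: "r < r'" "r' \<le> K" and m: "m < n" "\<And>j. j \<le> m \<Longrightarrow> layer (u j) \<le> r"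
      "\<And>j. m < j \<Longrightarrow> j \<le> n \<Longrightarrow> r < layer (u j)"
    and m': "m' < n" "\<And>j. j \<le> m' \<Longrightarrow> layer (u j) \<le> r'"
      "\<And>j. m' < j \<Longrightarrow> j \<le> n \<Longrightarrow> r' < layer (u j)"
    unfolding cut_def by auto
  have cross: "\<exists>y x. core i y x \<and> y < Ny \<and> x < Dx \<and> u j = vx i y x \<and> u (Suc j) = vx (Suc i) y x"
    if j: "j < n" "layer (u j) \<le> i" "i < layer (u (Suc j))" for i j
  proof -
    from step[OF j(1)] j(2,3) obtain i' y x where "core i' y x" "y < Ny" "x < Dx"
      "u j = vx i' y x \<and> u (Suc j) = vx (Suc i') y x \<or> u (Suc j) = vx i' y x \<and> u j = vx (Suc i') y x"
      by auto
    moreover from this have "i' = i \<and> u j = vx i' y x \<and> u (Suc j) = vx (Suc i') y x"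
      using j(2,3) by auto
    ultimately show ?thesis by blast
  qed
  obtain y1 x1 where 1: "core r y1 x1" "y1 < Ny" "x1 < Dx" "u m = vx r y1 x1" "u (Suc m) = vx (Suc r) y1 x1"
    using cross[of m r] m by auto
  obtain y2 x2 where 2: "core r' y2 x2" "y2 < Ny" "x2 < Dx" "u m' = vx r' y2 x2" "u (Suc m') = vx (Suc r') y2 x2"
    using cross[of m' r'] m' by auto
  \<comment> \<open>Otherwise the walk would be in layer \<open>Suc r \<le> r'\<close> at time
    \<open>Suc m\<close>, after it has passed level \<open>r'\<close> for good.\<close>
  have mm': "m < m'"
  proof (rule ccontr)
    assume "\<not> m < m'"
    then have "r' < layer (u (Suc m))" using m'(3)[of "Suc m"] m(1) by simp
    then show False using 1 r by simp
  qed
  have valid: "valid r y1 x1" "valid r' y2 x2" using 1(1) 2(1) r by (simp_all add: core_def)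
  have pre: "dig N p y1 = w p" if "p < K" "p + r < K" for p
  proof -
    have "dig N p (yc (u m)) = dig N p (yc (u 0))"
      using m step that by (intro slots_start[of m u r]) auto
    moreover have "dig N p (yc (u m)) = dig N p y1"
      using 1 that N by (auto simp: dig_zero_dig)
    ultimately show ?thesis using u0 y that Dx by simp
  qed
  have post: "dig N p y2 = w (Suc p)" if "p < K" "K \<le> p + r'" for p
  proof -
    have "dig N p (yc (u n)) = dig N p (yc (u (Suc m')))"
      using m' step that by (intro slots_end[of m' n r']) auto
    moreover have "dig N p (yc (u (Suc m'))) = dig N p y2"
      using 2 that N by (auto simp: dig_zero_dig)
    ultimately show ?thesis using un z that Dx by simp
  qed
  \<comment> \<open>Between the crossings the layers range over \<open>Suc r, ..., r'\<close>, which
    are all inner.\<close>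
  have "xc (u m') = xc (u (Suc m))"
  proof (rule coords_between[OF _ _ mm'])
    show "1 \<le> layer (u j) \<and> layer (u j) \<le> K" if "m < j" "j \<le> m'" for j
      using that m(3)[of j] m'(1) m'(2)[of j] r by simp
  qed (use m' step in auto)
  then have x: "x2 = x1" using 1 2 r by simp
  \<comment> \<open>The lower level selects the coordinate. Families with \<open>l + r < K\<close>
    are still in place at the first crossing; the others, in slots \<open>p = l - 1\<close> with
    \<open>K \<le> p + r'\<close> because of \<open>r < r'\<close>, are in place at the
    second.\<close>
  have "f l (w l) (dig D r x1)" if "l \<le> K" for l
  proof (cases "l + r < K")
    case True
    then show ?thesis using valid(1)[unfolded valid_def, rule_format, of l r] pre[of l] by simp
  next
    case False
    then obtain p where p: "l = Suc p" using r by (cases l) auto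
    then show ?thesis using valid(2)[unfolded valid_def, rule_format, of p r] post[of p] that r False x
      by (auto split: if_splits)
  qed
  moreover have "dig D r x1 < D" using D by (rule dig_less)
  ultimately show False using sol(2) by blast
qed

lemma graph_dist_le: "(u, v) \<in> adj E ^^ d \<Longrightarrow> graph_dist E u v \<le> d"
  unfolding graph_dist_def by (rule Least_le)

lemma diameter_le:
  assumes "\<And>w. (\<And>l. l \<le> K \<Longrightarrow> w l < N) \<Longrightarrow> \<exists>c < D. \<forall>l \<le> K. f l (w l) c"
  shows "bichromatic_diameter (4 * V) Eg Sg \<le> 2 * K + 1"
proof -
  let ?A = "{graph_dist Eg s t | s t. s \<in> Sg \<and> t \<in> {..<4 * V} - Sg}"
  have le: "a \<le> 2 * K + 1" if "a \<in> ?A" for a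
    using that short_walks[OF assms] graph_dist_le le_trans by blast
  moreover have "?A \<subseteq> {..2 * K + 1}" using le by (intro subsetI) simp
  then have "finite ?A" by (rule finite_subset) simp
  moreover have "?A \<noteq> {}" using instance_Eg unfolding bichromatic_instance_def by blast
  ultimately show ?thesis unfolding bichromatic_diameter_def by (intro Max.boundedI) auto
qed

lemma diameter_ge:
  assumes sol: "\<And>l. l \<le> K \<Longrightarrow> w l < N" "\<And>c. c < D \<Longrightarrow> \<exists>l \<le> K. \<not> f l (w l) c"
  shows "4 * K + 1 \<le> bichromatic_diameter (4 * V) Eg Sg"
proof -
  let ?A = "{graph_dist Eg s t | s t. s \<in> Sg \<and> t \<in> {..<4 * V} - Sg}"
  obtain y where y: "y < Ny" "\<And>p. p < K \<Longrightarrow> dig N p y = w p"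
    using ex_digits[of K w N] sol(1) unfolding Ny_def by auto
  obtain z where z: "z < Ny" "\<And>p. p < K \<Longrightarrow> dig N p z = w (Suc p)"
    using ex_digits[of K "\<lambda>p. w (Suc p)" N] sol(1) unfolding Ny_def by auto
  have z': "vid (2 * K + 1) z 0 \<notin> Sg"
  proof
    assume "vid (2 * K + 1) z 0 \<in> Sg"
    then obtain y' where "y' < Ny" "vid (2 * K + 1) z 0 = vid 0 y' 0" unfolding Sg_def by blast
    then have "layer (vid (2 * K + 1) z 0) = 0" using Dx by simp
    then show False using z(1) Dx by simp
  qed
  have zV: "vid (2 * K + 1) z 0 < V" using z(1) Dx by (intro vid_less) simp_all
  have y': "vid 0 y 0 \<in> Sg" using y by (auto simp: Sg_def)
  have "(vid 0 y 0, vid (2 * K + 1) z 0) \<in> (adj Eg)\<^sup>*"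
    using connected_Eg y' zV Sg_subset unfolding connected_graph_def by (auto simp: subset_iff)
  then obtain d where "(vid 0 y 0, vid (2 * K + 1) z 0) \<in> adj Eg ^^ d" by (auto simp: rtrancl_power)
  then have "(vid 0 y 0, vid (2 * K + 1) z 0) \<in> adj Eg ^^ graph_dist Eg (vid 0 y 0) (vid (2 * K + 1) z 0)"
    unfolding graph_dist_def by (rule LeastI)
  then have "4 * K + 1 \<le> graph_dist Eg (vid 0 y 0) (vid (2 * K + 1) z 0)"
    using sol y z by (intro long_walks[of w y z]) blast+
  also have "\<dots> \<le> bichromatic_diameter (4 * V) Eg Sg"
    unfolding bichromatic_diameter_def
  proof (rule Max_ge)
    have "finite Sg" by (simp add: Sg_def)
    then have "finite ((\<lambda>(s, t). graph_dist Eg s t) ` (Sg \<times> ({..<4 * V} - Sg)))" by simp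
    then show "finite ?A" by (rule finite_subset[rotated]) auto
    have "vid (2 * K + 1) z 0 \<in> {..<4 * V} - Sg" using z' zV by simp
    then show "graph_dist Eg (vid 0 y 0) (vid (2 * K + 1) z 0) \<in> ?A" using y' by blast
  qed
  finally show ?thesis .
qed

end

subsection \<open>Compiling expressions to the word-RAM\<close>

text \<open>The exact number of steps and the arbitrary continuation \<open>P\<close> make fragments
  composable. Everything that precedes the simulated program has such a deterministic
  outcome.\<close>

definition steps_to ::
  "nat \<Rightarrow> program \<Rightarrow> (nat \<Rightarrow> nat) \<Rightarrow> (nat \<Rightarrow> nat) \<Rightarrow> nat \<Rightarrow> (nat \<Rightarrow> nat) \<Rightarrow> (nat \<Rightarrow> nat) \<Rightarrow> bool"
where
  "steps_to w A R M t R' M' \<longleftrightarrow> (\<forall>P. run w t (A @ P, R, M) = return_pmf (P, R', M'))"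

definition runs ::
  "nat \<Rightarrow> program \<Rightarrow> (nat \<Rightarrow> nat) \<Rightarrow> (nat \<Rightarrow> nat) \<Rightarrow> nat \<Rightarrow> ((nat \<Rightarrow> nat) \<Rightarrow> (nat \<Rightarrow> nat) \<Rightarrow> bool) \<Rightarrow> bool"
where
  "runs w A R M T Q \<longleftrightarrow> (\<exists>t \<le> T. \<exists>R' M'. steps_to w A R M t R' M' \<and> Q R' M')"

lemma run_add: "run w (s + t) c = bind_pmf (run w s c) (run w t)"
proof (induction s arbitrary: c)
  case (Suc s)
  then have "run w (s + t) = (\<lambda>c. bind_pmf (run w s c) (run w t))" by (rule ext)
  then show ?case by (simp add: bind_assoc_pmf)
qed (simp add: bind_return_pmf)

lemma steps_to_append:
  assumes "steps_to w A R M s R1 M1" "steps_to w B R1 M1 t R2 M2"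
  shows "steps_to w (A @ B) R M (s + t) R2 M2"
  using assms by (simp add: steps_to_def run_add bind_return_pmf)

lemma steps_to_step:
  assumes "\<And>P. step w (i # P, R, M) = return_pmf (B @ P, R1, M1)" "steps_to w (B @ A) R1 M1 t R2 M2"
  shows "steps_to w (i # A) R M (Suc t) R2 M2"
  using assms by (simp add: steps_to_def bind_return_pmf)

lemma runs_Nil: "Q R M \<Longrightarrow> runs w [] R M T Q"
  unfolding runs_def steps_to_def by (intro exI[of _ 0] exI conjI) auto

lemma runs_step:
  assumes "\<And>P. step w (i # P, R, M) = return_pmf (B @ P, R1, M1)" "1 \<le> T" "runs w (B @ A) R1 M1 (T - 1) Q"
  shows "runs w (i # A) R M T Q"
proof -
  obtain t R2 M2 where t: "t \<le> T - 1" "steps_to w (B @ A) R1 M1 t R2 M2" "Q R2 M2"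
    using assms(3) unfolding runs_def by blast
  have "steps_to w (i # A) R M (Suc t) R2 M2" using assms(1) t(2) by (rule steps_to_step)
  then show ?thesis using t assms(2) unfolding runs_def by (intro exI[of _ "Suc t"]) auto
qed

lemma runs_Const: "1 \<le> T \<Longrightarrow> runs w A (R(r := x mod 2 ^ w)) M (T - 1) Q \<Longrightarrow> runs w (Const r x # A) R M T Q"
  by (rule runs_step[where B = "[]"]) simp_all

lemma runs_Op:
  "1 \<le> T \<Longrightarrow> runs w A (R(r := eval_op w g (R a) (R b))) M (T - 1) Q \<Longrightarrow> runs w (Op g r a b # A) R M T Q"
  by (rule runs_step[where B = "[]"]) simp_all

lemma runs_Load: "1 \<le> T \<Longrightarrow> runs w A (R(r := M (R a))) M (T - 1) Q \<Longrightarrow> runs w (Load r a # A) R M T Q"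
  by (rule runs_step[where B = "[]"]) simp_all

lemma runs_Store: "1 \<le> T \<Longrightarrow> runs w A R (M(R a := R r)) (T - 1) Q \<Longrightarrow> runs w (Store a r # A) R M T Q"
  by (rule runs_step[where B = "[]"]) simp_all

lemmas runs_straight = runs_Const runs_Op runs_Load runs_Store runs_Nil

lemma runs_append:
  assumes "runs w A R M S (\<lambda>R' M'. runs w B R' M' T Q)" "S + T \<le> U"
  shows "runs w (A @ B) R M U Q"
proof -
  obtain s t R1 M1 R2 M2 where "s \<le> S" "steps_to w A R M s R1 M1" "t \<le> T"
    "steps_to w B R1 M1 t R2 M2" "Q R2 M2"
    using assms(1) unfolding runs_def by blast
  then show ?thesis
    using steps_to_append assms(2) unfolding runs_def by (intro exI[of _ "s + t"] conjI exI) auto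
qed

lemma runs_mono:
  assumes "runs w A R M S Q" "S \<le> T" "\<And>R' M'. Q R' M' \<Longrightarrow> Q' R' M'"
  shows "runs w A R M T Q'"
  using assms unfolding runs_def by (meson le_trans)

text \<open>Each round pays one extra step for its test; the final step is the failing test.\<close>

lemma runs_Loop:
  assumes body: "\<And>i R M. i < n \<Longrightarrow> I i R M \<Longrightarrow> runs w A R M T (I (Suc i))"
    and test: "\<And>i R M. i \<le> n \<Longrightarrow> I i R M \<Longrightarrow> R g \<noteq> 0 \<longleftrightarrow> i < n"
    and init: "I 0 R M"
  shows "runs w [Loop g A] R M (n * (T + 1) + 1) (I n)"
proof -
  have "runs w [Loop g A] R M (d * (T + 1) + 1) (I n)" if "I i R M" "i + d = n" for i d R M
    using that
  proof (induction d arbitrary: i R M)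
    case 0
    then have "R g = 0" using test[of i R M] by auto
    then show ?case using 0 by (intro runs_step[where B = "[]"]) (auto intro: runs_Nil)
  next
    case (Suc d)
    then have g: "R g \<noteq> 0" using test[of i R M] by auto
    have A: "runs w (A @ [Loop g A]) R M (T + (d * (T + 1) + 1)) (I n)"
    proof (rule runs_append)
      show "runs w A R M T (\<lambda>R' M'. runs w [Loop g A] R' M' (d * (T + 1) + 1) (I n))"
        using Suc.prems by (intro runs_mono[OF body[of i]] Suc.IH[of "Suc i"]) auto
    qed simp
    have eq: "Suc d * (T + 1) + 1 - 1 = T + (d * (T + 1) + 1)" by simp
    show ?case
    proof (rule runs_step)
      show "step w (Loop g A # P, R, M) = return_pmf ((A @ [Loop g A]) @ P, R, M)" for P
        using g by simp
      show "runs w ((A @ [Loop g A]) @ []) R M (Suc d * (T + 1) + 1 - 1) (I n)"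
        using A by (simp only: append_Nil2 eq)
    qed simp
  qed
  from this[of 0 R M n] init show ?thesis by simp
qed

text \<open>Bounded sums are the only iteration. They suffice for scanning a clause and for bit
  lengths, and they leave the bounds on value and time to structural recursion.\<close>

datatype expr =
    ENum nat
  | EVar nat
  | EBin binop expr expr
  | EMem expr
  | ESum nat expr expr

fun ideal_op :: "binop \<Rightarrow> nat \<Rightarrow> nat \<Rightarrow> nat" where
  "ideal_op ADD x y = x + y"
| "ideal_op SUB x y = x - y"
| "ideal_op MUL x y = x * y"
| "ideal_op DIV x y = x div y"
| "ideal_op MOD x y = x mod y"
| "ideal_op BAND x y = x AND y"
| "ideal_op BOR x y = x OR y"
| "ideal_op BXOR x y = x XOR y"
| "ideal_op SHL x y = push_bit y x"
| "ideal_op SHR x y = drop_bit y x"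
| "ideal_op LESS x y = of_bool (x < y)"
| "ideal_op EQ x y = of_bool (x = y)"

fun ev :: "(nat \<Rightarrow> nat) \<Rightarrow> (nat \<Rightarrow> nat) \<Rightarrow> expr \<Rightarrow> nat" where
  "ev e M (ENum c) = c"
| "ev e M (EVar v) = e v"
| "ev e M (EBin g a b) = ideal_op g (ev e M a) (ev e M b)"
| "ev e M (EMem a) = M (ev e M a)"
| "ev e M (ESum v a b) = (\<Sum>i < ev e M a. ev (e(v := i)) M b)"

text \<open>
  Variables and memory cells that are read are below \<open>B\<close>, and sums have at most \<open>S\<close> terms. Then the
  value of an expression is below a fixed power of \<open>B\<close>, and no overflow occurs in words of that size.
\<close>

fun safe :: "nat \<Rightarrow> nat \<Rightarrow> (nat \<Rightarrow> nat) \<Rightarrow> (nat \<Rightarrow> nat) \<Rightarrow> expr \<Rightarrow> bool" where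
  "safe B S e M (ENum c) = True"
| "safe B S e M (EVar v) = (e v < B)"
| "safe B S e M (EBin g a b) = (safe B S e M a \<and> safe B S e M b \<and> g \<notin> {BAND, BOR, BXOR} \<and>
     (g = SUB \<longrightarrow> ev e M b \<le> ev e M a) \<and> (g = SHL \<longrightarrow> push_bit (ev e M b) (ev e M a) < B))"
| "safe B S e M (EMem a) = (safe B S e M a \<and> M (ev e M a) < B)"
| "safe B S e M (ESum v a b) = (safe B S e M a \<and> ev e M a \<le> S \<and>
     (\<forall>i < ev e M a. safe B S (e(v := i)) M b))"

text \<open>The exponent of \<open>B\<close> in the value bound. It does not depend on
  \<open>B\<close>: a constant gets \<open>c + 1\<close> because of \<open>c < 2 ^ (c + 1)\<close>.
  A sum has fewer than \<open>B\<close> terms, hence its extra 1.\<close>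

fun deg :: "expr \<Rightarrow> nat" where
  "deg (ENum c) = c + 1"
| "deg (EVar v) = 1"
| "deg (EBin g a b) = deg a + deg b"
| "deg (EMem a) = 1 + deg a"
| "deg (ESum v a b) = 1 + deg a + deg b"

text \<open>In a sum, 5 is the overhead of a round (four instructions and the test), and 7 consists
  of four instructions of setup, the failing test and two closing moves.\<close>

fun cost :: "nat \<Rightarrow> expr \<Rightarrow> nat" where
  "cost S (ENum c) = 1"
| "cost S (EVar v) = 1"
| "cost S (EBin g a b) = cost S a + cost S b + 1"
| "cost S (EMem a) = cost S a + 1"
| "cost S (ESum v a b) = cost S a + (S * (cost S b + 5) + 7)"

text \<open>
  Registers are divided into those of the simulated program (even numbers), program variables and
  temporaries.
\<close>

definition rv :: "nat \<Rightarrow> nat" where "rv v = 4 * v + 1"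
definition rt :: "nat \<Rightarrow> nat" where "rt d = 4 * d + 3"

lemma rv_rt [simp]:
  "rv u = rv v \<longleftrightarrow> u = v" "rt c = rt d \<longleftrightarrow> c = d" "rv v \<noteq> rt d" "rt d \<noteq> rv v"
  "rv v \<noteq> 2 * r" "2 * r \<noteq> rv v" "rt d \<noteq> 2 * r" "2 * r \<noteq> rt d"
  unfolding rv_def rt_def by presburger+

text \<open>The result goes to \<open>rt d\<close>; higher temporaries form a stack.
  \<open>BOR\<close> of a register with itself serves as a move. A sum keeps its bound in
  \<open>rt d\<close> and, in the next three, the saved value of its variable, the accumulator and
  the test.\<close>

fun compile :: "nat \<Rightarrow> expr \<Rightarrow> program" where
  "compile d (ENum c) = [Const (rt d) c]"
| "compile d (EVar v) = [Op BOR (rt d) (rv v) (rv v)]"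
| "compile d (EBin g a b) = compile d a @ compile (Suc d) b @ [Op g (rt d) (rt d) (rt (Suc d))]"
| "compile d (EMem a) = compile d a @ [Load (rt d) (rt d)]"
| "compile d (ESum v a b) = compile d a @
     [Op BOR (rt (d + 1)) (rv v) (rv v), Const (rt (d + 2)) 0, Const (rv v) 0,
      Op LESS (rt (d + 3)) (rv v) (rt d)] @
     [Loop (rt (d + 3)) (compile (d + 4) b @
       [Op ADD (rt (d + 2)) (rt (d + 2)) (rt (d + 4)), Const (rt (d + 4)) 1,
        Op ADD (rv v) (rv v) (rt (d + 4)), Op LESS (rt (d + 3)) (rv v) (rt d)])] @
     [Op BOR (rv v) (rt (d + 1)) (rt (d + 1)), Op BOR (rt d) (rt (d + 2)) (rt (d + 2))]"

lemma deg_pos: "1 \<le> deg x"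
  by (induction x) auto

lemma power_leD:
  fixes B :: nat
  assumes "2 \<le> B" "m \<le> n" "B ^ n \<le> x"
  shows "B ^ m \<le> x"
  using assms(1) by (intro le_trans[OF power_increasing[OF assms(2)] assms(3)]) simp

text \<open>Numbers that are at least 2 have a sum no larger than their product, so degrees add
  under \<open>ADD\<close> as they do under \<open>MUL\<close>.\<close>

lemma power_add_le:
  fixes B x y :: nat
  assumes "2 \<le> B" "x < B ^ m" "y < B ^ n" "1 \<le> m" "1 \<le> n"
  shows "x + y < B ^ (m + n)"
proof -
  have *: "2 \<le> B ^ k" if "1 \<le> k" for k
    using power_increasing[OF that, of B] assms(1) by simp
  have "u + v \<le> u * v" if "2 \<le> u" "2 \<le> v" for u v :: nat
    using that by (auto dest!: le_Suc_ex simp: algebra_simps)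
  note this[OF *[OF assms(4)] *[OF assms(5)]]
  then show ?thesis using assms by (simp add: power_add)
qed

lemma ev_less:
  assumes "safe B S e M x" "2 \<le> B" "S < B"
  shows "ev e M x < B ^ deg x"
  using assms(1)
proof (induction x arbitrary: e)
  case (ENum c)
  have "c < 2 ^ (c + 1)" by (meson le_add1 less_exp less_le_trans one_le_numeral power_increasing)
  also have "\<dots> \<le> B ^ (c + 1)" using assms(2) by (rule power_mono) simp
  finally show ?case by simp
next
  case (EVar v)
  then show ?case by simp
next
  case (EBin g a b)
  then have a: "ev e M a < B ^ deg a" and b: "ev e M b < B ^ deg b" by simp_all
  have le: "B ^ deg a \<le> B ^ (deg a + deg b)" "B ^ 1 \<le> B ^ (deg a + deg b)"
    using assms(2) deg_pos[of a] by (intro power_increasing; simp)+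
  have a': "x < B ^ (deg a + deg b)" if "x \<le> ev e M a" for x using that a le(1) by linarith
  have b1: "(of_bool c :: nat) < B ^ (deg a + deg b)" for c using le(2) assms(2) by (cases c) auto
  show ?case
  proof (cases g)
    case ADD
    then show ?thesis using power_add_le[OF assms(2) a b deg_pos deg_pos] by simp
  next
    case MUL
    have "ev e M a * ev e M b < B ^ deg a * B ^ deg b" using a b by (rule mult_strict_mono'[OF _ _ le0 le0])
    then show ?thesis using MUL by (simp add: power_add)
  next
    case SHL
    then show ?thesis using EBin.prems le(2) by simp
  qed (use EBin.prems a' b1 in \<open>simp_all add: drop_bit_eq_div\<close>)
next
  case (EMem a)
  then have "M (ev e M a) < B ^ 1" by simp
  also have "\<dots> \<le> B ^ deg (EMem a)" using assms(2) by (intro power_increasing) simp_all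
  finally show ?case by simp
next
  case (ESum v a b)
  have "ev (e(v := i)) M b \<le> B ^ deg b" if "i < ev e M a" for i
  proof -
    have "safe B S (e(v := i)) M b" using ESum.prems that by simp
    from ESum.IH(2)[OF this] show ?thesis by (rule less_imp_le)
  qed
  then have "(\<Sum>i < ev e M a. ev (e(v := i)) M b) \<le> ev e M a * B ^ deg b"
    using sum_bounded_above[of "{..<ev e M a}" "\<lambda>i. ev (e(v := i)) M b" "B ^ deg b"]
    by simp
  also have "\<dots> \<le> S * B ^ deg b" using ESum.prems by simp
  also have "\<dots> < B * B ^ deg b" using assms by (intro mult_strict_right_mono) auto
  also have "\<dots> \<le> B ^ (1 + deg a + deg b)" using assms(2)
    by (subst power_Suc[symmetric], intro power_increasing) auto
  finally show ?case by simp
qed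

lemma eval_ideal:
  assumes "g \<notin> {BAND, BOR, BXOR}" "g = SUB \<longrightarrow> y \<le> x" "ideal_op g x y < 2 ^ w"
  shows "eval_op w g x y = ideal_op g x y"
proof (cases "g = SUB")
  case True
  have eq: "int x - int y = int (x - y)" using True assms(2) by simp
  have "int (x - y) mod 2 ^ w = int ((x - y) mod 2 ^ w)" by (simp add: zmod_int)
  then show ?thesis using True assms(3) unfolding True eval_op.simps ideal_op.simps eq by simp
qed (use assms in \<open>cases g; simp\<close>)

text \<open>The last conjunct carries the induction: an operand compiled at greater depth leaves
  earlier results alone, and a sum restores its variable.\<close>

lemma compile_runs:
  assumes "safe B S (\<lambda>v. R (rv v)) M x" "2 \<le> B" "S + 1 < B" "B ^ deg x \<le> 2 ^ w"
  shows "runs w (compile d x) R M (cost S x) (\<lambda>R' M'. M' = M \<and> R' (rt d) = ev (\<lambda>v. R (rv v)) M x \<and>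
    (\<forall>r. (\<forall>i \<ge> d. r \<noteq> rt i) \<longrightarrow> R' r = R r))"
  using assms(1,4)
proof (induction x arbitrary: d R)
  case (ENum c)
  have "c < 2 ^ w" using ev_less[OF ENum.prems(1) assms(2)] assms(3) ENum.prems(2) by simp
  then show ?case by (auto intro!: runs_straight)
next
  case (EVar v)
  then show ?case by (auto intro!: runs_straight)
next
  case (EBin g a b)
  let ?e = "\<lambda>v. R (rv v)"
  have le: "B ^ deg a \<le> 2 ^ w" "B ^ deg b \<le> 2 ^ w"
    using power_leD[OF assms(2) _ EBin.prems(2)] by simp_all
  have less: "ideal_op g (ev ?e M a) (ev ?e M b) < 2 ^ w"
    using ev_less[OF EBin.prems(1) assms(2)] assms(3) EBin.prems(2) by simp
  have op: "eval_op w g (ev ?e M a) (ev ?e M b) = ideal_op g (ev ?e M a) (ev ?e M b)"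
    using EBin.prems(1) less by (intro eval_ideal) simp_all
  show ?case unfolding compile.simps
  proof (rule runs_append[OF runs_mono[OF EBin.IH(1) order_refl]])
    fix R1 M1
    assume 1: "M1 = M \<and> R1 (rt d) = ev ?e M a \<and> (\<forall>r. (\<forall>i \<ge> d. r \<noteq> rt i) \<longrightarrow> R1 r = R r)"
    then have e1: "(\<lambda>v. R1 (rv v)) = ?e" and M1: "M1 = M" by auto
    show "runs w (compile (Suc d) b @ [Op g (rt d) (rt d) (rt (Suc d))]) R1 M1 (cost S b + 1)
      (\<lambda>R' M'. M' = M \<and> R' (rt d) = ev ?e M (EBin g a b) \<and> (\<forall>r. (\<forall>i \<ge> d. r \<noteq> rt i) \<longrightarrow> R' r = R r))"
      unfolding M1
    proof (rule runs_append[OF runs_mono[OF EBin.IH(2) order_refl]])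
      fix R2 M2
      assume 2: "M2 = M \<and> R2 (rt (Suc d)) = ev (\<lambda>v. R1 (rv v)) M b \<and>
        (\<forall>r. (\<forall>i \<ge> Suc d. r \<noteq> rt i) \<longrightarrow> R2 r = R1 r)"
      then have "R2 (rt d) = ev ?e M a" using 1 by auto
      then show "runs w [Op g (rt d) (rt d) (rt (Suc d))] R2 M2 1
        (\<lambda>R' M'. M' = M \<and> R' (rt d) = ev ?e M (EBin g a b) \<and> (\<forall>r. (\<forall>i \<ge> d. r \<noteq> rt i) \<longrightarrow> R' r = R r))"
        using 1 2 op e1 by (auto intro!: runs_straight)
    qed (use EBin.prems le e1 1 in auto)
  qed (use EBin.prems le in auto)
next
  case (EMem a)
  have le: "B ^ deg a \<le> 2 ^ w"
    using power_leD[OF assms(2) _ EMem.prems(2)] by simp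
  show ?case unfolding compile.simps
    by (rule runs_append[OF runs_mono[OF EMem.IH order_refl]])
      (use EMem.prems le in \<open>auto intro!: runs_straight\<close>)
next
  case (ESum v a b)
  let ?e = "\<lambda>v. R (rv v)"
  have le: "B ^ deg a \<le> 2 ^ w" "B ^ deg b \<le> 2 ^ w" "B \<le> 2 ^ w"
    using power_leD[OF assms(2) _ ESum.prems(2)] power_leD[OF assms(2) _ ESum.prems(2), of 1]
    by simp_all
  define n where "n = ev ?e M a"
  have n: "n \<le> S" "n + 1 < 2 ^ w" using ESum.prems(1) assms(3) le(3) by (simp_all add: n_def)
  define s where "s i = (\<Sum>j < i. ev (?e(v := j)) M b)" for i
  have "s n < 2 ^ w"
    using ev_less[OF ESum.prems(1) assms(2)] assms(3) ESum.prems(2) by (simp add: s_def n_def)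
  then have s: "s i < 2 ^ w" if "i \<le> n" for i
    using sum_mono2[of "{..<n}" "{..<i}" "\<lambda>j. ev (?e(v := j)) M b"] that unfolding s_def by force
  define I where "I i R' M' \<longleftrightarrow> M' = M \<and> R' (rv v) = i \<and> R' (rt d) = n \<and> R' (rt (d + 1)) = R (rv v) \<and>
    R' (rt (d + 2)) = s i \<and> R' (rt (d + 3)) = of_bool (i < n) \<and>
    (\<forall>r. r \<noteq> rv v \<and> (\<forall>i \<ge> d. r \<noteq> rt i) \<longrightarrow> R' r = R r)" for i :: nat and R' M' :: "nat \<Rightarrow> nat"
  have body: "runs w (compile (d + 4) b @
       [Op ADD (rt (d + 2)) (rt (d + 2)) (rt (d + 4)), Const (rt (d + 4)) 1,
        Op ADD (rv v) (rv v) (rt (d + 4)), Op LESS (rt (d + 3)) (rv v) (rt d)]) R1 M1 (cost S b + 4) (I (Suc i))"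
    if i: "i < n" and I: "I i R1 M1" for i R1 M1
  proof -
    have e1: "(\<lambda>u. R1 (rv u)) = ?e(v := i)" using I unfolding I_def by auto
    have M1: "M1 = M" using I unfolding I_def by simp
    have "runs w (compile (d + 4) b) R1 M (cost S b) (\<lambda>R' M'. M' = M \<and>
        R' (rt (d + 4)) = ev (\<lambda>u. R1 (rv u)) M b \<and> (\<forall>r. (\<forall>i \<ge> d + 4. r \<noteq> rt i) \<longrightarrow> R' r = R1 r))"
      using ESum.prems(1) i le unfolding n_def by (intro ESum.IH(2)) (simp_all only: e1 safe.simps)
    then show ?thesis unfolding M1
    proof (rule runs_append[OF runs_mono[OF _ order_refl]])
      fix R2 M2
      assume 2: "M2 = M \<and> R2 (rt (d + 4)) = ev (\<lambda>u. R1 (rv u)) M b \<and>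
        (\<forall>r. (\<forall>i \<ge> d + 4. r \<noteq> rt i) \<longrightarrow> R2 r = R1 r)"
      have R2: "R2 (rv v) = i" "R2 (rt d) = n" "R2 (rt (d + 1)) = R (rv v)" "R2 (rt (d + 2)) = s i"
        "R2 (rt (d + 4)) = ev (?e(v := i)) M b"
        "\<And>r. r \<noteq> rv v \<Longrightarrow> \<forall>i \<ge> d. r \<noteq> rt i \<Longrightarrow> R2 r = R r"
        using 2 I unfolding I_def e1 by auto
      have "s i + ev (?e(v := i)) M b = s (Suc i)" by (simp add: s_def)
      moreover have "s (Suc i) mod 2 ^ w = s (Suc i)" "Suc i mod 2 ^ w = Suc i" "1 mod 2 ^ w = (1::nat)"
        using s[of "Suc i"] n i by (simp_all, cases w, simp_all)
      ultimately show "runs w [Op ADD (rt (d + 2)) (rt (d + 2)) (rt (d + 4)), Const (rt (d + 4)) 1,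
        Op ADD (rv v) (rv v) (rt (d + 4)), Op LESS (rt (d + 3)) (rv v) (rt d)] R2 M2 4 (I (Suc i))"
        using 2 R2 by (intro runs_straight) (auto simp: I_def)
    qed simp
  qed
  have loop: "runs w [Loop (rt (d + 3)) (compile (d + 4) b @
       [Op ADD (rt (d + 2)) (rt (d + 2)) (rt (d + 4)), Const (rt (d + 4)) 1,
        Op ADD (rv v) (rv v) (rt (d + 4)), Op LESS (rt (d + 3)) (rv v) (rt d)])] R1 M1
       (S * (cost S b + 5) + 1) (I n)" if "I 0 R1 M1" for R1 M1
  proof (rule runs_mono[OF runs_Loop[of n I]])
    show "runs w (compile (d + 4) b @
       [Op ADD (rt (d + 2)) (rt (d + 2)) (rt (d + 4)), Const (rt (d + 4)) 1,
        Op ADD (rv v) (rv v) (rt (d + 4)), Op LESS (rt (d + 3)) (rv v) (rt d)]) R1 M1 (cost S b + 4) (I (Suc i))"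
      if "i < n" "I i R1 M1" for i R1 M1 using that by (rule body)
    show "R1 (rt (d + 3)) \<noteq> 0 \<longleftrightarrow> i < n" if "I i R1 M1" for i R1 M1 using that unfolding I_def by simp
    show "n * (cost S b + 4 + 1) + 1 \<le> S * (cost S b + 5) + 1"
      using mult_le_mono1[OF n(1), of "cost S b + 5"] by (simp add: algebra_simps)
  qed (use that in simp_all)
  let ?Q = "\<lambda>R' M'. M' = M \<and> R' (rt d) = ev ?e M (ESum v a b) \<and> (\<forall>r. (\<forall>i \<ge> d. r \<noteq> rt i) \<longrightarrow> R' r = R r)"
  show ?case unfolding compile.simps cost.simps
  proof (rule runs_append[OF runs_mono[OF ESum.IH(1) order_refl]])
    fix R1 M1
    assume 1: "M1 = M \<and> R1 (rt d) = ev ?e M a \<and> (\<forall>r. (\<forall>i \<ge> d. r \<noteq> rt i) \<longrightarrow> R1 r = R r)"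
    show "runs w ([Op BOR (rt (d + 1)) (rv v) (rv v), Const (rt (d + 2)) 0, Const (rv v) 0,
      Op LESS (rt (d + 3)) (rv v) (rt d)] @
     [Loop (rt (d + 3)) (compile (d + 4) b @
       [Op ADD (rt (d + 2)) (rt (d + 2)) (rt (d + 4)), Const (rt (d + 4)) 1,
        Op ADD (rv v) (rv v) (rt (d + 4)), Op LESS (rt (d + 3)) (rv v) (rt d)])] @
     [Op BOR (rv v) (rt (d + 1)) (rt (d + 1)), Op BOR (rt d) (rt (d + 2)) (rt (d + 2))]) R1 M1
     (4 + ((S * (cost S b + 5) + 1) + 2)) ?Q"
    proof (rule runs_append)
      show "runs w [Op BOR (rt (d + 1)) (rv v) (rv v), Const (rt (d + 2)) 0, Const (rv v) 0,
        Op LESS (rt (d + 3)) (rv v) (rt d)] R1 M1 4 (\<lambda>R' M'. runs w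
        ([Loop (rt (d + 3)) (compile (d + 4) b @
       [Op ADD (rt (d + 2)) (rt (d + 2)) (rt (d + 4)), Const (rt (d + 4)) 1,
        Op ADD (rv v) (rv v) (rt (d + 4)), Op LESS (rt (d + 3)) (rv v) (rt d)])] @
     [Op BOR (rv v) (rt (d + 1)) (rt (d + 1)), Op BOR (rt d) (rt (d + 2)) (rt (d + 2))]) R' M'
       ((S * (cost S b + 5) + 1) + 2) ?Q)"
      proof (rule runs_mono[OF _ order_refl])
        show "runs w [Op BOR (rt (d + 1)) (rv v) (rv v), Const (rt (d + 2)) 0, Const (rv v) 0,
          Op LESS (rt (d + 3)) (rv v) (rt d)] R1 M1 4 (I 0)"
          using 1 by (intro runs_straight) (auto simp: I_def s_def n_def)
        fix R2 M2 assume "I 0 R2 M2"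
        then show "runs w ([Loop (rt (d + 3)) (compile (d + 4) b @
         [Op ADD (rt (d + 2)) (rt (d + 2)) (rt (d + 4)), Const (rt (d + 4)) 1,
          Op ADD (rv v) (rv v) (rt (d + 4)), Op LESS (rt (d + 3)) (rv v) (rt d)])] @
         [Op BOR (rv v) (rt (d + 1)) (rt (d + 1)), Op BOR (rt d) (rt (d + 2)) (rt (d + 2))]) R2 M2
           ((S * (cost S b + 5) + 1) + 2) ?Q"
        proof (intro runs_append[OF runs_mono[OF loop order_refl]])
          fix R3 M3 assume "I n R3 M3"
          then show "runs w [Op BOR (rv v) (rt (d + 1)) (rt (d + 1)), Op BOR (rt d) (rt (d + 2)) (rt (d + 2))]
            R3 M3 2 ?Q"
            by (intro runs_straight) (auto simp: I_def s_def n_def)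
        qed simp_all
      qed
    qed simp
  qed (use ESum.prems le in auto)
qed

text \<open>Even registers belong to the simulated program, which has to start with zeros.\<close>

definition state :: "(nat \<Rightarrow> nat) \<Rightarrow> (nat \<Rightarrow> nat) \<Rightarrow> bool" where
  "state e R \<longleftrightarrow> (\<forall>v. R (rv v) = e v) \<and> (\<forall>r. R (2 * r) = 0)"

definition assign :: "nat \<Rightarrow> expr \<Rightarrow> program" where
  "assign v x = compile 0 x @ [Op BOR (rv v) (rt 0) (rt 0)]"

lemma runs_assign:
  assumes "state e R" "safe B S e M x" "2 \<le> B" "S + 1 < B" "B ^ deg x \<le> 2 ^ w"
  shows "runs w (assign v x) R M (cost S x + 1) (\<lambda>R' M'. state (e(v := ev e M x)) R' \<and> M' = M)"
proof -
  have e: "(\<lambda>v. R (rv v)) = e" using assms(1) by (auto simp: state_def)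
  show ?thesis unfolding assign_def
  proof (rule runs_append[OF runs_mono[OF compile_runs[of B S R] order_refl]])
    fix R' M' assume "M' = M \<and> R' (rt 0) = ev (\<lambda>v. R (rv v)) M x \<and>
      (\<forall>r. (\<forall>i \<ge> 0. r \<noteq> rt i) \<longrightarrow> R' r = R r)"
    then show "runs w [Op BOR (rv v) (rt 0) (rt 0)] R' M' 1
      (\<lambda>R' M'. state (e(v := ev e M x)) R' \<and> M' = M)"
      using assms(1) unfolding e by (intro runs_straight) (auto simp: state_def)
  qed (use assms e in simp_all)
qed

definition fill :: "nat \<Rightarrow> nat \<Rightarrow> nat \<Rightarrow> expr \<Rightarrow> program" where
  "fill v b n x = [Const (rv v) 0, Op LESS (rt 0) (rv v) (rv n)] @
     [Loop (rt 0) (compile 0 x @ [Op ADD (rt 1) (rv b) (rv v), Store (rt 1) (rt 0), Const (rt 1) 1,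
       Op ADD (rv v) (rv v) (rt 1), Op LESS (rt 0) (rv v) (rv n)])]"

definition filled :: "(nat \<Rightarrow> nat) \<Rightarrow> nat \<Rightarrow> nat \<Rightarrow> (nat \<Rightarrow> nat) \<Rightarrow> nat \<Rightarrow> nat" where
  "filled M b n g j = (if b \<le> j \<and> j < b + n then g (j - b) else M j)"

lemma filled_0 [simp]: "filled M b 0 g = M"
  by (auto simp: filled_def)

lemma filled_Suc: "filled M b (Suc n) g = (filled M b n g)(b + n := g n)"
  by (auto simp: filled_def)

text \<open>The expression is evaluated in the memory with \<open>i\<close> cells already written,
  so a table may be defined by recursion on its own entries.\<close>

lemma runs_fill:
  assumes st: "state e R" and v: "v \<noteq> b" "v \<noteq> n"
    and x: "\<And>i. i < e n \<Longrightarrow> safe B S (e(v := i)) (filled M (e b) i g) x"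
      "\<And>i. i < e n \<Longrightarrow> ev (e(v := i)) (filled M (e b) i g) x = g i"
    and B: "2 \<le> B" "S + 1 < B" "B ^ deg x \<le> 2 ^ w" "e b + e n + 1 < 2 ^ w"
  shows "runs w (fill v b n x) R M (e n * (cost S x + 6) + 3)
    (\<lambda>R' M'. state (e(v := e n)) R' \<and> M' = filled M (e b) (e n) g)"
proof -
  define I where "I i R' M' \<longleftrightarrow> state (e(v := i)) R' \<and> M' = filled M (e b) i g \<and>
    R' (rt 0) = of_bool (i < e n)" for i R' M'
  have body: "runs w (compile 0 x @ [Op ADD (rt 1) (rv b) (rv v), Store (rt 1) (rt 0), Const (rt 1) 1,
       Op ADD (rv v) (rv v) (rt 1), Op LESS (rt 0) (rv v) (rv n)]) R1 M1 (cost S x + 5) (I (Suc i))"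
    if i: "i < e n" and I: "I i R1 M1" for i R1 M1
  proof -
    have e1: "(\<lambda>u. R1 (rv u)) = e(v := i)" and M1: "M1 = filled M (e b) i g"
      using I unfolding I_def state_def by auto
    have "runs w (compile 0 x) R1 M1 (cost S x) (\<lambda>R' M'. M' = M1 \<and>
        R' (rt 0) = ev (\<lambda>u. R1 (rv u)) M1 x \<and> (\<forall>r. (\<forall>i \<ge> 0. r \<noteq> rt i) \<longrightarrow> R' r = R1 r))"
      by (rule compile_runs) (use x(1)[OF i] B in \<open>simp_all only: e1 M1\<close>)
    then show ?thesis
    proof (rule runs_append[OF runs_mono[OF _ order_refl]])
      fix R2 M2
      assume 2: "M2 = M1 \<and> R2 (rt 0) = ev (\<lambda>u. R1 (rv u)) M1 x \<and> (\<forall>r. (\<forall>i \<ge> 0. r \<noteq> rt i) \<longrightarrow> R2 r = R1 r)"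
      have R2: "R2 (rv v) = i" "R2 (rv n) = e n" "R2 (rv b) = e b" "R2 (rt 0) = g i" "M2 = filled M (e b) i g"
        "\<And>u. u \<noteq> v \<Longrightarrow> R2 (rv u) = e u" "\<And>r. R2 (2 * r) = 0"
        using 2 I v x(2)[OF i] unfolding I_def state_def e1 M1 by auto
      moreover have "Suc i mod 2 ^ w = Suc i" "1 mod 2 ^ w = (1::nat)" "(e b + i) mod 2 ^ w = e b + i"
        using B(4) i by (simp_all, cases w, simp_all)
      ultimately show "runs w [Op ADD (rt 1) (rv b) (rv v), Store (rt 1) (rt 0), Const (rt 1) 1,
        Op ADD (rv v) (rv v) (rt 1), Op LESS (rt 0) (rv v) (rv n)] R2 M2 5 (I (Suc i))"
        using v by (intro runs_straight) (auto simp: I_def state_def filled_Suc)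
    qed simp
  qed
  have init: "runs w [Const (rv v) 0, Op LESS (rt 0) (rv v) (rv n)] R M 2 (I 0)"
    using st v by (intro runs_straight) (auto simp: I_def state_def)
  have loop: "runs w [Loop (rt 0) (compile 0 x @ [Op ADD (rt 1) (rv b) (rv v), Store (rt 1) (rt 0),
       Const (rt 1) 1, Op ADD (rv v) (rv v) (rt 1), Op LESS (rt 0) (rv v) (rv n)])] R1 M1
      (e n * (cost S x + 5 + 1) + 1) (I (e n))" if "I 0 R1 M1" for R1 M1
    using that by (intro runs_Loop body) (auto simp: I_def le_less)
  show ?thesis unfolding fill_def
    by (rule runs_append[OF runs_mono[OF init order_refl runs_mono[OF loop order_refl]]])
      (simp_all add: I_def)
qed

lemma cost_poly: "\<exists>C h. \<forall>S. cost S x \<le> C * (S + 1) ^ h"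
proof (induction x)
  case (ENum c)
  show ?case by (rule exI[of _ 1], rule exI[of _ 0]) simp
next
  case (EVar v)
  show ?case by (rule exI[of _ 1], rule exI[of _ 0]) simp
next
  case (EBin g a b)
  then obtain C h D k where *: "\<And>S. cost S a \<le> C * (S + 1) ^ h" "\<And>S. cost S b \<le> D * (S + 1) ^ k"
    by blast
  have "cost S (EBin g a b) \<le> (C + D + 1) * (S + 1) ^ (h + k)" for S
  proof -
    have "C * (S + 1) ^ h \<le> C * (S + 1) ^ (h + k)" "D * (S + 1) ^ k \<le> D * (S + 1) ^ (h + k)"
      "1 \<le> (S + 1) ^ (h + k)"
      by (intro mult_le_mono2 power_increasing; simp)+ simp
    then show ?thesis using *[of S] unfolding cost.simps distrib_right by linarith
  qed
  then show ?case by blast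
next
  case (EMem a)
  then obtain C h where *: "\<And>S. cost S a \<le> C * (S + 1) ^ h" by blast
  have "cost S (EMem a) \<le> (C + 1) * (S + 1) ^ h" for S
    using *[of S] one_le_power[of "S + 1" h] unfolding cost.simps distrib_right by linarith
  then show ?case by blast
next
  case (ESum v a b)
  then obtain C h D k where *: "\<And>S. cost S a \<le> C * (S + 1) ^ h" "\<And>S. cost S b \<le> D * (S + 1) ^ k"
    by blast
  have "cost S (ESum v a b) \<le> (C + D + 12) * (S + 1) ^ (h + k + 1)" for S
  proof -
    have le: "C * (S + 1) ^ h \<le> C * (S + 1) ^ (h + k + 1)" "D * (S + 1) ^ (k + 1) \<le> D * (S + 1) ^ (h + k + 1)"
      "(S + 1) ^ 1 \<le> (S + 1) ^ (h + k + 1)"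
      by (intro mult_le_mono2 power_increasing; simp)+
    have "S * (cost S b + 5) \<le> (S + 1) * (D * (S + 1) ^ k + 5)"
      using *(2)[of S] by (intro mult_le_mono) auto
    then have "cost S (ESum v a b) \<le> C * (S + 1) ^ h + (D * (S + 1) ^ (k + 1) + 12 * (S + 1) ^ 1)"
      using *(1)[of S] by (simp add: algebra_simps)
    also have "\<dots> \<le> (C + D + 12) * (S + 1) ^ (h + k + 1)"
      using le unfolding distrib_right by linarith
    finally show ?thesis .
  qed
  then show ?case by blast
qed

subsection \<open>Simulation with shorter words\<close>

lemma and_mask_nat: "x AND (2 ^ m - 1) = x mod (2 ^ m :: nat)"
  by (simp add: take_bit_eq_mod[symmetric] take_bit_eq_mask mask_eq_exp_minus_1)

text \<open>\<open>2 ^ m\<close> divides \<open>2 ^ w\<close>, so reduction commutes with addition,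
  subtraction, multiplication and left shift. The other operations have results that fit into
  \<open>m\<close> bits; for truth values this is \<open>1 \<le> m\<close>.\<close>

lemma eval_op_mod:
  assumes "x < 2 ^ m" "y < 2 ^ m" "m \<le> w" "1 \<le> m"
  shows "eval_op w g x y mod 2 ^ m = eval_op m g x y"
proof -
  have mod: "z mod 2 ^ w mod 2 ^ m = z mod 2 ^ m" for z :: nat
    using assms(3) by (simp add: mod_mod_cancel le_imp_power_dvd)
  have modi: "z mod 2 ^ w mod 2 ^ m = z mod 2 ^ m" for z :: int
    using assms(3) by (simp add: mod_mod_cancel le_imp_power_dvd)
  have tb: "take_bit m x = x" "take_bit m y = y"
    using assms by (simp_all add: take_bit_nat_eq_self)
  have le: "z mod 2 ^ m = z" if "z \<le> x" for z using that assms(1) by simp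
  have bool: "(of_bool c :: nat) mod 2 ^ m = of_bool c" for c using assms(4) by (cases m) auto
  show ?thesis
  proof (cases g)
    case SUB
    have "nat ((int x - int y) mod 2 ^ w) mod 2 ^ m = nat ((int x - int y) mod 2 ^ w mod 2 ^ m)"
      by (simp add: nat_mod_distrib nat_power_eq)
    then show ?thesis unfolding SUB eval_op.simps modi .
  next
    case BAND
    have "take_bit m (x AND y) = x AND y" by (simp add: tb)
    then show ?thesis using BAND by (simp add: take_bit_eq_mod)
  next
    case BOR
    have "take_bit m (x OR y) = x OR y" by (simp add: tb)
    then show ?thesis using BOR by (simp add: take_bit_eq_mod)
  next
    case BXOR
    have "take_bit m (x XOR y) = x XOR y" by (simp add: tb)
    then show ?thesis using BXOR by (simp add: take_bit_eq_mod)
  qed (simp_all add: mod bool le drop_bit_eq_div)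
qed

lemma card_mod_eq:
  assumes "0 < a" "y < a"
  shows "card {x. x < a * b \<and> x mod a = y} = (b :: nat)"
proof -
  have "{x. x < a * b \<and> x mod a = y} = (\<lambda>j. y + a * j) ` {..<b}"
  proof (intro equalityI subsetI)
    fix x assume "x \<in> {x. x < a * b \<and> x mod a = y}"
    then have x: "x < a * b" "x mod a = y" by auto
    then have "x = y + a * (x div a)" by (metis mod_mult_div_eq)
    moreover have "x div a < b" using x(1) by (simp add: less_mult_imp_div_less mult.commute)
    ultimately show "x \<in> (\<lambda>j. y + a * j) ` {..<b}" by blast
  next
    fix x assume "x \<in> (\<lambda>j. y + a * j) ` {..<b}"
    then obtain j where j: "j < b" "x = y + a * j" by auto
    have "a * (j + 1) \<le> a * b" using j by (intro mult_le_mono2) simp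
    then show "x \<in> {x. x < a * b \<and> x mod a = y}" using j assms by simp
  qed
  moreover have "inj_on (\<lambda>j. y + a * j) {..<b}" using assms by (auto simp: inj_on_def)
  ultimately show ?thesis by (simp add: card_image)
qed

text \<open>Every residue has the same number \<open>2 ^ (w - m)\<close> of preimages.\<close>

lemma map_pmf_mod_uniform:
  assumes "m \<le> w"
  shows "map_pmf (\<lambda>x. x mod 2 ^ m) (pmf_of_set {..<2 ^ w}) = pmf_of_set {..<2 ^ m :: nat}"
proof (rule pmf_eqI)
  fix y :: nat
  obtain d where w: "w = m + d" using assms by (metis le_Suc_ex)
  have ne: "{..<2 ^ n :: nat} \<noteq> {}" for n by (metis lessThan_iff empty_iff zero_less_power pos2)
  have "pmf (map_pmf (\<lambda>x. x mod 2 ^ m) (pmf_of_set {..<2 ^ w})) y =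
      card ({..<2 ^ w} \<inter> (\<lambda>x. x mod 2 ^ m) -` {y}) / 2 ^ w"
    using ne by (simp add: pmf_map measure_pmf_of_set)
  also have "{..<2 ^ w} \<inter> (\<lambda>x. x mod 2 ^ m) -` {y} = {x. x < 2 ^ m * 2 ^ d \<and> x mod 2 ^ m = y}"
    by (auto simp: w power_add)
  also have "card {x. x < 2 ^ m * 2 ^ d \<and> x mod 2 ^ m = y} / 2 ^ w = pmf (pmf_of_set {..<2 ^ m}) y"
  proof (cases "y < 2 ^ m")
    case True
    then show ?thesis using ne by (subst card_mod_eq) (simp_all add: w power_add)
  next
    case False
    then have "{x. x < 2 ^ m * 2 ^ d \<and> x mod 2 ^ m = y} = {}" by auto
    then show ?thesis using False ne by simp
  qed
  finally show "pmf (map_pmf (\<lambda>x. x mod 2 ^ m) (pmf_of_set {..<2 ^ w})) y = pmf (pmf_of_set {..<2 ^ m}) y" .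
qed

lemma run_halted: "run w t ([], R, M) = return_pmf ([], R, M)"
  by (induction t) (simp_all add: bind_return_pmf)

lemma rel_pmf_imp_measure_le:
  assumes "rel_pmf (\<lambda>x y. x \<in> A \<longrightarrow> y \<in> B) p q"
  shows "measure_pmf.prob p A \<le> measure_pmf.prob q B"
  using rel_pmf_measureD[OF assms, of A]
  by (rule order_trans) (auto intro!: measure_pmf.finite_measure_mono)

text \<open>Halted configurations are fixed points of \<open>step\<close>, so time bounds may be
  rounded up.\<close>

lemma prob_halted_mono:
  assumes "s \<le> t"
  shows "measure_pmf.prob (run w s c) (halted_with a) \<le> measure_pmf.prob (run w t c) (halted_with a)"
proof (rule rel_pmf_imp_measure_le)
  have "rel_pmf (\<lambda>x y. x \<in> halted_with a \<longrightarrow> y \<in> halted_with a)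
      (bind_pmf (run w s c) return_pmf) (bind_pmf (run w s c) (run w (t - s)))"
  proof (rule rel_pmf_bindI[of "(=)"])
    fix x y :: config assume "x = y"
    then show "rel_pmf (\<lambda>x y. x \<in> halted_with a \<longrightarrow> y \<in> halted_with a) (return_pmf x) (run w (t - s) y)"
      by (cases "x \<in> halted_with a")
        (auto simp: rel_pmf_return_pmf1 halted_with_def run_halted)
  qed (simp add: pmf.rel_refl)
  then show "rel_pmf (\<lambda>x y. x \<in> halted_with a \<longrightarrow> y \<in> halted_with a) (run w s c) (run w t c)"
    using assms by (simp add: bind_return_pmf' run_add[symmetric])
qed

definition nop :: instr where "nop = Const (rt 0) 0"

text \<open>
  Every instruction is simulated in exactly three steps, so that the two machines run in lockstep.
\<close>

fun sim_instr :: "nat \<Rightarrow> nat \<Rightarrow> instr \<Rightarrow> program" where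
  "sim_instr vb vm (Const r x) = [Const (2 * r) x, Op BAND (2 * r) (2 * r) (rv vm), nop]"
| "sim_instr vb vm (Op g r a b) = [Op g (2 * r) (2 * a) (2 * b), Op BAND (2 * r) (2 * r) (rv vm), nop]"
| "sim_instr vb vm (Load r a) = [Op ADD (rt 0) (2 * a) (rv vb), Load (2 * r) (rt 0), nop]"
| "sim_instr vb vm (Store a r) = [Op ADD (rt 0) (2 * a) (rv vb), Store (rt 0) (2 * r), nop]"
| "sim_instr vb vm (Rand r) = [Rand (2 * r), Op BAND (2 * r) (2 * r) (rv vm), nop]"
| "sim_instr vb vm (Cond r A B) =
     [nop, nop, Cond (2 * r) (concat (map (sim_instr vb vm) A)) (concat (map (sim_instr vb vm) B))]"
| "sim_instr vb vm (Loop r A) = [Loop (2 * r) (nop # nop # concat (map (sim_instr vb vm) A)), nop, nop]"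

definition sim_prog :: "nat \<Rightarrow> nat \<Rightarrow> program \<Rightarrow> program" where
  "sim_prog vb vm A = concat (map (sim_instr vb vm) A)"

text \<open>The first \<open>nop\<close> sets \<open>rt 0\<close> to 0, so the comparison flips
  register 0, which is register 0 of both machines. The last one pads the length to three.\<close>

definition negate_answer :: program where
  "negate_answer = [nop, Op EQ 0 0 (rt 0), nop]"

lemma sim_prog_simps [simp]:
  "sim_prog vb vm [] = []"
  "sim_prog vb vm (i # A) = sim_instr vb vm i @ sim_prog vb vm A"
  "sim_prog vb vm (A @ A') = sim_prog vb vm A @ sim_prog vb vm A'"
  by (simp_all add: sim_prog_def)

text \<open>The short memory is a window of the long one, starting at cell \<open>b\<close>;
  assumption \<open>b\<close> excludes wrap-around of addresses.\<close>

locale simulation =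
  fixes m w b vb vm :: nat
  assumes m: "1 \<le> m" "m \<le> w" and b: "b + 2 ^ m \<le> 2 ^ w" and vars: "vb \<noteq> vm"
begin

definition simulates :: "(nat \<Rightarrow> nat) \<Rightarrow> (nat \<Rightarrow> nat) \<Rightarrow> (nat \<Rightarrow> nat) \<Rightarrow> (nat \<Rightarrow> nat) \<Rightarrow> bool" where
  "simulates R M R' M' \<longleftrightarrow> (\<forall>r. R r < 2 ^ m \<and> R' (2 * r) = R r) \<and> R' (rv vb) = b \<and>
     R' (rv vm) = 2 ^ m - 1 \<and> (\<forall>i. M i < 2 ^ m \<and> M' (b + i) = M i)"

text \<open>When the short machine halts, \<open>running\<close> holds with \<open>Q = []\<close>.
  It idles while the long one executes \<open>negate_answer\<close>, and then \<open>halted\<close>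
  holds, with opposite answers.\<close>

inductive sim_rel :: "config \<Rightarrow> config \<Rightarrow> bool" where
  running: "simulates R M R' M' \<Longrightarrow> sim_rel (Q, R, M) (sim_prog vb vm Q @ negate_answer, R', M')"
| halted: "(R' 0 \<noteq> 0 \<longleftrightarrow> R 0 = 0) \<Longrightarrow> sim_rel ([], R, M) ([], R', M')"

lemma simulates_update:
  assumes "simulates R M R' M'" "R1 = R'(2 * r := x mod 2 ^ m, rt 0 := z)"
  shows "simulates (R(r := x mod 2 ^ m)) M R1 M'"
  using assms unfolding simulates_def by auto

lemma simulates_temp:
  "simulates R M R' M' \<Longrightarrow> simulates R M (R'(rt 0 := z)) M'"
  unfolding simulates_def by auto

lemma sim_rel_step:
  assumes "sim_rel c c'"
  shows "rel_pmf sim_rel (step m c) (run w 3 c')"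
  using assms
proof cases
  case (halted R' R M M')
  then show ?thesis using assms by (simp add: run_halted)
next
  case (running R M R' M' Q)
  note c = running(1,2) and sim = running(3)
  have R: "R r < 2 ^ m" "R' (2 * r) = R r" and M: "M i < 2 ^ m" "M' (b + i) = M i"
    and v: "R' (rv vb) = b" "R' (rv vm) = 2 ^ m - 1" for r i
    using sim unfolding simulates_def by blast+
  have mod: "z mod 2 ^ w mod 2 ^ m = z mod 2 ^ m" for z :: nat
    using m by (simp add: mod_mod_cancel le_imp_power_dvd)
  have addr: "(R a + b) mod 2 ^ w = b + R a" for a
    using R(1)[of a] b by simp
  have sim_mod: "simulates (R(r := x mod 2 ^ m)) M (R'(2 * r := x mod 2 ^ m, rt 0 := z)) M'" for r x z
    using simulates_update[OF sim refl] .
  note [simp] = numeral_3_eq_3 bind_return_pmf nop_def R(2) v and_mask_nat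
    and_mask_nat[unfolded One_nat_def]
  show ?thesis
  proof (cases Q)
    case Nil
    have "rt 0 \<noteq> 0" "0 \<noteq> rt 0" by (simp_all add: rt_def)
    moreover have "R' 0 = R 0" using R(2)[of 0] by simp
    ultimately show ?thesis unfolding c Nil by (auto simp: negate_answer_def intro!: sim_rel.halted)
  next
    case (Cons i P)
    show ?thesis
    proof (cases i)
      case (Const r x)
      then show ?thesis using sim_mod[of r x] mod unfolding c Cons
        by (auto simp: fun_upd_twist[of "rt 0"] intro!: sim_rel.running)
    next
      case (Op g r x y)
      have "eval_op w g (R x) (R y) mod 2 ^ m = eval_op m g (R x) (R y)"
        using R m by (intro eval_op_mod) auto
      then show ?thesis using sim_mod[of r "eval_op w g (R x) (R y)"] unfolding c Cons Op
        by (auto simp: intro!: sim_rel.running)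
    next
      case (Load r a)
      have "M (R a) mod 2 ^ m = M (R a)" using M by simp
      then show ?thesis using sim_mod[of r "M (R a)"] unfolding c Cons Load
        by (auto simp: addr M fun_upd_twist[of "rt 0"] intro!: sim_rel.running)
    next
      case (Store a r)
      have "simulates R (M(R a := R r)) (R'(rt 0 := z)) (M'(b + R a := R r))" for z
        using sim unfolding simulates_def by auto
      then show ?thesis unfolding c Cons Store
        by (auto simp: addr intro!: sim_rel.running)
    next
      case (Rand r)
      \<comment> \<open>The random words are coupled: the short one is the masked long one.\<close>
      show ?thesis unfolding c Cons Rand
        using sim_mod
        by (auto simp: map_pmf_mod_uniform[OF m(2), symmetric] pmf.map_comp comp_def bind_map_pmf
            map_pmf_def[symmetric] pmf.rel_map intro!: sim_rel.running rel_pmf_reflI)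
    next
      case (Cond r A B)
      show ?thesis unfolding c Cons Cond
        using simulates_temp[OF sim, of 0] sim_rel.running[of R M "R'(rt 0 := 0)" M' "A @ P"]
          sim_rel.running[of R M "R'(rt 0 := 0)" M' "B @ P"]
        by (auto simp: sim_prog_def)
    next
      case (Loop r A)
      show ?thesis unfolding c Cons Loop
        using simulates_temp[OF sim, of 0] sim_rel.running[of R M "R'(rt 0 := 0)" M' "A @ Loop r A # P"]
          sim_rel.running[of R M "R'(rt 0 := 0)" M' "P"]
        by (auto simp: sim_prog_def)
    qed
  qed
qed

lemma sim_rel_run:
  "sim_rel c c' \<Longrightarrow> rel_pmf sim_rel (run m t c) (run w (3 * t) c')"
proof (induction t arbitrary: c c')
  case (Suc t)
  have "run w (3 * Suc t) c' = bind_pmf (run w 3 c') (run w (3 * t))"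
    by (simp only: mult_Suc_right run_add)
  then show ?case
    using Suc by (auto intro!: rel_pmf_bindI[OF sim_rel_step])
qed simp

text \<open>The three additional steps are for a short run that halts only at time \<open>t\<close>,
  when the negation is still to come.\<close>

lemma simulation_prob:
  assumes "simulates R M R' M'"
  shows "measure_pmf.prob (run m t (P, R, M)) (halted_with a)
    \<le> measure_pmf.prob (run w (3 * t + 3) (sim_prog vb vm P @ negate_answer, R', M')) (halted_with (\<not> a))"
proof (rule rel_pmf_imp_measure_le)
  let ?c = "(P, R, M)" and ?c' = "(sim_prog vb vm P @ negate_answer, R', M')"
  have "rel_pmf (\<lambda>x y. x \<in> halted_with a \<longrightarrow> y \<in> halted_with (\<not> a))
      (bind_pmf (run m t ?c) return_pmf) (bind_pmf (run w (3 * t) ?c') (run w 3))"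
  proof (rule rel_pmf_bindI[OF sim_rel_run[OF sim_rel.running[OF assms]]])
    fix c c' assume "sim_rel c c'"
    then show "rel_pmf (\<lambda>x y. x \<in> halted_with a \<longrightarrow> y \<in> halted_with (\<not> a)) (return_pmf c) (run w 3 c')"
    proof cases
      case (running R M R' M' Q)
      have rt: "rt 0 \<noteq> 0" "0 \<noteq> rt 0" by (simp_all add: rt_def)
      have R': "R' 0 = R 0" using running(3) unfolding simulates_def by (metis mult_0_right)
      show ?thesis
      proof (cases "Q = []")
        case True
        then show ?thesis unfolding running(1,2) negate_answer_def using rt R'
          by (cases a) (simp_all add: numeral_3_eq_3 bind_return_pmf nop_def halted_with_def)
      qed (use running in \<open>simp add: rel_pmf_return_pmf1 halted_with_def\<close>)
    next
      case (halted R' R M M')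
      then show ?thesis by (cases a) (auto simp: run_halted halted_with_def)
    qed
  qed
  then show "rel_pmf (\<lambda>x y. x \<in> halted_with a \<longrightarrow> y \<in> halted_with (\<not> a)) (run m t ?c) (run w (3 * t + 3) ?c')"
    by (simp add: bind_return_pmf' run_add[symmetric])
qed

end

subsection \<open>From formulas to vectors\<close>

definition lit_holds :: "nat \<Rightarrow> nat \<Rightarrow> nat \<Rightarrow> nat \<times> bool \<Rightarrow> bool" where
  "lit_holds q l w = (\<lambda>(v, b). v div q = l \<and> bit w (1 + v mod q) = b)"

text \<open>
  Vectors of family \<open>l\<close> are indexed by assignments to the \<open>l\<close>-th block of \<open>q\<close> variables, shifted by
  one bit: bit 0 tells apart the vectors of assignments (odd index) from all-ones vectors (even
  index). The coordinate \<open>length \<phi> + l\<close> forces the vector of family \<open>l\<close> in a solution to be odd.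
\<close>

definition cnf_vec :: "cnf \<Rightarrow> nat \<Rightarrow> nat \<Rightarrow> nat \<Rightarrow> nat \<Rightarrow> bool" where
  "cnf_vec \<phi> q l w c \<longleftrightarrow> \<not> (odd w \<and>
     (c < length \<phi> \<and> (\<exists>x \<in> set (\<phi> ! c). lit_holds q l w x) \<or> c = length \<phi> + l))"

lemma ex_nat_bits: "\<exists>w < 2 ^ q. \<forall>t < q. bit (w :: nat) t = P t"
proof (induction q)
  case (Suc q)
  then obtain w :: nat where w: "w < 2 ^ q" "\<forall>t < q. bit w t = P t" by blast
  show ?case
  proof (cases "P q")
    case True
    have nb: "\<not> bit w t" if "q \<le> t" for t
      using w(1) that by (metis bit_take_bit_iff not_le take_bit_nat_eq_self)
    have "set_bit q w = w + 2 ^ q"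
      by (subst set_bit_eq) (simp add: nb)
    then have "set_bit q w < 2 ^ Suc q" using w(1) by simp
    moreover have "bit (set_bit q w) t = P t" if "t < Suc q" for t
      using that w(2) True by (auto simp: bit_set_bit_iff less_Suc_eq)
    ultimately show ?thesis by blast
  next
    case False
    have "\<not> bit w q" using w(1) by (metis bit_take_bit_iff less_irrefl take_bit_nat_eq_self)
    then show ?thesis using w False by (intro exI[of _ w]) (auto simp: less_Suc_eq)
  qed
qed simp

text \<open>An odd vector is 0 at the coordinate of a clause exactly if its partial assignment makes
  a literal of the clause true, and the blocks cover all variables.\<close>

lemma satisfiable_iff_vectors:
  assumes cnf: "cnf_over n \<phi>" and n: "n < q * (K + 1)"
  shows "satisfiable \<phi> \<longleftrightarrow> (\<exists>w. (\<forall>l \<le> K. w l < 2 ^ (q + 1)) \<and>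
    (\<forall>c < length \<phi> + (K + 1). \<exists>l \<le> K. \<not> cnf_vec \<phi> q l (w l) c))"
proof
  have q: "q > 0" using n by (cases q) auto
  assume "satisfiable \<phi>"
  then obtain \<alpha> where \<alpha>: "\<And>C. C \<in> set \<phi> \<Longrightarrow> \<exists>(v, b) \<in> set C. \<alpha> v = b" unfolding satisfiable_def by blast
  have "\<forall>l. \<exists>w < 2 ^ q. \<forall>t < q. bit (w :: nat) t = \<alpha> (l * q + t)"
    by (intro allI ex_nat_bits)
  from choice[OF this] obtain u where u: "\<And>l. u l < (2::nat) ^ q"
    "\<And>l t. t < q \<Longrightarrow> bit (u l) t = \<alpha> (l * q + t)" by blast
  define w where "w l = 2 * u l + 1" for l
  have "w l < 2 ^ (q + 1)" for l using u(1)[of l] unfolding w_def by simp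
  moreover have "\<exists>l \<le> K. \<not> cnf_vec \<phi> q l (w l) c" if c: "c < length \<phi> + (K + 1)" for c
  proof (cases "c < length \<phi>")
    case True
    obtain v b where vb: "(v, b) \<in> set (\<phi> ! c)" "\<alpha> v = b"
      using \<alpha>[OF nth_mem[OF True]] by blast
    have "v < n" using cnf True vb(1) unfolding cnf_over_def by (metis case_prodD nth_mem)
    then have "v div q < K + 1" using n by (simp add: less_mult_imp_div_less mult.commute)
    moreover have "bit (w (v div q)) (1 + v mod q) = b"
      using u(2)[of "v mod q" "v div q"] vb(2) q by (simp add: w_def bit_Suc)
    ultimately have "\<not> cnf_vec \<phi> q (v div q) (w (v div q)) c"
      using True vb(1) unfolding cnf_vec_def lit_holds_def by (auto simp: w_def)
    then show ?thesis using \<open>v div q < K + 1\<close> by (intro exI[of _ "v div q"]) simp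
  next
    case False
    then show ?thesis using c
      by (intro exI[of _ "c - length \<phi>"]) (auto simp: cnf_vec_def w_def)
  qed
  ultimately show "\<exists>w. (\<forall>l \<le> K. w l < 2 ^ (q + 1)) \<and>
    (\<forall>c < length \<phi> + (K + 1). \<exists>l \<le> K. \<not> cnf_vec \<phi> q l (w l) c)" by blast
next
  assume "\<exists>w. (\<forall>l \<le> K. w l < 2 ^ (q + 1)) \<and>
    (\<forall>c < length \<phi> + (K + 1). \<exists>l \<le> K. \<not> cnf_vec \<phi> q l (w l) c)"
  then obtain w where w: "\<And>c. c < length \<phi> + (K + 1) \<Longrightarrow> \<exists>l \<le> K. \<not> cnf_vec \<phi> q l (w l) c" by blast
  define \<alpha> where "\<alpha> v = bit (w (v div q)) (1 + v mod q)" for v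
  have "\<exists>(v, b) \<in> set C. \<alpha> v = b" if "C \<in> set \<phi>" for C
  proof -
    from that obtain c where c: "c < length \<phi>" "\<phi> ! c = C" unfolding in_set_conv_nth by (elim exE conjE)
    have "c < length \<phi> + (K + 1)" using c(1) by simp
    from w[OF this] obtain l where "\<not> cnf_vec \<phi> q l (w l) c" by blast
    then have "\<exists>x \<in> set C. lit_holds q l (w l) x" using c unfolding cnf_vec_def by auto
    then obtain v b where "(v, b) \<in> set C" "lit_holds q l (w l) (v, b)" by auto
    then show ?thesis unfolding lit_holds_def \<alpha>_def by (intro bexI[of _ "(v, b)"]) auto
  qed
  then show "satisfiable \<phi>" unfolding satisfiable_def by blast
qed

section \<open>Arithmetic expressions for the words of the encoded graph\<close>

definition eNot :: "expr \<Rightarrow> expr" where "eNot a = EBin EQ a (ENum 0)"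
definition eOr :: "expr \<Rightarrow> expr \<Rightarrow> expr" where "eOr a b = EBin LESS (ENum 0) (EBin ADD a b)"
text \<open>Both branches are evaluated, so both have to be safe, even where the condition discards
  one.\<close>

definition eIf :: "expr \<Rightarrow> expr \<Rightarrow> expr \<Rightarrow> expr" where
  "eIf c a b = EBin ADD (EBin MUL c a) (EBin MUL (eNot c) b)"
definition eAll :: "expr list \<Rightarrow> expr" where "eAll xs = foldr (EBin MUL) xs (ENum 1)"
definition eSum :: "expr list \<Rightarrow> expr" where "eSum xs = foldr (EBin ADD) xs (ENum 0)"

primrec ePow :: "expr \<Rightarrow> nat \<Rightarrow> expr" where
  "ePow a 0 = ENum 1"
| "ePow a (Suc p) = EBin MUL a (ePow a p)"

definition eDig :: "expr \<Rightarrow> nat \<Rightarrow> expr \<Rightarrow> expr" where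
  "eDig b p y = EBin MOD (EBin DIV y (ePow b p)) b"
definition eZero :: "expr \<Rightarrow> nat \<Rightarrow> expr \<Rightarrow> expr" where
  "eZero b p y = EBin ADD (EBin MUL (EBin DIV y (ePow b (Suc p))) (ePow b (Suc p))) (EBin MOD y (ePow b p))"

fun evars :: "expr \<Rightarrow> nat set" where
  "evars (ENum c) = {}"
| "evars (EVar v) = {v}"
| "evars (EBin g a b) = evars a \<union> evars b"
| "evars (EMem a) = evars a"
| "evars (ESum v a b) = {v} \<union> evars a \<union> evars b"

lemma ev_fresh: "u \<notin> evars x \<Longrightarrow> ev (e(u := i)) M x = ev e M x"
  by (induction x arbitrary: e) (simp_all add: fun_upd_twist[of u])

lemma safe_fresh: "u \<notin> evars x \<Longrightarrow> i < B \<Longrightarrow> safe B S (e(u := i)) M x = safe B S e M x"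
  by (induction x arbitrary: e) (simp_all add: ev_fresh fun_upd_twist[of u])

lemma ev_eNot [simp]: "ev e M (eNot a) = of_bool (ev e M a = 0)"
  by (simp add: eNot_def)
lemma ev_eOr [simp]: "ev e M (eOr a b) = of_bool (ev e M a \<noteq> 0 \<or> ev e M b \<noteq> 0)"
  by (simp add: eOr_def)
lemma ev_eIf: "ev e M c = of_bool P \<Longrightarrow> ev e M (eIf c a b) = (if P then ev e M a else ev e M b)"
  by (simp add: eIf_def)
lemma ev_eAll: "(\<And>z. z \<in> set zs \<Longrightarrow> ev e M (g z) = of_bool (P z)) \<Longrightarrow>
    ev e M (eAll (map g zs)) = of_bool (\<forall>z \<in> set zs. P z)"
  by (induction zs) (auto simp: eAll_def)
lemma ev_eSum [simp]: "ev e M (eSum xs) = (\<Sum>x\<leftarrow>xs. ev e M x)"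
  by (induction xs) (auto simp: eSum_def)
lemma ev_ePow [simp]: "ev e M (ePow a p) = ev e M a ^ p"
  by (induction p) auto
lemma ev_eDig [simp]: "ev e M (eDig b p y) = dig (ev e M b) p (ev e M y)"
  by (simp add: eDig_def dig_def)
lemma ev_eZero [simp]: "ev e M (eZero b p y) = zero_dig (ev e M b) p (ev e M y)"
  by (simp add: eZero_def zero_dig_def)

lemma safe_eNot [simp]: "safe B S e M (eNot a) = safe B S e M a"
  by (simp add: eNot_def)
lemma safe_eOr [simp]: "safe B S e M (eOr a b) = (safe B S e M a \<and> safe B S e M b)"
  by (simp add: eOr_def)
lemma safe_eIf [simp]: "safe B S e M (eIf c a b) = (safe B S e M c \<and> safe B S e M a \<and> safe B S e M b)"
  by (auto simp: eIf_def)
lemma safe_eAll [simp]: "safe B S e M (eAll xs) = (\<forall>x \<in> set xs. safe B S e M x)"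
  by (induction xs) (auto simp: eAll_def)
lemma safe_eSum [simp]: "safe B S e M (eSum xs) = (\<forall>x \<in> set xs. safe B S e M x)"
  by (induction xs) (auto simp: eSum_def)
lemma safe_ePow: "safe B S e M a \<Longrightarrow> safe B S e M (ePow a p)"
  by (induction p) auto
lemma safe_eDig: "safe B S e M b \<Longrightarrow> safe B S e M y \<Longrightarrow> safe B S e M (eDig b p y)"
  by (simp add: eDig_def safe_ePow)
lemma safe_eZero: "safe B S e M b \<Longrightarrow> safe B S e M y \<Longrightarrow> safe B S e M (eZero b p y)"
  by (simp add: eZero_def safe_ePow)

lemma evars_ePow: "evars (ePow a p) \<subseteq> evars a"
  by (induction p) auto
lemma evars_eDig: "evars (eDig b p y) \<subseteq> evars b \<union> evars y"
  using evars_ePow by (auto simp: eDig_def)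

text \<open>Variables 0 to 7 hold dimensions, \<open>xH\<close> the address of the table of clause
  positions and \<open>xG\<close> that of the graph; \<open>xi\<close> is the index of the cell
  being filled and \<open>xt\<close> the index bound by sums.\<close>

abbreviation (input) "xn \<equiv> EVar 0"
abbreviation (input) "xL \<equiv> EVar 1"
abbreviation (input) "xq \<equiv> EVar 2"
abbreviation (input) "xN \<equiv> EVar 3"
abbreviation (input) "xD \<equiv> EVar 4"
abbreviation (input) "xNy \<equiv> EVar 5"
abbreviation (input) "xDx \<equiv> EVar 6"
abbreviation (input) "xV \<equiv> EVar 7"
abbreviation (input) "xH \<equiv> EVar 8"
abbreviation (input) "xG \<equiv> EVar 9"
abbreviation (input) "xi \<equiv> EVar 10"
abbreviation (input) "xt \<equiv> EVar 11"

text \<open>The sum counts the literals of clause \<open>c\<close> that hold in \<open>w\<close>.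
  The factor \<open>EBin LESS c xL\<close> empties it at coordinates beyond the clauses, for which
  the table has no entry.\<close>

definition eVec :: "nat \<Rightarrow> expr \<Rightarrow> expr \<Rightarrow> expr" where
  "eVec l w c = (let start = EMem (EBin ADD xH c); lit = EMem (EBin ADD (EBin ADD start (ENum 1)) xt) in
     eNot (EBin MUL (EBin MOD w (ENum 2)) (eOr
       (ESum 11 (EBin MUL (EBin LESS c xL) (EMem start))
         (EBin MUL (EBin EQ (EBin DIV (EBin DIV lit (ENum 2)) xq) (ENum l))
           (EBin EQ (EBin MOD (EBin SHR w (EBin ADD (ENum 1) (EBin MOD (EBin DIV lit (ENum 2)) xq))) (ENum 2))
             (EBin MOD lit (ENum 2)))))
       (EBin EQ c (EBin ADD xL (ENum l))))))"

definition eValid :: "nat \<Rightarrow> expr \<Rightarrow> expr \<Rightarrow> expr \<Rightarrow> expr" where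
  "eValid K i y x = eAll (map (\<lambda>(p, j). eIf (EBin LESS (EBin ADD (ENum p) i) (ENum K))
     (if p + j < K then eVec p (eDig xN p y) (eDig xD j x) else ENum 1)
     (if K \<le> p + j + 1 then eVec (p + 1) (eDig xN p y) (eDig xD j x) else ENum 1))
     (List.product [0..<K] [0..<K]))"

definition eVid :: "expr \<Rightarrow> expr \<Rightarrow> expr \<Rightarrow> expr" where
  "eVid i y x = EBin ADD (EBin MUL (EBin ADD (EBin MUL i xNy) y) xDx) x"

definition eMid :: "nat \<Rightarrow> expr \<Rightarrow> expr" where
  "eMid K i = EBin MUL (EBin LESS (ENum 0) i) (EBin LESS i (ENum (K + 1)))"

text \<open>\<open>eZero\<close> needs a constant position, but \<open>K - i\<close> varies at run
  time; the sum over \<open>j\<close> selects it.\<close>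

definition eVx :: "nat \<Rightarrow> expr \<Rightarrow> expr \<Rightarrow> expr \<Rightarrow> expr" where
  "eVx K i y x = eIf (eMid K i)
     (eVid i (eSum (map (\<lambda>j. EBin MUL (EBin EQ i (ENum j)) (eZero xN (K - j) y)) [1..<K + 1])) x)
     (eVid i y (ENum 0))"

definition eCore :: "nat \<Rightarrow> expr \<Rightarrow> expr \<Rightarrow> expr \<Rightarrow> expr" where
  "eCore K i y x = EBin MUL (EBin LESS i (ENum (2 * K + 1)))
     (eIf (EBin LESS i (ENum (K + 1))) (eValid K i y x) (EBin EQ x (ENum 0)))"

definition eLay :: "expr \<Rightarrow> expr" where "eLay a = EBin DIV (EBin DIV a xDx) xNy"
definition eYc :: "expr \<Rightarrow> expr" where "eYc a = EBin MOD (EBin DIV a xDx) xNy"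
definition eXc :: "expr \<Rightarrow> expr" where "eXc a = EBin MOD a xDx"

definition eGood :: "nat \<Rightarrow> expr \<Rightarrow> expr" where
  "eGood K a = EBin MUL (EBin EQ (eVx K (eLay a) (eYc a) (eXc a)) a)
     (eOr (eNot (eMid K (eLay a))) (eValid K (eLay a) (eYc a) (eXc a)))"

definition eHub :: "nat \<Rightarrow> expr" where "eHub K = eVid (ENum (K + 1)) (ENum 0) (ENum 0)"

definition eLeaf :: "expr \<Rightarrow> expr" where "eLeaf a = EBin ADD xV (EBin MUL (ENum 3) a)"

definition eFst :: "nat \<Rightarrow> expr \<Rightarrow> expr \<Rightarrow> expr" where
  "eFst K a s = eIf (EBin LESS s (ENum 3)) (EBin ADD (eLeaf a) s)
     (eIf (EBin EQ s (ENum 3))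
       (eIf (eCore K (eLay a) (eYc a) (eXc a)) (eVx K (eLay a) (eYc a) (eXc a)) (eLeaf a))
       (eIf (eGood K a) (eLeaf a) a))"

definition eSnd :: "nat \<Rightarrow> expr \<Rightarrow> expr \<Rightarrow> expr" where
  "eSnd K a s = eIf (EBin LESS s (ENum 3)) (eHub K)
     (eIf (EBin EQ s (ENum 3))
       (eIf (eCore K (eLay a) (eYc a) (eXc a)) (eVx K (EBin ADD (eLay a) (ENum 1)) (eYc a) (eXc a))
         (EBin ADD (eLeaf a) (ENum 1)))
       (eIf (eGood K a) (EBin ADD (eLeaf a) (ENum 2)) (eHub K)))"

definition eCell :: "nat \<Rightarrow> expr" where
  "eCell K = (let j = EBin DIV xi (ENum 2); a = EBin DIV j (ENum 5); s = EBin MOD j (ENum 5) in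
     eIf (EBin EQ (EBin MOD xi (ENum 2)) (ENum 0)) (eFst K a s) (eSnd K a s))"

locale cnf_reduction =
  fixes K n :: nat and \<phi> :: cnf
  assumes K: "1 \<le> K" and cnf: "cnf_over n \<phi>"
begin

text \<open>The \<open>+ 1\<close> makes \<open>q * (K + 1)\<close> exceed \<open>n\<close> and
  keeps \<open>q\<close> positive even for \<open>n = 0\<close>.\<close>

definition "q = n div (K + 1) + 1"
definition "Nv = (2::nat) ^ (q + 1)"
definition "Dc = length \<phi> + (K + 1)"

sublocale kov_graph K Nv Dc "cnf_vec \<phi> q"
proof
  \<comment> \<open>Coordinate \<open>length \<phi> + l\<close> is 0 only in vectors of family
    \<open>l\<close>; here \<open>l = 0\<close>, next \<open>l = K\<close>.\<close>
  show "\<exists>c<Dc. \<forall>l w. l \<noteq> 0 \<longrightarrow> cnf_vec \<phi> q l w c"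
    by (rule exI[of _ "length \<phi>"]) (simp add: Dc_def cnf_vec_def)
  show "\<exists>c<Dc. \<forall>l w. l \<noteq> K \<longrightarrow> cnf_vec \<phi> q l w c"
    by (rule exI[of _ "length \<phi> + K"]) (simp add: Dc_def cnf_vec_def)
qed (use K in \<open>simp_all add: cnf_vec_def Nv_def\<close>)

lemma n_less: "n < q * (K + 1)"
  unfolding q_def using dividend_less_div_times[of "K + 1" n] by (simp add: algebra_simps)

lemma diameter_iff: "bichromatic_diameter (4 * V) Eg Sg \<le> 2 * K + 1 \<longleftrightarrow> \<not> satisfiable \<phi>"
  and diameter_gap: "bichromatic_diameter (4 * V) Eg Sg \<le> 2 * K + 1 \<or>
    4 * K + 1 \<le> bichromatic_diameter (4 * V) Eg Sg"
proof -
  have sat: "4 * K + 1 \<le> bichromatic_diameter (4 * V) Eg Sg" if s: "satisfiable \<phi>"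
  proof -
    obtain w where "\<forall>l \<le> K. w l < Nv" "\<forall>c < Dc. \<exists>l \<le> K. \<not> cnf_vec \<phi> q l (w l) c"
      using s unfolding satisfiable_iff_vectors[OF cnf n_less] Nv_def Dc_def by blast
    then show ?thesis by (intro diameter_ge[of w]) auto
  qed
  have unsat: "bichromatic_diameter (4 * V) Eg Sg \<le> 2 * K + 1" if "\<not> satisfiable \<phi>"
    using that unfolding satisfiable_iff_vectors[OF cnf n_less] Nv_def[symmetric] Dc_def[symmetric]
    by (intro diameter_le) blast
  show "bichromatic_diameter (4 * V) Eg Sg \<le> 2 * K + 1 \<longleftrightarrow> \<not> satisfiable \<phi>"
    using sat unsat K by fastforce
  show "bichromatic_diameter (4 * V) Eg Sg \<le> 2 * K + 1 \<or>
    4 * K + 1 \<le> bichromatic_diameter (4 * V) Eg Sg" using sat unsat by blast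
qed

definition start :: "nat \<Rightarrow> nat" where
  "start c = 2 + (\<Sum>i < c. length (\<phi> ! i) + 1)"

text \<open>Only the input and the clause table are fixed, so this covers every stage of writing the
  graph behind them.\<close>

definition loaded :: "nat \<Rightarrow> nat \<Rightarrow> (nat \<Rightarrow> nat) \<Rightarrow> (nat \<Rightarrow> nat) \<Rightarrow> bool" where
  "loaded B S e M \<longleftrightarrow> (\<forall>v. e v < B) \<and> (\<forall>i. M i < B) \<and> e 1 = length \<phi> \<and> e 2 = q \<and> e 3 = Nv \<and> e 4 = Dc \<and>
     e 5 = Ny \<and> e 6 = Dx \<and> e 7 = V \<and>
     (\<forall>c < length \<phi>. M (e 8 + c) = start c \<and> M (start c) = length (\<phi> ! c) \<and> length (\<phi> ! c) \<le> S \<and>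
       (\<forall>t < length (\<phi> ! c). M (start c + 1 + t) = (\<lambda>(v, b). 2 * v + of_bool b) (\<phi> ! c ! t))) \<and> S < B"

lemma safe_eVec:
  assumes "loaded B S e M" "safe B S e M w" "safe B S e M c" "11 \<notin> evars w" "11 \<notin> evars c"
  shows "safe B S e M (eVec l w c)"
proof -
  have b: "e v < B" "M i < B" for v i using assms(1) by (auto simp: loaded_def)
  define s where "s = ev e M c"
  have cnt: "of_bool (s < length \<phi>) * M (M (e 8 + s)) \<le> S"
    using assms(1) unfolding loaded_def by auto
  have "safe B S (e(11 := i)) M w" "safe B S (e(11 := i)) M c" "ev (e(11 := i)) M w = ev e M w"
    "ev (e(11 := i)) M c = ev e M c" if "i < B" for i
    using assms(2-5) that by (simp_all add: safe_fresh ev_fresh)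
  moreover have "e 1 = length \<phi>" "S < B" using assms(1) by (simp_all add: loaded_def)
  moreover have "length \<phi> < B" using b(1)[of 1] calculation by simp
  ultimately show ?thesis using cnt assms(2,3) b unfolding eVec_def Let_def s_def
    by (auto intro: le_less_trans)
qed

lemma ev_eVec:
  assumes "loaded B S e M" "11 \<notin> evars w" "11 \<notin> evars c"
  shows "ev e M (eVec l w c) = of_bool (cnf_vec \<phi> q l (ev e M w) (ev e M c))"
proof -
  define s where "s = ev e M c"
  define x where "x = ev e M w"
  have L: "e 1 = length \<phi>" "e 2 = q" using assms(1) by (simp_all add: loaded_def)
  have *: "ev (e(11 := i)) M w = x" "ev (e(11 := i)) M c = s" for i
    using assms(2,3) by (simp_all add: ev_fresh s_def x_def)
  have bit: "drop_bit m x mod 2 = of_bool (bit x m)" for m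
    by (simp add: bit_iff_odd_drop_bit mod_2_eq_odd)
  define T where "T = (\<Sum>i < of_bool (s < length \<phi>) * M (M (e 8 + s)).
     of_bool (M (Suc (M (e 8 + s) + i)) div 2 div q = l) *
     (of_bool (drop_bit (Suc (M (Suc (M (e 8 + s) + i)) div 2 mod q)) x mod 2 = M (Suc (M (e 8 + s) + i)) mod 2) :: nat))"
  have "T \<noteq> 0 \<longleftrightarrow> s < length \<phi> \<and> (\<exists>y \<in> set (\<phi> ! s). lit_holds q l x y)"
  proof (cases "s < length \<phi>")
    case True
    then have M: "M (e 8 + s) = start s" "M (start s) = length (\<phi> ! s)"
      "\<And>t. t < length (\<phi> ! s) \<Longrightarrow> M (start s + 1 + t) = (\<lambda>(v, b). 2 * v + of_bool b) (\<phi> ! s ! t)"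
      using assms(1) unfolding loaded_def by auto
    have "of_bool (M (Suc (start s + t)) div 2 div q = l) *
        (of_bool (drop_bit (Suc (M (Suc (start s + t)) div 2 mod q)) x mod 2 = M (Suc (start s + t)) mod 2) :: nat)
        = of_bool (lit_holds q l x (\<phi> ! s ! t))" if "t < length (\<phi> ! s)" for t
      using M(3)[OF that] unfolding bit by (cases "\<phi> ! s ! t") (auto simp: lit_holds_def)
    then have "T = (\<Sum>t < length (\<phi> ! s). of_bool (lit_holds q l x (\<phi> ! s ! t)))"
      unfolding T_def using True M(1,2) by (auto intro!: sum.cong)
    also have "\<dots> \<noteq> 0 \<longleftrightarrow> (\<exists>t < length (\<phi> ! s). lit_holds q l x (\<phi> ! s ! t))"
      by (subst sum_eq_0_iff) auto
    finally show ?thesis using True by (metis in_set_conv_nth)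
  qed (simp add: T_def)
  moreover have "ev e M (eVec l w c) = of_bool (\<not> (odd x \<and> (T \<noteq> 0 \<or> s = length \<phi> + l)))"
    unfolding eVec_def Let_def using L *
    by (auto simp: T_def s_def[symmetric] x_def[symmetric] mod_2_eq_odd)
  ultimately show ?thesis unfolding cnf_vec_def s_def x_def by simp
qed

end

subsection \<open>The program of the reduction\<close>

lemma nth_concat_offset:
  "c < length xss \<Longrightarrow> t < length (xss ! c) \<Longrightarrow>
    concat xss ! ((\<Sum>i < c. length (xss ! i)) + t) = xss ! c ! t \<and>
    (\<Sum>i < c. length (xss ! i)) + t < length (concat xss)"
proof (induction xss arbitrary: c)
  case (Cons xs xss)
  show ?case
  proof (cases c)
    case 0
    then show ?thesis using Cons.prems by (simp add: nth_append)
  next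
    case (Suc c')
    then show ?thesis using Cons.IH[of c'] Cons.prems
      by (simp del: sum.lessThan_Suc add: sum.lessThan_Suc_shift nth_append add.assoc)
  qed
qed simp

lemma concat_pairs:
  "concat (map (\<lambda>(u, v). [u, v]) (map g [0..<m])) =
    map (\<lambda>i. if even i then fst (g (i div 2)) else snd (g (i div 2))) [0..<2 * m]"
  by (induction m) (auto simp: case_prod_unfold)

text \<open>The operations include no logarithm; counting the shifts that leave a nonzero number is
  a bounded sum.\<close>

lemma sum_drop_bit_eq_floorlog:
  "(\<Sum>i < m. of_bool (0 < drop_bit i m)) = floorlog 2 m"
proof (cases "m = 0")
  case False
  then have b: "2 ^ (floorlog 2 m - 1) \<le> m" "m < 2 ^ floorlog 2 m"
    using floorlog_bounds[of m 2] by simp_all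
  have pos: "0 < floorlog 2 m" using False by (simp add: floorlog_def)
  have "0 < drop_bit i m \<longleftrightarrow> i < floorlog 2 m" for i
  proof
    assume "0 < drop_bit i m"
    then have "2 ^ i \<le> m" by (simp add: drop_bit_eq_div div_greater_zero_iff)
    then have "(2::nat) ^ i < 2 ^ floorlog 2 m" using b(2) by linarith
    then show "i < floorlog 2 m" by simp
  next
    assume "i < floorlog 2 m"
    then have "(2::nat) ^ i \<le> 2 ^ (floorlog 2 m - 1)" by (intro power_increasing) auto
    then have "2 ^ i \<le> m" using b(1) by (rule le_trans)
    then show "0 < drop_bit i m" by (simp add: drop_bit_eq_div div_greater_zero_iff)
  qed
  moreover have "floorlog 2 m \<le> m"
  proof -
    have "(2::nat) ^ (floorlog 2 m - 1) < 2 ^ m" using b(1) less_exp[of m] by linarith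
    then have "floorlog 2 m - 1 < m" by simp
    then show ?thesis using pos by linarith
  qed
  then have "{..<m} \<inter> {i. i < floorlog 2 m} = {..<floorlog 2 m}" by auto
  ultimately show ?thesis by simp
qed (simp add: floorlog_def)

fun upd_all :: "(nat \<Rightarrow> nat) \<Rightarrow> (nat \<Rightarrow> nat) \<Rightarrow> (nat \<times> expr) list \<Rightarrow> nat \<Rightarrow> nat" where
  "upd_all e M [] = e"
| "upd_all e M ((v, x) # xs) = upd_all (e(v := ev e M x)) M xs"

fun safe_all :: "nat \<Rightarrow> nat \<Rightarrow> (nat \<Rightarrow> nat) \<Rightarrow> (nat \<Rightarrow> nat) \<Rightarrow> (nat \<times> expr) list \<Rightarrow> bool" where
  "safe_all B S e M [] = True"
| "safe_all B S e M ((v, x) # xs) = (safe B S e M x \<and> safe_all B S (e(v := ev e M x)) M xs)"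

definition assigns :: "(nat \<times> expr) list \<Rightarrow> program" where
  "assigns xs = concat (map (\<lambda>(v, x). assign v x) xs)"

definition costs :: "nat \<Rightarrow> (nat \<times> expr) list \<Rightarrow> nat" where
  "costs S xs = (\<Sum>(v, x)\<leftarrow>xs. cost S x + 1)"

lemma runs_assigns:
  assumes "state e R" "safe_all B S e M xs" "2 \<le> B" "S + 1 < B" "\<forall>(v, x) \<in> set xs. B ^ deg x \<le> 2 ^ w"
  shows "runs w (assigns xs) R M (costs S xs) (\<lambda>R' M'. state (upd_all e M xs) R' \<and> M' = M)"
  using assms(1,2,5)
proof (induction xs arbitrary: e R)
  case Nil
  then show ?case by (simp add: assigns_def runs_Nil)
next
  case (Cons vx xs)
  obtain v x where vx: "vx = (v, x)" by (cases vx)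
  have "runs w (assign v x @ assigns xs) R M (cost S x + 1 + costs S xs)
    (\<lambda>R' M'. state (upd_all e M (vx # xs)) R' \<and> M' = M)"
  proof (rule runs_append[OF runs_mono[OF runs_assign[of e R B S] order_refl]])
    fix R' M' assume "state (e(v := ev e M x)) R' \<and> M' = M"
    then have st: "state (e(v := ev e M x)) R'" and M': "M' = M" by auto
    have "safe_all B S (e(v := ev e M x)) M xs" "\<forall>(v, x) \<in> set xs. B ^ deg x \<le> 2 ^ w"
      using Cons.prems by (simp_all add: vx)
    from Cons.IH[OF st this]
    show "runs w (assigns xs) R' M' (costs S xs) (\<lambda>R' M'. state (upd_all e M (vx # xs)) R' \<and> M' = M)"
      unfolding M' vx upd_all.simps .
  qed (use Cons.prems assms(3,4) vx in auto)
  then show ?case by (simp add: vx assigns_def costs_def)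
qed

text \<open>A recurrence: from the preceding position, skip the length cell and as many literals as
  it announces. Clause 0 starts behind two words of header.\<close>

definition eStart :: expr where
  "eStart = (let p = EBin SUB (EBin ADD xH xi) (ENum 1) in
     eIf (EBin EQ xi (ENum 0)) (ENum 2) (EBin ADD (EBin ADD (EMem p) (ENum 1)) (EMem (EMem p))))"

definition eHeader :: expr where
  "eHeader = eIf (EBin EQ xi (ENum 0)) (EBin MUL (ENum 4) xV)
     (eIf (EBin EQ xi (ENum 1)) (EBin MUL (ENum 5) xV) xNy)"

definition eMask :: "nat \<Rightarrow> expr" where
  "eMask c = EBin SUB (EBin SHL (ENum 1)
     (EBin MUL (ENum c) (ESum 11 (EVar 17) (EBin LESS (ENum 0) (EBin SHR (EVar 17) xt))))) (ENum 1)"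

text \<open>Variable 8 points behind the input, as a clause of distinct literals takes at most
  \<open>2 * n + 1\<close> words. Variables 12 and 14 are the addresses of the edge list and of the
  list of \<open>Sg\<close>; 13, 16 and 17 are the lengths in words of the edge list, the header and
  the whole encoding.\<close>

definition dims :: "nat \<Rightarrow> (nat \<times> expr) list" where
  "dims K = [(0, EMem (ENum 0)), (1, EMem (ENum 1)),
     (2, EBin ADD (EBin DIV xn (ENum (K + 1))) (ENum 1)),
     (3, EBin SHL (ENum 1) (EBin ADD xq (ENum 1))),
     (4, EBin ADD xL (ENum (K + 1))),
     (5, ePow xN K), (6, ePow xD K),
     (7, EBin MUL (ENum (2 * (K + 1))) (EBin MUL xNy xDx)),
     (8, EBin ADD (ENum 2) (EBin MUL xL (EBin ADD (EBin MUL (ENum 2) xn) (ENum 1)))),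
     (9, EBin ADD xH xL), (12, EBin ADD xG (ENum 3)), (13, EBin MUL (ENum 10) xV),
     (14, EBin ADD (EVar 12) (EVar 13)), (16, ENum 3),
     (17, EBin ADD (EBin ADD (ENum 3) (EVar 13)) xNy)]"

text \<open>The last table lists \<open>Sg\<close>, since \<open>vid 0 y 0 = y * Dx\<close>.\<close>

definition prelude :: "nat \<Rightarrow> nat \<Rightarrow> program" where
  "prelude K c = assigns (dims K) @ fill 10 8 1 eStart @ fill 10 9 16 eHeader @
     fill 10 12 13 (eCell K) @ fill 10 14 5 (EBin MUL xi xDx) @ assigns [(15, eMask c)]"

context cnf_reduction
begin

lemma ev_eValid:
  assumes "loaded B S e M" "11 \<notin> evars y" "11 \<notin> evars x"
  shows "ev e M (eValid K i y x) = of_bool (valid (ev e M i) (ev e M y) (ev e M x))"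
proof -
  have e: "e 3 = Nv" "e 4 = Dc" using assms(1) by (simp_all add: loaded_def)
  have fresh: "11 \<notin> evars (eDig xN p y)" "11 \<notin> evars (eDig xD p x)" for p
    using evars_eDig[of xN p y] evars_eDig[of xD p x] assms(2,3) by auto
  have "ev e M (eValid K i y x) = of_bool (\<forall>(p, j) \<in> set (List.product [0..<K] [0..<K]).
    if p + ev e M i < K then p + j < K \<longrightarrow> cnf_vec \<phi> q p (dig Nv p (ev e M y)) (dig Dc j (ev e M x))
    else K \<le> p + j + 1 \<longrightarrow> cnf_vec \<phi> q (p + 1) (dig Nv p (ev e M y)) (dig Dc j (ev e M x)))"
    unfolding eValid_def
    by (rule ev_eAll) (auto simp: if_distrib[of "ev e M"] ev_eIf[where P = "_ < _"] ev_eVec[OF assms(1) fresh] e split: if_split_asm)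
  moreover have "(\<forall>(p, j) \<in> set (List.product [0..<K] [0..<K]). P p j) \<longleftrightarrow> (\<forall>p < K. \<forall>j < K. P p j)"
    for P by auto
  ultimately show ?thesis unfolding valid_def by (simp only:)
qed

lemma ev_eVid: "loaded B S e M \<Longrightarrow> ev e M (eVid i y x) = vid (ev e M i) (ev e M y) (ev e M x)"
  by (simp add: eVid_def vid_def loaded_def)

lemma ev_eMid: "ev e M (eMid K i) = of_bool (1 \<le> ev e M i \<and> ev e M i \<le> K)"
  by (auto simp: eMid_def)

lemma ev_eVx:
  assumes "loaded B S e M"
  shows "ev e M (eVx K i y x) = vx (ev e M i) (ev e M y) (ev e M x)"
proof -
  have e: "e 3 = Nv" using assms by (simp add: loaded_def)
  have sum: "(\<Sum>j\<leftarrow>[1..<K + 1]. of_bool (k = j) * zero_dig Nv (K - j) z) = zero_dig Nv (K - k) z"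
    if "1 \<le> k" "k \<le> K" for k z
  proof -
    have "(\<Sum>j\<leftarrow>[1..<K + 1]. of_bool (k = j) * zero_dig Nv (K - j) z) =
        (\<Sum>j \<in> {1..<K + 1}. if k = j then zero_dig Nv (K - j) z else 0)"
      unfolding interv_sum_list_conv_sum_set_nat by (intro sum.cong) auto
    then show ?thesis using that by simp
  qed
  have "ev e M (eSum (map (\<lambda>j. EBin MUL (EBin EQ i (ENum j)) (eZero xN (K - j) y)) [1..<K + 1])) =
      (\<Sum>j\<leftarrow>[1..<K + 1]. of_bool (ev e M i = j) * zero_dig Nv (K - j) (ev e M y))"
    by (simp add: comp_def e)
  then show ?thesis unfolding eVx_def ev_eIf[OF ev_eMid] vx_def ev_eVid[OF assms]
    using sum by (simp del: upt_Suc)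
qed

lemma ev_eCore:
  assumes "loaded B S e M" "11 \<notin> evars y" "11 \<notin> evars x"
  shows "ev e M (eCore K i y x) = of_bool (core (ev e M i) (ev e M y) (ev e M x))"
proof -
  have "ev e M (EBin LESS i (ENum (K + 1))) = of_bool (ev e M i \<le> K)" by auto
  from ev_eIf[OF this] show ?thesis
    unfolding eCore_def core_def by (auto simp: ev_eValid[OF assms])
qed

lemma ev_decode:
  assumes "loaded B S e M"
  shows "ev e M (eLay a) = layer (ev e M a)" "ev e M (eYc a) = yc (ev e M a)" "ev e M (eXc a) = xc (ev e M a)"
  using assms by (simp_all add: eLay_def eYc_def eXc_def layer_def yc_def xc_def loaded_def)

lemma evars_decode: "11 \<notin> evars a \<Longrightarrow> 11 \<notin> evars (eLay a) \<and> 11 \<notin> evars (eYc a) \<and> 11 \<notin> evars (eXc a)"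
  by (simp add: eLay_def eYc_def eXc_def)

lemma ev_eGood:
  assumes "loaded B S e M" "11 \<notin> evars a"
  shows "ev e M (eGood K a) = of_bool (good (ev e M a))"
  using assms evars_decode[OF assms(2)]
  by (simp add: eGood_def good_def ev_eVx ev_eValid ev_decode ev_eMid)

lemma ev_eFst_eSnd:
  assumes l: "loaded B S e M" and fresh: "11 \<notin> evars a"
    and a: "ev e M a = j div 5" and s: "ev e M s = j mod 5"
  shows "ev e M (eFst K a s) = fst (gedge j)" "ev e M (eSnd K a s) = snd (gedge j)"
proof -
  have e: "e 7 = V" using l by (simp add: loaded_def)
  have hub: "ev e M (eHub K) = hub" by (simp add: eHub_def ev_eVid[OF l] hub_def)
  have 1: "ev e M (EBin LESS s (ENum 3)) = of_bool (j mod 5 < 3)" by (simp add: s)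
  have 2: "ev e M (EBin EQ s (ENum 3)) = of_bool (j mod 5 = 3)" by (simp add: s)
  note fr = evars_decode[OF fresh]
  have 3: "ev e M (eCore K (eLay a) (eYc a) (eXc a)) =
      of_bool (core (layer (j div 5)) (yc (j div 5)) (xc (j div 5)))"
    using fr by (simp add: ev_eCore[OF l] ev_decode[OF l] a)
  have 4: "ev e M (eGood K a) = of_bool (good (j div 5))" by (simp add: ev_eGood[OF l fresh] a)
  show "ev e M (eFst K a s) = fst (gedge j)" "ev e M (eSnd K a s) = snd (gedge j)"
    unfolding eFst_def eSnd_def ev_eIf[OF 1] ev_eIf[OF 2] ev_eIf[OF 3] ev_eIf[OF 4] gedge_def Let_def
    by (simp_all add: eLeaf_def ev_eVx[OF l] ev_decode[OF l] a s e hub)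
qed

lemma ev_eCell:
  assumes "loaded B S e M"
  shows "ev e M (eCell K) = (if even (e 10) then fst (gedge (e 10 div 2)) else snd (gedge (e 10 div 2)))"
proof -
  have "ev e M (EBin EQ (EBin MOD xi (ENum 2)) (ENum 0)) = of_bool (even (e 10))"
    by (simp add: even_iff_mod_2_eq_zero)
  from ev_eIf[OF this] show ?thesis unfolding eCell_def Let_def
    by (simp add: ev_eFst_eSnd[OF assms, where j = "e 10 div 2"])
qed

lemma safe_eValid:
  assumes "loaded B S e M" "11 \<notin> evars y" "11 \<notin> evars x"
    "safe B S e M i" "safe B S e M y" "safe B S e M x"
  shows "safe B S e M (eValid K i y x)"
proof -
  have e: "e v < B" for v using assms(1) unfolding loaded_def by blast
  have fresh: "11 \<notin> evars (eDig xN p y)" "11 \<notin> evars (eDig xD p x)" for p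
    using evars_eDig[of xN p y] evars_eDig[of xD p x] assms(2,3) by auto
  show ?thesis unfolding eValid_def
    using assms e fresh by (auto intro!: safe_eVec safe_eDig)
qed

lemma safe_eVx:
  assumes "loaded B S e M" "safe B S e M i" "safe B S e M y" "safe B S e M x"
  shows "safe B S e M (eVx K i y x)"
proof -
  have "e v < B" for v using assms(1) unfolding loaded_def by blast
  then show ?thesis using assms(2-) by (auto simp: eVx_def eMid_def eVid_def intro!: safe_eZero)
qed

lemma safe_eCell:
  assumes l: "loaded B S e M"
  shows "safe B S e M (eCell K)"
proof -
  have e: "e v < B" for v using l unfolding loaded_def by blast
  define a where "a = EBin DIV (EBin DIV xi (ENum 2)) (ENum 5)"
  define s where "s = EBin MOD (EBin DIV xi (ENum 2)) (ENum 5)"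
  have a: "safe B S e M a" "11 \<notin> evars a" and s: "safe B S e M s" using e by (simp_all add: a_def s_def)
  have d: "safe B S e M (eLay a)" "safe B S e M (eYc a)" "safe B S e M (eXc a)"
    using a e by (simp_all add: eLay_def eYc_def eXc_def)
  have valid: "safe B S e M (eValid K (eLay a) (eYc a) (eXc a))"
    using evars_decode[OF a(2)] by (intro safe_eValid l d) auto
  have vx: "safe B S e M (eVx K (eLay a) (eYc a) (eXc a))"
    "safe B S e M (eVx K (EBin ADD (eLay a) (ENum 1)) (eYc a) (eXc a))"
    using d by (auto intro!: safe_eVx l)
  show ?thesis unfolding eCell_def Let_def a_def[symmetric] s_def[symmetric] eFst_def eSnd_def
    using a s d valid vx e
    by (simp add: eCore_def eGood_def eMid_def eLeaf_def eHub_def eVid_def)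
qed

end

definition mem_of :: "nat list \<Rightarrow> nat \<Rightarrow> nat" where
  "mem_of xs i = (if i < length xs then xs ! i else 0)"

lemma runs_then:
  assumes "runs w A R M S (\<lambda>R' M'. state e R' \<and> M' = M1)"
    and "\<And>R'. state e R' \<Longrightarrow> runs w A' R' M1 T Q"
  shows "runs w (A @ A') R M (S + T) Q"
  using assms by (intro runs_append[OF runs_mono[OF assms(1) order_refl]]) auto

definition exprs :: "nat \<Rightarrow> nat \<Rightarrow> expr list" where
  "exprs K c = map snd (dims K) @ [eStart, eHeader, eCell K, EBin MUL xi xDx, eMask c]"

context cnf_reduction
begin

definition "xs = encode_cnf n \<phi>"
definition "hb = 2 + length \<phi> * (2 * n + 1)"
definition "gb = hb + length \<phi>"
definition "glen = 3 + 10 * V + Ny"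
definition "gcode = encode_graph (4 * V) (map gedge [0..<5 * V]) (map (\<lambda>y. vid 0 y 0) [0..<Ny])"
definition "cell i = (if even i then fst (gedge (i div 2)) else snd (gedge (i div 2)))"
definition "header i = (if i = 0 then 4 * V else if i = 1 then 5 * V else Ny)"

abbreviation "clause_code C \<equiv> length C # map (\<lambda>(v, b). 2 * v + of_bool b) (C :: (nat \<times> bool) list)"

lemma clause_length: "C \<in> set \<phi> \<Longrightarrow> length C \<le> 2 * n"
proof -
  assume "C \<in> set \<phi>"
  then have "distinct C" "set C \<subseteq> {..<n} \<times> UNIV" using cnf unfolding cnf_over_def by fastforce+
  then have "length C \<le> card ({..<n} \<times> (UNIV :: bool set))"
    by (metis distinct_card card_mono finite_SigmaI finite_lessThan finite)
  then show ?thesis by (simp add: card_cartesian_product)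
qed

lemma xs_eq: "xs = n # length \<phi> # concat (map clause_code \<phi>)"
  by (simp add: xs_def encode_cnf_def)

lemma length_xs: "length xs \<le> hb"
proof -
  have "length (concat (map clause_code \<phi>)) = (\<Sum>C\<leftarrow>\<phi>. length C + 1)"
    by (simp add: length_concat comp_def)
  also have "\<dots> \<le> (\<Sum>C\<leftarrow>\<phi>. 2 * n + 1)"
    by (rule sum_list_mono) (simp add: clause_length)
  also have "\<dots> = length \<phi> * (2 * n + 1)" by (simp add: sum_list_triv)
  finally show ?thesis by (simp add: xs_eq hb_def)
qed

lemma clause_code_at:
  assumes "c < length \<phi>" "t \<le> length (\<phi> ! c)"
  shows "start c + t < length xs" "mem_of xs (start c + t) = clause_code (\<phi> ! c) ! t"
proof -
  have c: "c < length (map clause_code \<phi>)" "t < length (map clause_code \<phi> ! c)"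
    using assms by simp_all
  have "(\<Sum>i < c. length (map clause_code \<phi> ! i)) = (\<Sum>i < c. length (\<phi> ! i) + 1)"
    using assms(1) by (intro sum.cong) auto
  then have s: "start c + t = Suc (Suc ((\<Sum>i < c. length (map clause_code \<phi> ! i)) + t))"
    by (simp add: start_def)
  show lt: "start c + t < length xs"
    unfolding s xs_eq using nth_concat_offset[OF c] by simp
  have "xs ! (start c + t) = clause_code (\<phi> ! c) ! t"
    unfolding s xs_eq using nth_concat_offset[OF c] assms(1) by simp
  then show "mem_of xs (start c + t) = clause_code (\<phi> ! c) ! t" using lt by (simp add: mem_of_def)
qed

lemma xs_le: "mem_of xs i \<le> 2 * n + length \<phi>"
proof (cases "i < length xs")
  case True
  then have "xs ! i \<in> set xs" by simp
  then consider "xs ! i \<le> n + length \<phi>" | C where "C \<in> set \<phi>" "xs ! i = length C"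
    | C v b where "C \<in> set \<phi>" "(v, b) \<in> set C" "xs ! i = 2 * v + of_bool b"
    unfolding xs_eq by force
  then have "xs ! i \<le> 2 * n + length \<phi>"
  proof cases
    case (2 C)
    then show ?thesis using clause_length[of C] by simp
  next
    case (3 C v b)
    then have "v < n" using cnf unfolding cnf_over_def by fastforce
    then show ?thesis using 3 by (cases b) auto
  qed simp
  then show ?thesis using True by (simp add: mem_of_def)
qed (simp add: mem_of_def)

lemma loadedI:
  assumes "\<And>v. e v < B" "\<And>i. M i < B" "2 * n \<le> S" "S < B"
    and "e 1 = length \<phi>" "e 2 = q" "e 3 = Nv" "e 4 = Dc" "e 5 = Ny" "e 6 = Dx" "e 7 = V" "e 8 = hb"
    and "\<And>c. c < length \<phi> \<Longrightarrow> M (hb + c) = start c" "\<And>j. j < length xs \<Longrightarrow> M j = mem_of xs j"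
  shows "loaded B S e M"
proof -
  have "M (start c) = length (\<phi> ! c)" if "c < length \<phi>" for c
    using clause_code_at[OF that, of 0] assms(14)[of "start c"] by simp
  moreover have "M (start c + 1 + t) = (\<lambda>(v, b). 2 * v + of_bool b) (\<phi> ! c ! t)"
    if "c < length \<phi>" "t < length (\<phi> ! c)" for c t
    using clause_code_at[OF that(1), of "Suc t"] assms(14)[of "start c + Suc t"] that by simp
  moreover have "length (\<phi> ! c) \<le> S" if "c < length \<phi>" for c
    using clause_length[of "\<phi> ! c"] that assms(3) by simp
  ultimately show ?thesis unfolding loaded_def
    by (simp add: assms assms(5)[unfolded One_nat_def])
qed

lemma cell_less: "i < 10 * V \<Longrightarrow> cell i < 4 * V"
proof -
  assume "i < 10 * V"
  then have "i div 2 < 5 * V" by auto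
  then have "(\<lambda>(u, v). {u, v}) (gedge (i div 2)) \<in> Eg" unfolding Eg_def by (intro imageI) simp
  from simple_graph_Eg[unfolded simple_graph_def, THEN bspec, OF this]
  have "(\<lambda>(u, v). {u, v}) (gedge (i div 2)) \<subseteq> {..<4 * V}" by (rule conjunct1)
  then show ?thesis by (cases "gedge (i div 2)") (auto simp: cell_def)
qed

lemma gcode_eq: "gcode = map header [0..<3] @ map cell [0..<10 * V] @ map (\<lambda>i. i * Dx) [0..<Ny]"
proof -
  have "concat (map (\<lambda>(u, v). [u, v]) (map gedge [0..<5 * V])) = map cell [0..<10 * V]"
    unfolding concat_pairs cell_def by simp
  moreover have "map header [0..<3] = [4 * V, 5 * V, Ny]"
    by (simp add: upt_rec header_def)
  moreover have "map (\<lambda>y. vid 0 y 0) [0..<Ny] = map (\<lambda>i. i * Dx) [0..<Ny]"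
    by (simp add: vid_def)
  ultimately show ?thesis unfolding gcode_def encode_graph_def by simp
qed

lemma length_gcode: "length gcode = glen"
  by (simp add: gcode_eq glen_def)

lemma mem_of_gcode:
  assumes "i < glen"
  shows "mem_of gcode i = (if i < 3 then header i else if i < 3 + 10 * V then cell (i - 3)
    else (i - 3 - 10 * V) * Dx)"
  using assms unfolding mem_of_def length_gcode unfolding gcode_eq glen_def
  by (auto simp: nth_append)

lemma V_bounds: "Nv \<le> V" "Dc \<le> V" "Ny \<le> V" "Dx \<le> V" "q < V" "length \<phi> < V" "Ny * Dx \<le> V"
proof -
  have *: "x \<le> x ^ K" if "0 < x" for x :: nat using self_le_power[of x K] that K by simp
  have "Nv \<le> Ny" "Dc \<le> Dx" unfolding Ny_def Dx_def using N D by (auto intro!: *)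
  moreover have "Ny \<le> Ny * Dx" "Dx \<le> Ny * Dx" using Ny Dx by auto
  moreover have "Ny * Dx \<le> V" by (simp add: V_def)
  moreover have "q < Nv" unfolding Nv_def by (meson le_add1 less_exp less_le_trans one_le_numeral power_increasing)
  moreover have "length \<phi> < Dc" by (simp add: Dc_def)
  ultimately show "Nv \<le> V" "Dc \<le> V" "Ny \<le> V" "Dx \<le> V" "q < V" "length \<phi> < V" "Ny * Dx \<le> V" by linarith+
qed

definition "dim_env = upd_all (\<lambda>_. 0) (mem_of xs) (dims K)"

lemma dim_env:
  "dim_env 1 = length \<phi>" "dim_env 2 = q" "dim_env 3 = Nv" "dim_env 4 = Dc" "dim_env 5 = Ny"
  "dim_env 6 = Dx" "dim_env 7 = V" "dim_env 8 = hb" "dim_env 9 = gb" "dim_env 12 = gb + 3"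
  "dim_env 13 = 10 * V" "dim_env 14 = gb + 3 + 10 * V" "dim_env 16 = 3" "dim_env 17 = glen"
  and dim_env_le: "dim_env v \<le> 2 * n + gb + glen"
proof -
  have m: "mem_of xs 0 = n" "mem_of xs (Suc 0) = length \<phi>" by (simp_all add: mem_of_def xs_eq)
  have Nv: "2 * 2 ^ q = Nv" by (simp add: Nv_def)
  have Dc: "Suc (length \<phi> + K) = Dc" by (simp add: Dc_def)
  have V: "2 * (Ny * Dx) + 2 * K * (Ny * Dx) = V" "2 * (Dx * Ny) + 2 * K * (Ny * Dx) = V"
    by (simp_all add: V_def algebra_simps)
  have env: "dim_env = (\<lambda>_. 0)(0 := n, 1 := length \<phi>, 2 := q, 3 := Nv, 4 := Dc, 5 := Ny, 6 := Dx, 7 := V,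
    8 := hb, 9 := gb, 12 := gb + 3, 13 := 10 * V, 14 := gb + 3 + 10 * V, 16 := 3, 17 := glen)"
    unfolding dim_env_def dims_def
    by (simp add: m q_def[symmetric, simplified] Nv Dc Ny_def[symmetric] Dx_def[symmetric]
        V hb_def[symmetric, simplified] gb_def[symmetric] glen_def[symmetric])
  show "dim_env 1 = length \<phi>" "dim_env 2 = q" "dim_env 3 = Nv" "dim_env 4 = Dc" "dim_env 5 = Ny"
    "dim_env 6 = Dx" "dim_env 7 = V" "dim_env 8 = hb" "dim_env 9 = gb" "dim_env 12 = gb + 3"
    "dim_env 13 = 10 * V" "dim_env 14 = gb + 3 + 10 * V" "dim_env 16 = 3" "dim_env 17 = glen"
    by (simp_all add: env)
  show "dim_env v \<le> 2 * n + gb + glen"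
    using V_bounds by (simp add: env glen_def gb_def)
qed

end

lemma filled_less:
  "(\<And>j. M j < B) \<Longrightarrow> (\<And>i. i < n \<Longrightarrow> g i < B) \<Longrightarrow> filled M b n g j < B"
  by (auto simp: filled_def)

lemma filled_other: "j < b \<Longrightarrow> filled M b n g j = M j"
  by (simp add: filled_def)

lemma filled_at: "i < n \<Longrightarrow> filled M b n g (b + i) = g i"
  by (simp add: filled_def)

context cnf_reduction
begin

text \<open>Sums over literals have at most \<open>2 * n\<close> terms. The sum in
  \<open>eMask\<close> has \<open>glen\<close> terms but is evaluated once.\<close>

definition "prelude_time c = costs (2 * n) (dims K) +
  ((length \<phi> * (cost (2 * n) eStart + 6) + 3) + ((3 * (cost (2 * n) eHeader + 6) + 3) +
  ((10 * V * (cost (2 * n) (eCell K) + 6) + 3) + ((Ny * (cost (2 * n) (EBin MUL xi xDx) + 6) + 3) +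
    costs glen [(15, eMask c)]))))"

lemma start_less: "c < length \<phi> \<Longrightarrow> start c < hb"
  using clause_code_at(1)[of c 0] length_xs by simp

text \<open>The last conjunct concerns all cells from \<open>gb\<close> on: behind the encoding the
  memory must be 0, as in the initial memory of the simulated program.\<close>

lemma prelude_runs:
  assumes B: "2 * n + gb + glen + 1 < B" and mask: "2 ^ (c * floorlog 2 glen) < B"
    and w: "\<And>x. x \<in> set (exprs K c) \<Longrightarrow> B ^ deg x \<le> 2 ^ w"
  shows "runs w (prelude K c) (\<lambda>_. 0) (mem_of xs) (prelude_time c)
    (\<lambda>R' M'. (\<forall>r. R' (2 * r) = 0) \<and> R' (rv 9) = gb \<and> R' (rv 15) = 2 ^ (c * floorlog 2 glen) - 1 \<and>
      (\<forall>i. M' (gb + i) = mem_of gcode i))"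
proof -
  define S where "S = 2 * n"
  have "B * B \<le> 2 ^ w" using w[of "EBin MUL xi xDx"] by (simp add: exprs_def)
  then have wB: "B \<le> 2 ^ w" by (rule le_trans[OF le_square])
  have two: "2 \<le> B" and SB: "S + 1 < B" using B unfolding S_def by linarith+
  have wA: "\<forall>(v, x) \<in> set (dims K). B ^ deg x \<le> 2 ^ w"
  proof clarify
    fix v x assume "(v, x) \<in> set (dims K)"
    then have "snd (v, x) \<in> snd ` set (dims K)" by (rule imageI)
    then show "B ^ deg x \<le> 2 ^ w" by (intro w) (simp add: exprs_def)
  qed
  have wE: "B ^ deg eStart \<le> 2 ^ w" "B ^ deg eHeader \<le> 2 ^ w" "B ^ deg (eCell K) \<le> 2 ^ w"
    "B ^ deg (EBin MUL xi xDx) \<le> 2 ^ w" "B ^ deg (eMask c) \<le> 2 ^ w"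
    by (rule w, simp add: exprs_def)+
  have V: "Nv < B" "Dc < B" "Ny < B" "Dx < B" "q < B" "length \<phi> < B" "Ny * Dx < B" "n < B" "10 * V < B" "V < B"
    "hb < B" "gb < B" "glen < B" "gb + glen < B" "gb + 3 < B" "gb + 3 + 10 * V < B" "3 + 10 * V < B"
    using V_bounds B unfolding glen_def gb_def by linarith+
  have e_less: "dim_env v < B" for v using dim_env_le[of v] B by linarith
  have e_upd: "(dim_env(10 := i)) v < B" if "i < B" for i v using e_less that by simp
  have xs_less: "mem_of xs j < B" for j
    using xs_le[of j] V_bounds B unfolding glen_def by (simp add: le_less_trans)
  define M1 where "M1 = filled (mem_of xs) hb (length \<phi>) start"
  define M2 where "M2 = filled M1 gb 3 header"
  define M3 where "M3 = filled M2 (gb + 3) (10 * V) cell"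
  define M4 where "M4 = filled M3 (gb + 3 + 10 * V) Ny (\<lambda>i. i * Dx)"
  have start_B: "start i < B" if "i < length \<phi>" for i using start_less[OF that] V by linarith
  have header_B: "header i < B" for i
    using B V_bounds unfolding header_def glen_def by auto
  have cell_B: "cell i < B" if "i < 10 * V" for i using cell_less[OF that] B unfolding glen_def by linarith
  have M_less: "M1 j < B" "M2 j < B" "M3 j < B" for j
    unfolding M1_def M2_def M3_def by (intro filled_less xs_less start_B header_B cell_B; assumption?)+
  have s0: "state (\<lambda>_. 0) (\<lambda>_. 0)" by (simp add: state_def)
  have safe0: "safe_all B S (\<lambda>_. 0) (mem_of xs) (dims K)"
  proof -
    have m: "mem_of xs 0 = n" "mem_of xs (Suc 0) = length \<phi>" by (simp_all add: mem_of_def xs_eq)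
    have Nv: "2 * 2 ^ q = Nv" by (simp add: Nv_def)
    have Dc: "Suc (length \<phi> + K) = Dc" by (simp add: Dc_def)
    have V': "2 * (Ny * Dx) + 2 * K * (Ny * Dx) = V" "2 * (Dx * Ny) + 2 * K * (Ny * Dx) = V"
      by (simp_all add: V_def algebra_simps)
    show ?thesis using V unfolding dims_def
      by (simp add: safe_ePow m q_def[symmetric, simplified] Nv Dc Ny_def[symmetric] Dx_def[symmetric]
        V' hb_def[symmetric, simplified] gb_def[symmetric] glen_def[symmetric])
  qed
  have r1: "runs w (assigns (dims K)) (\<lambda>_. 0) (mem_of xs) (costs S (dims K))
      (\<lambda>R' M'. state dim_env R' \<and> M' = mem_of xs)"
    unfolding dim_env_def by (rule runs_assigns[OF s0 safe0 two SB wA])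
  have r2: "runs w (fill 10 8 1 eStart) R (mem_of xs) (length \<phi> * (cost S eStart + 6) + 3)
      (\<lambda>R' M'. state (dim_env(10 := length \<phi>)) R' \<and> M' = M1)" if st: "state dim_env R" for R
  proof -
    have ev: "ev (dim_env(10 := i)) (filled (mem_of xs) hb i start) eStart = start i"
      if i: "i < length \<phi>" for i
    proof -
      have "ev (dim_env(10 := i)) (filled (mem_of xs) hb i start) (EBin EQ xi (ENum 0)) = of_bool (i = 0)"
        by simp
      note If = ev_eIf[OF this]
      show ?thesis
      proof (cases i)
        case 0
        then show ?thesis unfolding eStart_def Let_def If by (simp add: start_def)
      next
        case (Suc k)
        have "filled (mem_of xs) hb i start (hb + k) = start k" using Suc by (simp add: filled_at)
        moreover have "filled (mem_of xs) hb i start (start k) = length (\<phi> ! k)"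
          using Suc i start_less[of k] clause_code_at(2)[of k 0] by (simp add: filled_other)
        ultimately show ?thesis unfolding eStart_def Let_def If using Suc
          by (simp add: dim_env start_def)
      qed
    qed
    have safe: "safe B S (dim_env(10 := i)) (filled (mem_of xs) hb i start) eStart"
      if i: "i < length \<phi>" for i
    proof -
      have "filled (mem_of xs) hb i start j < B" for j
        using i by (intro filled_less xs_less start_B) simp
      moreover have "i < B" "1 \<le> hb" using i V by (simp_all add: hb_def)
      ultimately show ?thesis using V by (simp add: eStart_def Let_def dim_env)
    qed
    have "runs w (fill 10 8 1 eStart) R (mem_of xs) (dim_env 1 * (cost S eStart + 6) + 3)
      (\<lambda>R' M'. state (dim_env(10 := dim_env 1)) R' \<and> M' = filled (mem_of xs) (dim_env 8) (dim_env 1) start)"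
      by (rule runs_fill[OF st _ _ _ _ two SB wE(1)])
        (use safe ev wB V in \<open>simp_all add: dim_env gb_def[symmetric] del: One_nat_def\<close>)
    then show ?thesis by (simp add: dim_env M1_def del: One_nat_def)
  qed
  have r3: "runs w (fill 10 9 16 eHeader) R M1 (3 * (cost S eHeader + 6) + 3)
      (\<lambda>R' M'. state (dim_env(10 := 3)) R' \<and> M' = M2)" if st: "state (dim_env(10 := length \<phi>)) R" for R
  proof -
    let ?e = "dim_env(10 := length \<phi>)"
    have "runs w (fill 10 9 16 eHeader) R M1 (?e 16 * (cost S eHeader + 6) + 3)
      (\<lambda>R' M'. state (?e(10 := ?e 16)) R' \<and> M' = filled M1 (?e 9) (?e 16) header)"
    proof (rule runs_fill[OF st _ _ _ _ two SB wE(2)])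
      fix i assume "i < ?e 16"
      then show "safe B S (?e(10 := i)) (filled M1 (?e 9) i header) eHeader"
        "ev (?e(10 := i)) (filled M1 (?e 9) i header) eHeader = header i"
        using V B unfolding eHeader_def
        by (simp_all add: ev_eIf[where P = "_ = _"] header_def dim_env)
    qed (use wB V B in \<open>simp_all add: dim_env glen_def\<close>)
    then show ?thesis by (simp add: dim_env M2_def)
  qed
  have loaded: "loaded B S (dim_env(10 := i)) (filled M2 (gb + 3) j cell)" if "i < B" "j \<le> 10 * V" for i j
  proof (rule loadedI)
    show "(dim_env(10 := i)) v < B" for v using e_upd that(1) .
    show "filled M2 (gb + 3) j cell k < B" for k
      using that(2) by (intro filled_less M_less cell_B) simp
    show "filled M2 (gb + 3) j cell (hb + k) = start k" if "k < length \<phi>" for k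
    proof -
      have "hb + k < gb" using that by (simp add: gb_def)
      then have "filled M2 (gb + 3) j cell (hb + k) = M1 (hb + k)" unfolding M2_def by (simp add: filled_other)
      then show ?thesis using that by (simp add: M1_def filled_at)
    qed
    show "filled M2 (gb + 3) j cell k = mem_of xs k" if "k < length xs" for k
      using that length_xs unfolding M2_def M1_def gb_def by (simp add: filled_other)
  qed (use SB in \<open>simp_all add: S_def dim_env dim_env(1)[unfolded One_nat_def]\<close>)
  have r4: "runs w (fill 10 12 13 (eCell K)) R M2 (10 * V * (cost S (eCell K) + 6) + 3)
      (\<lambda>R' M'. state (dim_env(10 := 10 * V)) R' \<and> M' = M3)" if st: "state (dim_env(10 := 3)) R" for R
  proof -
    let ?e = "dim_env(10 := 3)"
    have "runs w (fill 10 12 13 (eCell K)) R M2 (?e 13 * (cost S (eCell K) + 6) + 3)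
      (\<lambda>R' M'. state (?e(10 := ?e 13)) R' \<and> M' = filled M2 (?e 12) (?e 13) cell)"
    proof (rule runs_fill[OF st _ _ _ _ two SB wE(3)])
      fix i assume "i < ?e 13"
      then have i: "i < B" "i \<le> 10 * V" using V by (simp_all add: dim_env)
      then show "safe B S (?e(10 := i)) (filled M2 (?e 12) i cell) (eCell K)"
        "ev (?e(10 := i)) (filled M2 (?e 12) i cell) (eCell K) = cell i"
        using safe_eCell[OF loaded[OF i]] ev_eCell[OF loaded[OF i]] by (simp_all add: dim_env cell_def)
    qed (use wB V B in \<open>simp_all add: dim_env glen_def\<close>)
    then show ?thesis by (simp add: dim_env M3_def)
  qed
  have r5: "runs w (fill 10 14 5 (EBin MUL xi xDx)) R M3 (Ny * (cost S (EBin MUL xi xDx) + 6) + 3)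
      (\<lambda>R' M'. state (dim_env(10 := Ny)) R' \<and> M' = M4)" if st: "state (dim_env(10 := 10 * V)) R" for R
  proof -
    let ?e = "dim_env(10 := 10 * V)"
    have "runs w (fill 10 14 5 (EBin MUL xi xDx)) R M3 (?e 5 * (cost S (EBin MUL xi xDx) + 6) + 3)
      (\<lambda>R' M'. state (?e(10 := ?e 5)) R' \<and> M' = filled M3 (?e 14) (?e 5) (\<lambda>i. i * Dx))"
      by (rule runs_fill[OF st _ _ _ _ two SB wE(4)])
        (use wB V B in \<open>simp_all add: dim_env glen_def\<close>)
    then show ?thesis by (simp add: dim_env M4_def)
  qed
  have r6: "runs w (assigns [(15, eMask c)]) R M4 (costs glen [(15, eMask c)])
      (\<lambda>R' M'. (\<forall>r. R' (2 * r) = 0) \<and> R' (rv 9) = gb \<and> R' (rv 15) = 2 ^ (c * floorlog 2 glen) - 1 \<and> M' = M4)"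
    if st: "state (dim_env(10 := Ny)) R" for R
  proof -
    let ?e = "dim_env(10 := Ny)"
    have sum: "(\<Sum>i < glen. of_bool (0 < drop_bit i glen)) = floorlog 2 glen"
      by (rule sum_drop_bit_eq_floorlog)
    have ev: "ev ?e M4 (eMask c) = 2 ^ (c * floorlog 2 glen) - 1"
      unfolding eMask_def by (simp add: dim_env sum[simplified] push_bit_eq_mult)
    have "safe_all B glen ?e M4 [(15, eMask c)]"
      unfolding eMask_def using V mask by (auto simp: dim_env sum[simplified] push_bit_eq_mult)
    moreover have "glen + 1 < B" using B by linarith
    moreover have "\<forall>(v, x) \<in> set [(15, eMask c)]. B ^ deg x \<le> 2 ^ w" using wE(5) by simp
    ultimately have "runs w (assigns [(15, eMask c)]) R M4 (costs glen [(15, eMask c)])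
      (\<lambda>R' M'. state (upd_all ?e M4 [(15, eMask c)]) R' \<and> M' = M4)"
      using runs_assigns[OF st _ two] by blast
    then show ?thesis
      by (rule runs_mono[OF _ order_refl]) (simp add: state_def ev dim_env)
  qed
  have M4: "M4 (gb + i) = mem_of gcode i" for i
  proof (cases "i < glen")
    case True
    then show ?thesis unfolding mem_of_gcode[OF True] M4_def M3_def M2_def
      by (auto simp: filled_def glen_def)
  next
    case False
    moreover have "length xs \<le> gb" using length_xs by (simp add: gb_def)
    ultimately show ?thesis unfolding M4_def M3_def M2_def M1_def
      by (auto simp: filled_def mem_of_def length_gcode glen_def gb_def)
  qed
  show ?thesis unfolding prelude_def prelude_time_def S_def[symmetric]
    by (rule runs_then[OF r1 runs_then[OF r2 runs_then[OF r3 runs_then[OF r4 runs_then[OF r5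
      runs_mono[OF r6 order_refl]]]]]]) (simp_all add: M4)
qed

end

subsection \<open>Space and time\<close>

lemma costs_poly: "\<exists>C h. \<forall>S. costs S xs \<le> C * (S + 1) ^ h"
proof (induction xs)
  case Nil
  then show ?case by (simp add: costs_def)
next
  case (Cons vx xs)
  obtain v x where vx: "vx = (v, x)" by (cases vx)
  obtain C h D k where *: "\<And>S. costs S xs \<le> C * (S + 1) ^ h" "\<And>S. cost S x \<le> D * (S + 1) ^ k"
    using Cons cost_poly[of x] by blast
  have "costs S (vx # xs) \<le> (C + D + 1) * (S + 1) ^ (h + k)" for S
  proof -
    have "C * (S + 1) ^ h \<le> C * (S + 1) ^ (h + k)" "D * (S + 1) ^ k \<le> D * (S + 1) ^ (h + k)"
      "1 \<le> (S + 1) ^ (h + k)"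
      by (intro mult_le_mono2 power_increasing; simp)+ simp
    moreover have "costs S (vx # xs) = cost S x + 1 + costs S xs" by (simp add: costs_def vx)
    ultimately show ?thesis using *[of S] unfolding distrib_right by linarith
  qed
  then show ?case by blast
qed

lemma poly_le_exp:
  assumes "1 < (y :: real)"
  shows "\<exists>C > 0. \<forall>n. real (n + 1) ^ h \<le> C * y ^ n"
  using assms
proof (induction h arbitrary: y)
  case 0
  have "1 \<le> y ^ n" for n using 0 by simp
  then show ?case by (intro exI[of _ 1]) simp
next
  case (Suc h)
  \<comment> \<open>One factor \<open>n + 1\<close> is charged to \<open>z ^ n\<close> by
    Bernoulli's inequality, the others to a second \<open>z ^ n\<close> by induction.\<close>
  define z where "z = sqrt y"
  have z: "1 < z" "z * z = y" using Suc.prems by (simp_all add: z_def)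
  obtain C where C: "0 < C" "\<And>n. real (n + 1) ^ h \<le> C * z ^ n" using Suc.IH[OF z(1)] by blast
  define C0 where "C0 = 1 + 1 / (z - 1)"
  have C0: "real (n + 1) \<le> C0 * z ^ n" for n
  proof -
    have "1 + real n * (z - 1) \<le> z ^ n" using Bernoulli_inequality[of "z - 1" n] z by simp
    then have "(1 + real n * (z - 1)) / (z - 1) \<le> z ^ n / (z - 1)" using z by (intro divide_right_mono) auto
    moreover have "(1 + real n * (z - 1)) / (z - 1) = 1 / (z - 1) + n" using z by (simp add: field_simps)
    moreover have "0 < 1 / (z - 1)" "1 \<le> z ^ n" using z by simp_all
    moreover have "C0 * z ^ n = z ^ n + z ^ n / (z - 1)" by (simp add: C0_def distrib_right)
    moreover have "real (n + 1) = 1 + real n" by simp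
    ultimately show ?thesis by linarith
  qed
  have "real (n + 1) ^ Suc h \<le> (C0 * C) * y ^ n" for n
  proof -
    have "real (n + 1) * real (n + 1) ^ h \<le> (C0 * z ^ n) * (C * z ^ n)"
      using C C0 by (intro mult_mono) (auto simp: order_trans[OF _ C0])
    then show ?thesis by (simp add: z(2)[symmetric] power_mult_distrib mult_ac)
  qed
  moreover have "0 < C0 * C" using z C(1) by (simp add: C0_def add_pos_pos)
  ultimately show ?case by blast
qed

context cnf_reduction
begin

text \<open>With \<open>glen < 2 ^ ?m\<close> in the next proof, every cell is a word of the
  simulated machine, as \<open>simulates\<close> demands.\<close>

lemma gcode_less: "mem_of gcode i < glen"
proof (cases "i < glen")
  case True
  have "j * Dx < glen" if "j < Ny" for j
  proof -
    have "j * Dx \<le> Ny * Dx" using that by simp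
    then show ?thesis using V_bounds(7) unfolding glen_def by linarith
  qed
  moreover have "cell j < glen" if "j < 10 * V" for j
    using cell_less[OF that] unfolding glen_def by linarith
  moreover have "header j < glen" for j using Ny V_bounds by (auto simp: header_def glen_def)
  ultimately show ?thesis using True unfolding mem_of_gcode[OF True] by (auto simp: glen_def)
next
  case False
  then show ?thesis by (simp add: mem_of_def length_gcode glen_def)
qed

lemma reduction_answers:
  assumes c: "0 < c" and P: "answers_within (word_length c glen) P gcode t a"
    and B: "2 * n + gb + glen + 1 < B" "2 ^ (c * floorlog 2 glen) < B"
    and w: "\<And>x. x \<in> set (exprs K c) \<Longrightarrow> B ^ deg x \<le> 2 ^ w"
    and u: "prelude_time c + 3 * t + 3 \<le> u"
  shows "answers_within w (prelude K c @ sim_prog 9 15 P @ negate_answer) xs u (\<not> a)"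
proof -
  let ?m = "c * floorlog 2 glen" and ?Q = "sim_prog 9 15 P @ negate_answer"
  have glen: "0 < glen" by (simp add: glen_def)
  have fl: "0 < floorlog 2 glen" "glen < 2 ^ floorlog 2 glen"
    using glen floorlog_bounds[of glen 2] by (auto simp: floorlog_def)
  have "(2::nat) ^ floorlog 2 glen \<le> 2 ^ ?m" using c by (intro power_increasing) auto
  then have glen_m: "glen < 2 ^ ?m" using fl by linarith
  have BB: "B * B \<le> 2 ^ w" using w[of "EBin MUL xi xDx"] by (simp add: exprs_def)
  have "2 \<le> B" using B(1) by linarith
  \<comment> \<open>An expression of degree 2 in \<open>exprs\<close> gives
    \<open>B * B \<le> 2 ^ w\<close>, which leaves room for the window of \<open>2 ^ ?m\<close>
    cells at \<open>gb\<close>.\<close>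
  then have "B + B \<le> B * B" by (metis mult_2 mult_le_mono1)
  then have gbm: "gb + 2 ^ ?m \<le> 2 ^ w" using B BB by linarith
  have "(2::nat) ^ ?m < 2 ^ w" using B BB \<open>B + B \<le> B * B\<close> by linarith
  then have mw: "?m \<le> w" by (simp add: less_imp_le)
  interpret simulation ?m w gb 9 15
    using c fl gbm mw by unfold_locales auto
  obtain s R M where s: "s \<le> prelude_time c" "steps_to w (prelude K c) (\<lambda>_. 0) (mem_of xs) s R M"
    and R: "\<And>r. R (2 * r) = 0" "R (rv 9) = gb" "R (rv 15) = 2 ^ ?m - 1" and M: "\<And>i. M (gb + i) = mem_of gcode i"
    using prelude_runs[OF B w] unfolding runs_def by blast
  have init: "initial P' ys = (P', (\<lambda>_. 0), mem_of ys)" for P' ys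
    by (simp add: initial_def mem_of_def fun_eq_iff)
  have "simulates (\<lambda>_. 0) (mem_of gcode) R M"
    unfolding simulates_def using R M gcode_less glen_m by (auto intro: less_trans)
  from simulation_prob[OF this, of t P a]
  have "2 / 3 \<le> measure_pmf.prob (run w (3 * t + 3) (?Q, R, M)) (halted_with (\<not> a))"
    using P unfolding answers_within_def word_length_def init by linarith
  also have "run w (3 * t + 3) (?Q, R, M) = run w (s + (3 * t + 3)) (prelude K c @ ?Q, (\<lambda>_. 0), mem_of xs)"
    using s(2) unfolding steps_to_def by (simp only: run_add[of w s] bind_return_pmf)
  also have "measure_pmf.prob (run w (s + (3 * t + 3)) (prelude K c @ ?Q, (\<lambda>_. 0), mem_of xs)) (halted_with (\<not> a))
      \<le> measure_pmf.prob (run w u (prelude K c @ ?Q, (\<lambda>_. 0), mem_of xs)) (halted_with (\<not> a))"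
    using s(1) u by (intro prob_halted_mono) linarith
  finally show ?thesis unfolding answers_within_def init .
qed

text \<open>A small diameter means unsatisfiable; \<open>negate_answer\<close> makes up for
  this.\<close>

lemma distinguisher_decides:
  assumes P: "distinguishes_diameter (2 * K + 1) (4 * K + 1) P c T" and c: "0 < c"
    and B: "2 * n + gb + glen + 1 < B" "2 ^ (c * floorlog 2 glen) < B"
      "\<And>x. x \<in> set (exprs K c) \<Longrightarrow> B ^ deg x \<le> 2 ^ w"
    and u: "prelude_time c + 3 * T (5 * V) + 3 \<le> u"
  shows "answers_within w (prelude K c @ sim_prog 9 15 P @ negate_answer) xs u (satisfiable \<phi>)"
proof -
  have "distinct (map (\<lambda>y. vid 0 y 0) [0..<Ny])" using Dx by (auto simp: distinct_map inj_on_def vid_def)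
  moreover have "set (map (\<lambda>y. vid 0 y 0) [0..<Ny]) = Sg" by (auto simp: Sg_def)
  ultimately have "answers_within (word_length c (length gcode)) P gcode (T (card Eg))
      (bichromatic_diameter (4 * V) Eg Sg \<le> 2 * K + 1)"
    using P[unfolded distinguishes_diameter_def, rule_format, of "4 * V" Eg Sg]
      instance_Eg lists_edges_gedge diameter_gap unfolding gcode_def by blast
  then have "answers_within (word_length c glen) P gcode (T (5 * V)) (\<not> satisfiable \<phi>)"
    unfolding length_gcode card_Eg diameter_iff .
  from reduction_answers[OF c this B u] show ?thesis by simp
qed

text \<open>The number of cells written is linear in \<open>V\<close>, and each takes time
  polynomial in \<open>n\<close>. The generous 1000 absorbs the overhead of the loops and the
  mask.\<close>

lemma prelude_time_le:
  assumes "\<And>S. costs S (dims K) \<le> C1 * (S + 1) ^ h1" "\<And>S. cost S eStart \<le> C2 * (S + 1) ^ h2"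
    "\<And>S. cost S eHeader \<le> C3 * (S + 1) ^ h3" "\<And>S. cost S (eCell K) \<le> C4 * (S + 1) ^ h4"
    "\<And>S. cost S (EBin MUL xi xDx) \<le> C5 * (S + 1) ^ h5"
  shows "prelude_time c \<le> (C1 + C2 + 3 * C3 + 10 * C4 + C5 + 1000) *
    (2 * n + 1) ^ (h1 + h2 + h3 + h4 + h5) * V"
proof -
  define h where "h = h1 + h2 + h3 + h4 + h5"
  define s where "s = (2 * n + 1) ^ h"
  have pow: "C * (2 * n + 1) ^ i \<le> C * s" if "i \<le> h" for C i
    unfolding s_def using that by (intro mult_le_mono2 power_increasing) auto
  have s1: "1 \<le> s" by (simp add: s_def)
  have V1: "1 \<le> V" using V_bounds(5) by linarith
  have c1: "costs (2 * n) (dims K) \<le> C1 * s" 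
    by (rule le_trans[OF assms(1) pow]) (simp add: h_def)
  have c2: "cost (2 * n) eStart \<le> C2 * s" 
    by (rule le_trans[OF assms(2) pow]) (simp add: h_def)
  have c3: "cost (2 * n) eHeader \<le> C3 * s" 
    by (rule le_trans[OF assms(3) pow]) (simp add: h_def)
  have c4: "cost (2 * n) (eCell K) \<le> C4 * s" 
    by (rule le_trans[OF assms(4) pow]) (simp add: h_def)
  have c5: "cost (2 * n) (EBin MUL xi xDx) \<le> C5 * s" 
    by (rule le_trans[OF assms(5) pow]) (simp add: h_def)
  define A where "A = s * V"
  have A: "s \<le> A" "V \<le> A" "1 \<le> A" using s1 V1 by (simp_all add: A_def)
  have c1': "costs (2 * n) (dims K) \<le> C1 * A" using c1 A(1) by (meson le_trans mult_le_mono2)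
  have t: "l * (cost (2 * n) x + 6) \<le> C * A + 6 * A" if "cost (2 * n) x \<le> C * s" "l \<le> V" for l x C
  proof -
    have "l * (cost (2 * n) x + 6) \<le> V * (C * s + 6)" using that by (intro mult_le_mono) auto
    also have "\<dots> = C * A + 6 * V" by (simp add: A_def algebra_simps)
    finally show ?thesis using A(2) by linarith
  qed
  have "length \<phi> * (cost (2 * n) eStart + 6) \<le> C2 * A + 6 * A" using c2 V_bounds by (intro t) auto
  moreover have "1 * (cost (2 * n) eHeader + 6) \<le> C3 * A + 6 * A" using c3 V1 by (intro t)
  then have "3 * (cost (2 * n) eHeader + 6) \<le> 3 * (C3 * A) + 18 * A" by linarith
  moreover have "10 * V * (cost (2 * n) (eCell K) + 6) \<le> 10 * (C4 * A) + 60 * A"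
    using t[OF c4 order_refl] by (simp only: mult.assoc)
  moreover have "Ny * (cost (2 * n) (EBin MUL xi xDx) + 6) \<le> C5 * A + 6 * A" using c5 V_bounds by (intro t) auto
  moreover have "costs glen [(15, eMask c)] = 15 + 10 * glen"
    by (simp add: costs_def eMask_def)
  moreover have "glen \<le> 14 * A" using A V_bounds(3) unfolding glen_def by linarith
  ultimately have "prelude_time c \<le> C1 * A + C2 * A + 3 * (C3 * A) + 10 * (C4 * A) + C5 * A + 1000 * A"
    using c1' A(3) unfolding prelude_time_def by linarith
  then have "prelude_time c \<le> (C1 + C2 + 3 * C3 + 10 * C4 + C5 + 1000) * A"
    by (simp only: distrib_right mult.assoc)
  then show ?thesis by (simp add: A_def s_def h_def mult.assoc)
qed

text \<open>The number whose bit length determines the words for satisfiability. The sizes in the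
  reduction are bounded by powers of it whose exponents depend on \<open>K\<close> and
  \<open>c\<close> only.\<close>

definition "search_time = 2 ^ n * length xs"

lemma search_time: "2 \<le> search_time" "n \<le> search_time" "length \<phi> \<le> search_time" "2 ^ n \<le> search_time"
proof -
  have len: "2 + length \<phi> \<le> length xs"
  proof -
    have "(\<Sum>C\<leftarrow>\<phi>. 1) \<le> (\<Sum>C\<leftarrow>\<phi>. length C + 1)" by (rule sum_list_mono) simp
    then show ?thesis by (simp add: xs_eq length_concat comp_def sum_list_triv)
  qed
  have "length xs \<le> search_time" by (simp add: search_time_def)
  then show "2 \<le> search_time" "length \<phi> \<le> search_time" using len by linarith+
  have "2 ^ n * 1 \<le> search_time" unfolding search_time_def using len by (intro mult_le_mono2) linarith
  then show "2 ^ n \<le> search_time" by simp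
  then show "n \<le> search_time" using less_exp[of n] by linarith
qed

lemma pow_mono: "i \<le> j \<Longrightarrow> search_time ^ i \<le> search_time ^ j"
  using search_time(1) by (intro power_increasing) auto

text \<open>The summands belong to the factors of \<open>V\<close>: \<open>2 + K\<close> to
  \<open>2 * (K + 1)\<close>, \<open>3 * K\<close> to \<open>Nv ^ K\<close> and
  \<open>(K + 2) * K\<close> to \<open>Dc ^ K\<close>.\<close>

definition "space_exp = 2 + K + 3 * K + (K + 2) * K"

lemma V_le: "V \<le> search_time ^ space_exp"
proof -
  have Z2: "2 \<le> search_time" by (rule search_time)
  have two: "2 ^ i \<le> search_time ^ i" for i using Z2 by (rule power_mono) simp
  have K1: "K + 1 \<le> search_time ^ (K + 1)"
    using less_exp[of "K + 1"] two[of "K + 1"] by linarith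
  have "Nv \<le> 2 ^ (n + 2)"
    unfolding Nv_def q_def by (rule power_increasing) auto
  also have "\<dots> = 2 ^ n * 2 ^ 2" by (rule power_add)
  also have "\<dots> \<le> search_time * search_time ^ 2" using search_time(4) two by (rule mult_le_mono)
  finally have N: "Nv \<le> search_time ^ 3" by (simp add: power3_eq_cube power2_eq_square)
  have zK: "search_time \<le> search_time ^ (K + 1)" using pow_mono[of 1 "K + 1"] by simp
  have "Dc \<le> search_time ^ (K + 1) + search_time ^ (K + 1)"
    using K1 search_time(3) zK unfolding Dc_def by linarith
  also have "\<dots> \<le> search_time * search_time ^ (K + 1)" using Z2 by (simp only: mult_2[symmetric]) (rule mult_le_mono1)
  finally have D: "Dc \<le> search_time ^ (K + 2)" by simp
  have "V = 2 * (K + 1) * (Nv ^ K * Dc ^ K)" by (simp add: V_def Ny_def Dx_def)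
  also have "\<dots> \<le> search_time * search_time ^ (K + 1) * ((search_time ^ 3) ^ K * (search_time ^ (K + 2)) ^ K)"
    using Z2 K1 N D by (intro mult_le_mono power_mono) auto
  also have "\<dots> = search_time ^ space_exp"
    by (simp add: space_exp_def power_add[symmetric] power_mult[symmetric] power_Suc[symmetric] del: power_Suc)
  finally show ?thesis .
qed

lemma glen_le: "2 * glen \<le> search_time ^ (space_exp + 5)"
proof -
  have "1 \<le> V" using V_bounds(5) by linarith
  then have "2 * glen \<le> 32 * V" using V_bounds(3) unfolding glen_def by auto
  also have "\<dots> \<le> search_time ^ 5 * search_time ^ space_exp"
    using V_le power_mono[OF search_time(1), of 5] by (intro mult_le_mono) auto
  finally show ?thesis by (simp add: power_add mult.commute)
qed

lemma space_le: "2 * n + gb + glen + 1 < search_time ^ (space_exp + 8)"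
proof -
  have s: "5 \<le> space_exp + 5" by simp
  have sq: "search_time * 2 \<le> search_time * search_time" using search_time(1) by (rule mult_le_mono2)
  have "length \<phi> * n \<le> search_time * search_time" using search_time by (intro mult_le_mono)
  moreover have "gb = 2 + 2 * (length \<phi> * n) + 2 * length \<phi>" by (simp add: gb_def hb_def algebra_simps)
  ultimately have "2 * n + gb + 1 \<le> 8 * (search_time * search_time)" using search_time sq by linarith
  also have "\<dots> \<le> search_time ^ 3 * search_time ^ 2"
    using power_mono[OF search_time(1), of 3] by (intro mult_le_mono) (auto simp: power2_eq_square)
  also have "\<dots> = search_time ^ 5" by (simp add: power_add[symmetric])
  also have "\<dots> \<le> search_time ^ (space_exp + 5)" by (rule pow_mono) simp
  finally have "2 * n + gb + glen + 1 \<le> 2 * search_time ^ (space_exp + 5)" using glen_le by linarith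
  also have "\<dots> < 8 * search_time ^ (space_exp + 5)" using search_time(1) by simp
  also have "\<dots> \<le> search_time ^ 3 * search_time ^ (space_exp + 5)" using power_mono[OF search_time(1), of 3] by (intro mult_le_mono) auto
  finally show ?thesis by (simp add: power_add[symmetric] add.commute)
qed

lemma word_capacity_le: "2 ^ (c * floorlog 2 glen) < search_time ^ ((space_exp + 5) * c + 1)"
proof -
  have glen: "0 < glen" by (simp add: glen_def)
  then have "0 < floorlog 2 glen" by (auto simp: floorlog_def)
  then have "(2::nat) ^ floorlog 2 glen = 2 * 2 ^ (floorlog 2 glen - 1)"
    by (metis Suc_diff_1 power_Suc)
  also have "\<dots> \<le> 2 * glen" using floorlog_bounds[of glen 2] glen by simp
  finally have "2 ^ floorlog 2 glen \<le> search_time ^ (space_exp + 5)" using glen_le by linarith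
  then have "(2 ^ floorlog 2 glen) ^ c \<le> (search_time ^ (space_exp + 5)) ^ c" by (rule power_mono) simp
  then have "2 ^ (c * floorlog 2 glen) \<le> search_time ^ ((space_exp + 5) * c)"
    by (simp only: power_mult[symmetric] mult.commute[of c])
  also have "\<dots> < search_time ^ ((space_exp + 5) * c + 1)" using search_time(1) by (intro power_strict_increasing) auto
  finally show ?thesis .
qed

end

text \<open>The first factor is an exponent \<open>b\<close> such that
  \<open>search_time ^ b\<close> exceeds all cells, variables and simulated words; the sum of
  degrees dominates each degree. Neither depends on the formula.\<close>

definition sat_word_factor :: "nat \<Rightarrow> nat \<Rightarrow> nat" where
  "sat_word_factor K c = ((2 + K + 3 * K + (K + 2) * K + 8) * (c + 1) + 1) * (\<Sum>x\<leftarrow>exprs K c. deg x)"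

context cnf_reduction
begin

lemma distinguisher_decides_encoded:
  assumes P: "distinguishes_diameter (2 * K + 1) (4 * K + 1) P c T" and c: "0 < c"
    and u: "prelude_time c + 3 * T (5 * V) + 3 \<le> u"
  shows "answers_within (word_length (sat_word_factor K c) (2 ^ n * length (encode_cnf n \<phi>)))
    (prelude K c @ sim_prog 9 15 P @ negate_answer) (encode_cnf n \<phi>) u (satisfiable \<phi>)"
proof -
  define b where "b = (space_exp + 8) * (c + 1) + 1"
  have b: "space_exp + 8 \<le> b" "(space_exp + 5) * c + 1 \<le> b" by (simp_all add: b_def algebra_simps)
  have 1: "2 * n + gb + glen + 1 < search_time ^ b" using space_le pow_mono[OF b(1)] by linarith
  have 2: "2 ^ (c * floorlog 2 glen) < search_time ^ b" using word_capacity_le pow_mono[OF b(2)] by (rule less_le_trans)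
  have "(search_time ^ b) ^ deg x \<le> 2 ^ word_length (sat_word_factor K c) search_time" if "x \<in> set (exprs K c)" for x
  proof -
    have "search_time < 2 ^ floorlog 2 search_time" using floorlog_bounds[of search_time 2] search_time(1) by simp
    then have "search_time ^ (b * deg x) \<le> (2 ^ floorlog 2 search_time) ^ (b * deg x)" by (intro power_mono) auto
    also have "\<dots> = 2 ^ (floorlog 2 search_time * (b * deg x))" by (rule power_mult[symmetric])
    also have "\<dots> \<le> 2 ^ word_length (sat_word_factor K c) search_time"
    proof (rule power_increasing)
      have "deg x \<le> (\<Sum>x\<leftarrow>exprs K c. deg x)" using that by (simp add: member_le_sum_list)
      then have "b * deg x \<le> sat_word_factor K c"
        unfolding sat_word_factor_def b_def space_exp_def by (rule mult_le_mono2)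
      then have "floorlog 2 search_time * (b * deg x) \<le> floorlog 2 search_time * sat_word_factor K c" by (rule mult_le_mono2)
      then show "floorlog 2 search_time * (b * deg x) \<le> word_length (sat_word_factor K c) search_time"
        by (simp add: word_length_def mult.commute)
    qed simp
    finally show ?thesis by (simp add: power_mult)
  qed
  from distinguisher_decides[OF P c 1 2 this u] show ?thesis
    by (simp add: search_time_def xs_def)
qed

end

text \<open>Stated outside the locale so that \<open>C\<close> and \<open>h\<close> are chosen
  before the formula.\<close>

lemma prelude_time_poly:
  "\<exists>C h. \<forall>n \<phi>. cnf_over n \<phi> \<longrightarrow> 1 \<le> K \<longrightarrow>
    cnf_reduction.prelude_time K n \<phi> c \<le> C * (n + 1) ^ h * kov_graph.V K (cnf_reduction.Nv K n) (cnf_reduction.Dc K \<phi>)"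
proof -
  obtain C1 h1 C2 h2 C3 h3 C4 h4 C5 h5 where C:
    "\<And>S. costs S (dims K) \<le> C1 * (S + 1) ^ h1" "\<And>S. cost S eStart \<le> C2 * (S + 1) ^ h2"
    "\<And>S. cost S eHeader \<le> C3 * (S + 1) ^ h3" "\<And>S. cost S (eCell K) \<le> C4 * (S + 1) ^ h4"
    "\<And>S. cost S (EBin MUL xi xDx) \<le> C5 * (S + 1) ^ h5"
    using costs_poly[of "dims K"] cost_poly[of eStart] cost_poly[of eHeader] cost_poly[of "eCell K"]
      cost_poly[of "EBin MUL xi xDx"] by blast
  define D where "D = C1 + C2 + 3 * C3 + 10 * C4 + C5 + 1000"
  define h where "h = h1 + h2 + h3 + h4 + h5"
  have "cnf_reduction.prelude_time K n \<phi> c \<le>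
      (D * 2 ^ h) * (n + 1) ^ h * kov_graph.V K (cnf_reduction.Nv K n) (cnf_reduction.Dc K \<phi>)"
    if "cnf_over n \<phi>" "1 \<le> K" for n \<phi>
  proof -
    interpret cnf_reduction K n \<phi> using that by unfold_locales
    have "(2 * n + 1) ^ h \<le> (2 * (n + 1)) ^ h" by (rule power_mono) auto
    also have "\<dots> = 2 ^ h * (n + 1) ^ h" by (rule power_mult_distrib)
    finally have le: "D * (2 * n + 1) ^ h * V \<le> D * (2 ^ h * (n + 1) ^ h) * V"
      by (intro mult_le_mono1 mult_le_mono2)
    have "prelude_time c \<le> D * (2 * n + 1) ^ h * V"
      unfolding D_def h_def by (rule prelude_time_le[OF C])
    then show ?thesis using le by (simp only: mult.assoc)
  qed
  then show ?thesis by blast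
qed

text \<open>The finitely many exceptions are absorbed by adding their sum to the constant;
  \<open>T\<close> need not be monotone.\<close>

lemma bigo_powr_bound:
  assumes "(\<lambda>m. real (T m)) \<in> O(\<lambda>m. real m powr g)" "g \<le> g'" "0 \<le> g'"
  shows "\<exists>A > 0. \<forall>m \<ge> 1. real (T m) \<le> A * real m powr g'"
proof -
  obtain c where c: "0 < c" "\<forall>\<^sub>F m in at_top. norm (real (T m)) \<le> c * norm (real m powr g)"
    using assms(1) by (elim landau_o.bigE)
  then obtain n0 where n0: "\<And>m. n0 \<le> m \<Longrightarrow> real (T m) \<le> c * real m powr g"
    unfolding eventually_at_top_linorder by auto
  define s where "s = (\<Sum>m < n0. real (T m))"
  have s: "0 \<le> s" unfolding s_def by (intro sum_nonneg) simp
  have "real (T m) \<le> (c + s) * real m powr g'" if m: "1 \<le> m" for m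
  proof (cases "n0 \<le> m")
    case True
    have "real (T m) \<le> c * real m powr g" using n0[OF True] .
    also have "\<dots> \<le> (c + s) * real m powr g'"
      using m assms(2) c(1) s by (intro mult_mono powr_mono) auto
    finally show ?thesis .
  next
    case False
    then have "real (T m) \<le> s" unfolding s_def by (intro member_le_sum) auto
    also have "\<dots> \<le> (c + s) * 1" using c(1) by simp
    also have "\<dots> \<le> (c + s) * real m powr g'"
      using m assms(3) c(1) s by (intro mult_left_mono ge_one_powr_ge_zero) auto
    finally show ?thesis .
  qed
  then show ?thesis using c(1) s by (intro exI[of _ "c + s"]) auto
qed

lemma (in cnf_reduction) V_bound:
  assumes "length \<phi> \<le> L * n"
  shows "real V \<le> real (2 * (K + 1) * (4 * (L + K + 1)) ^ K) * real (n + 1) ^ K *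
    2 powr (real K / real (K + 1) * real n)"
proof -
  have "real (n div (K + 1) * (K + 1)) \<le> real n" by (rule of_nat_mono) (rule div_times_less_eq_dividend)
  then have "real (n div (K + 1)) \<le> real n / real (K + 1)" by (simp only: of_nat_mult pos_le_divide_eq)
  then have "2 powr real (n div (K + 1)) \<le> 2 powr (real n / real (K + 1))" by (intro powr_mono) auto
  then have N: "real Nv \<le> 4 * 2 powr (real n / real (K + 1))"
    unfolding Nv_def q_def by (simp add: powr_realpow)
  have "Dc \<le> L * n + (K + 1)" using assms by (simp add: Dc_def)
  also have "\<dots> \<le> (L + K + 1) * (n + 1)" by (simp add: algebra_simps)
  finally have D: "real Dc \<le> real ((L + K + 1) * (n + 1))" by (rule of_nat_mono)
  have "real V = real (2 * (K + 1)) * (real Nv * real Dc) ^ K"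
    by (simp add: V_def Ny_def Dx_def power_mult_distrib algebra_simps)
  also have "\<dots> \<le> real (2 * (K + 1)) *
      (4 * 2 powr (real n / real (K + 1)) * real ((L + K + 1) * (n + 1))) ^ K"
    using N D by (intro mult_left_mono power_mono mult_mono) auto
  also have "\<dots> = real (2 * (K + 1)) * (real (4 * (L + K + 1)) ^ K * real (n + 1) ^ K *
      (2 powr (real n / real (K + 1))) ^ K)"
    by (simp only: of_nat_mult power_mult_distrib) (simp add: mult_ac)
  also have "(2 powr (real n / real (K + 1))) ^ K = 2 powr (real K / real (K + 1) * real n)"
    by (simp add: powr_realpow[symmetric] powr_powr mult_ac)
  finally show ?thesis by (simp only: of_nat_mult of_nat_power mult.assoc)
qed

text \<open>Both parts take \<open>2 powr ((1 - \<eta>) * n)\<close> up to polynomial factors: the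
  distinguisher by the choice of \<open>\<eta>\<close>, the prelude, linear in \<open>V\<close>,
  because of \<open>1 \<le> g\<close>. Half of \<open>\<eta>\<close> pays for the
  polynomial.\<close>

lemma total_time_bound:
  assumes K: "1 \<le> K" and T: "0 < A" "\<And>m. 1 \<le> m \<Longrightarrow> real (T m) \<le> A * real m powr g"
    and g: "1 \<le> g" "g \<le> 2" and \<eta>: "0 < \<eta>" "real K / real (K + 1) * g = 1 - \<eta>"
  shows "\<exists>C. \<forall>n \<phi>. cnf_over n \<phi> \<longrightarrow> length \<phi> \<le> L * n \<longrightarrow>
    real (cnf_reduction.prelude_time K n \<phi> c +
      3 * T (5 * kov_graph.V K (cnf_reduction.Nv K n) (cnf_reduction.Dc K \<phi>)) + 3)
    \<le> C * (2 powr (1 - \<eta> / 2)) ^ n"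
proof -
  obtain C1 h where C1: "\<And>n \<phi>. cnf_over n \<phi> \<Longrightarrow> cnf_reduction.prelude_time K n \<phi> c
      \<le> C1 * (n + 1) ^ h * kov_graph.V K (cnf_reduction.Nv K n) (cnf_reduction.Dc K \<phi>)"
    using prelude_time_poly[of K c] K by blast
  define C2 where "C2 = real (2 * (K + 1) * (4 * (L + K + 1)) ^ K)"
  have C2: "1 \<le> C2"
  proof -
    have "1 \<le> (4 * (L + K + 1)) ^ K" by simp
    then have "1 * 1 \<le> 2 * (K + 1) * (4 * (L + K + 1)) ^ K" by (intro mult_le_mono) auto
    then show ?thesis unfolding C2_def by linarith
  qed
  have "1 < 2 powr (\<eta> / 2)" using \<eta>(1) by simp
  from poly_le_exp[OF this, of "h + 2 * K"] obtain C3
    where C3: "0 < C3" "\<And>n. real (n + 1) ^ (h + 2 * K) \<le> C3 * (2 powr (\<eta> / 2)) ^ n" by blast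
  define D where "D = real C1 * C2 + 3 * (A * (5 * C2) ^ 2) + 3"
  have D_nonneg: "0 \<le> D" using C2 T(1) by (simp add: D_def)
  have "real (cnf_reduction.prelude_time K n \<phi> c +
      3 * T (5 * kov_graph.V K (cnf_reduction.Nv K n) (cnf_reduction.Dc K \<phi>)) + 3)
    \<le> D * C3 * (2 powr (1 - \<eta> / 2)) ^ n" if cnf: "cnf_over n \<phi>" and L: "length \<phi> \<le> L * n" for n \<phi>
  proof -
    interpret cnf_reduction K n \<phi> using K cnf by unfold_locales
    define x where "x = real (n + 1)"
    define y where "y = 2 powr ((1 - \<eta>) * real n)"
    have x: "1 \<le> x" by (simp add: x_def)
    have e1: "1 - \<eta> = real K / real (K + 1) * g" using \<eta>(2) by simp
    then have "real K / real (K + 1) * 1 \<le> 1 - \<eta>" using g(1) by (intro order_trans[OF mult_left_mono[OF g(1)]]) auto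
    then have e2: "real K / real (K + 1) * real n \<le> (1 - \<eta>) * real n" by (intro mult_right_mono) auto
    have "0 \<le> (1 - \<eta>) * real n" unfolding e1 using g(1) by (intro mult_nonneg_nonneg) auto
    then have y: "1 \<le> y" unfolding y_def by (intro ge_one_powr_ge_zero) auto
    have V0: "1 \<le> V" using V_bounds(5) by linarith
    have V: "real V \<le> C2 * x ^ K * 2 powr (real K / real (K + 1) * real n)"
      using V_bound[OF L] by (simp add: C2_def x_def)
    also have "\<dots> \<le> C2 * x ^ K * y"
      unfolding y_def using e2 C2 x by (intro mult_left_mono powr_mono) auto
    finally have Vy: "real V \<le> C2 * x ^ K * y" .
    have xp: "x ^ i \<le> x ^ (h + 2 * K)" if "i \<le> h + 2 * K" for i
      using x that by (rule power_increasing[rotated])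
    have "real (prelude_time c) \<le> real (C1 * (n + 1) ^ h * V)"
      using C1[OF cnf] by (rule of_nat_mono)
    also have "\<dots> = real C1 * x ^ h * real V" by (simp add: x_def)
    also have "\<dots> \<le> real C1 * x ^ h * (C2 * x ^ K * y)"
      using Vy x by (intro mult_left_mono) auto
    also have "\<dots> = real C1 * C2 * y * x ^ (h + K)" by (simp add: power_add)
    also have "\<dots> \<le> real C1 * C2 * y * x ^ (h + 2 * K)"
      using C2 y by (intro mult_left_mono xp) auto
    finally have t1: "real (prelude_time c) \<le> real C1 * C2 * (y * x ^ (h + 2 * K))" by (simp add: mult_ac)
    have X: "1 \<le> 5 * C2 * x ^ K"
    proof -
      have "1 * 1 \<le> (5 * C2) * x ^ K" using C2 x by (intro mult_mono) auto
      then show ?thesis by simp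
    qed
    have "real (T (5 * V)) \<le> A * real (5 * V) powr g" using V0 by (intro T(2)) simp
    also have "\<dots> \<le> A * (5 * C2 * x ^ K * 2 powr (real K / real (K + 1) * real n)) powr g"
      using V T(1) g by (intro mult_left_mono powr_mono2) auto
    also have "\<dots> = A * ((5 * C2 * x ^ K) powr g * y)"
      using C2 x e1 by (simp add: powr_mult powr_powr y_def mult_ac)
    \<comment> \<open>\<open>g \<le> 2\<close> replaces the real exponent of the polynomial part by
      a natural one.\<close>
    also have "\<dots> \<le> A * ((5 * C2 * x ^ K) powr 2 * y)"
      using T(1) y g X by (intro mult_left_mono mult_right_mono powr_mono) auto
    also have "(5 * C2 * x ^ K) powr 2 = (5 * C2 * x ^ K) ^ 2"
      using X by (intro powr_numeral) simp
    also have "\<dots> = (5 * C2) ^ 2 * x ^ (2 * K)"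
      by (simp add: power_mult_distrib power_mult[symmetric] mult.commute)
    also have "A * ((5 * C2) ^ 2 * x ^ (2 * K) * y) \<le> A * ((5 * C2) ^ 2 * x ^ (h + 2 * K) * y)"
      using T(1) y by (intro mult_left_mono mult_right_mono xp) auto
    finally have t2: "real (T (5 * V)) \<le> A * (5 * C2) ^ 2 * (y * x ^ (h + 2 * K))" by (simp add: mult_ac)
    have "1 * 1 \<le> y * x ^ (h + 2 * K)" using y x by (intro mult_mono) auto
    then have "real (prelude_time c + 3 * T (5 * V) + 3) \<le> D * (y * x ^ (h + 2 * K))"
      using t1 t2 unfolding D_def distrib_right by simp
    also have "\<dots> \<le> D * (y * (C3 * (2 powr (\<eta> / 2)) ^ n))"
      using D_nonneg y C3(2)[of n] by (intro mult_left_mono) (auto simp: x_def)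
    also have "\<dots> = D * C3 * (2 powr (1 - \<eta> / 2)) ^ n"
      by (simp add: y_def powr_realpow[symmetric] powr_powr powr_add[symmetric] algebra_simps)
    finally show ?thesis .
  qed
  then show ?thesis by blast
qed

theorem theorem33:
  assumes "SETH"
  shows "\<forall>k::nat. k \<ge> 2 \<longrightarrow>
    (\<forall>P c T. 0 < c \<and> distinguishes_diameter (2 * k - 1) (4 * k - 3) P c T \<longrightarrow>
      (\<forall>\<delta>::real. \<delta> > 0 \<longrightarrow>
        (\<lambda>m. real (T m)) \<notin> O(\<lambda>m. real m powr (1 + 1 / (real k - 1) - \<delta>))))"
proof (intro allI impI notI)
  fix k :: nat and P c T and \<delta> :: real
  assume k: "2 \<le> k" and P: "0 < c \<and> distinguishes_diameter (2 * k - 1) (4 * k - 3) P c T" and \<delta>: "0 < \<delta>"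
    and O: "(\<lambda>m. real (T m)) \<in> O(\<lambda>m. real m powr (1 + 1 / (real k - 1) - \<delta>))"
  define K where "K = k - 1"
  have K: "1 \<le> K" "real k - 1 = real K" "2 * k - 1 = 2 * K + 1" "4 * k - 3 = 4 * K + 1"
    using k by (simp_all add: K_def)
  note gap = K(3,4)
  \<comment> \<open>A smaller saving weakens the assumed bound, so capping is harmless; it keeps
    \<open>g\<close> at least 1, and writing the graph then fits into the same bound.\<close>
  define \<delta>' where "\<delta>' = min \<delta> (1 / real K)"
  define g where "g = 1 + 1 / real K - \<delta>'"
  define \<eta> where "\<eta> = real K / real (K + 1) * \<delta>'"
  have \<delta>': "0 < \<delta>'" "\<delta>' \<le> \<delta>" "\<delta>' \<le> 1 / real K" using \<delta> K(1) by (simp_all add: \<delta>'_def)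
  have "1 / real K \<le> 1" using K(1) by simp
  then have g: "1 \<le> g" "g \<le> 2" using \<delta>' unfolding g_def by linarith+
  have "1 + 1 / real K = real (K + 1) / real K" using K(1) by (simp add: add_divide_distrib)
  then have "real K / real (K + 1) * (1 + 1 / real K) = 1" using K(1) by simp
  then have \<eta>: "real K / real (K + 1) * g = 1 - \<eta>"
    unfolding g_def \<eta>_def by (simp only: right_diff_distrib)
  have \<eta>0: "0 < \<eta>"
    unfolding \<eta>_def using \<delta>'(1) K(1) by (intro mult_pos_pos divide_pos_pos) auto
  have "real K / real (K + 1) \<le> 1" "\<delta>' \<le> 1" using \<delta>'(3) \<open>1 / real K \<le> 1\<close> by simp_all
  then have "\<eta> \<le> 1 * 1" unfolding \<eta>_def using \<delta>'(1) by (intro mult_mono) auto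
  then have \<eta>1: "\<eta> \<le> 1" by simp
  obtain A where A: "0 < A" "\<And>m. 1 \<le> m \<Longrightarrow> real (T m) \<le> A * real m powr g"
    using bigo_powr_bound[OF O, of g] g \<delta>'(2) unfolding g_def K(2) by auto
  define x where "x = 2 powr (1 - \<eta> / 2)"
  define Q where "Q = prelude K c @ sim_prog 9 15 P @ negate_answer"
  have x: "1 \<le> x" unfolding x_def using \<eta>1 by (intro ge_one_powr_ge_zero) auto
  have "x < 2 powr 1" unfolding x_def using \<eta>0 by (intro powr_less_mono) auto
  then have x2: "x < 2" by simp
  \<comment> \<open>To refute \<open>SETH\<close>, program and word factor must be fixed before the
    clause ratio \<open>L\<close>; only the time bound \<open>T'\<close> depends on
    \<open>L\<close>.\<close>
  have "\<exists>T'. (\<lambda>n. real (T' n)) \<in> O(\<lambda>n. (2 - (2 - x)) ^ n) \<and> decides_sparse_sat L Q (sat_word_factor K c) T'" for L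
  proof -
    obtain C where C: "\<And>n \<phi>. cnf_over n \<phi> \<Longrightarrow> length \<phi> \<le> L * n \<Longrightarrow>
      real (cnf_reduction.prelude_time K n \<phi> c +
        3 * T (5 * kov_graph.V K (cnf_reduction.Nv K n) (cnf_reduction.Dc K \<phi>)) + 3) \<le> C * x ^ n"
      using total_time_bound[OF K(1) A g \<eta>0 \<eta>, of L c] unfolding x_def by blast
    define T' where "T' n = nat \<lceil>C * x ^ n\<rceil>" for n
    have "norm (real (T' n)) \<le> (\<bar>C\<bar> + 1) * norm (x ^ n)" for n
    proof -
      have xn: "1 \<le> x ^ n" using x by simp
      have "real (T' n) \<le> \<bar>C * x ^ n\<bar> + 1" unfolding T'_def by linarith
      also have "\<bar>C * x ^ n\<bar> = \<bar>C\<bar> * x ^ n" using xn by (simp add: abs_mult)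
      finally show ?thesis using xn by (simp add: distrib_right)
    qed
    then have "(\<lambda>n. real (T' n)) \<in> O(\<lambda>n. (2 - (2 - x)) ^ n)"
      by (intro bigoI[of _ "\<bar>C\<bar> + 1"] always_eventually) simp
    moreover have "decides_sparse_sat L Q (sat_word_factor K c) T'"
      unfolding decides_sparse_sat_def
    proof (intro allI impI)
      fix n \<phi> assume \<phi>: "cnf_over n \<phi> \<and> length \<phi> \<le> L * n"
      interpret cnf_reduction K n \<phi> using K(1) \<phi> by unfold_locales auto
      have "prelude_time c + 3 * T (5 * V) + 3 \<le> T' n"
        using C[of n \<phi>] \<phi> unfolding T'_def by linarith
      then show "answers_within (word_length (sat_word_factor K c) (2 ^ n * length (encode_cnf n \<phi>)))
          Q (encode_cnf n \<phi>) (T' n) (satisfiable \<phi>)"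
        using P unfolding gap Q_def by (intro distinguisher_decides_encoded) auto
    qed
    ultimately show ?thesis by blast
  qed
  moreover have "0 < 2 - x" "2 - x < 2" using x x2 by linarith+
  moreover have "0 < sat_word_factor K c"
  proof -
    have "0 < (\<Sum>x\<leftarrow>exprs K c. deg x)" by (simp add: exprs_def dims_def)
    then show ?thesis by (simp add: sat_word_factor_def)
  qed
  ultimately show False using assms unfolding SETH_def by blast
qed

end
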